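(* Let $\bar x=\operatorname{col}(\bar x_c,\bar\varphi,\bar p_g,\bar E_g,\bar E_l)$ be an equilibrium of the closed-loop power network/market system described in the context, let $\bar H$ be the associated shifted Hamiltonian defined in the context, and consider the closed-loop system of differential-algebraic equations written in shifted form, after elimination of the load frequencies $\omega_l$: $$ \begin{bmatrix}\dot x_c\\ \dot\varphi\\ \dot p_g\\ \dot E_g\\ 0\end{bmatrix} = \begin{bmatrix} J_c-G_2^TA_l^{-1}G_2 & -G_2^TA_l^{-1}\hat D_l & -G_1^T & 0 & 0\\ -\hat D_l^TA_l^{-1}G_2 & -\hat D_l^TA_l^{-1}\hat D_l & \hat D_g^T & 0 & 0\\ G_1 & -\hat D_g & -A_g & 0 & 0\\ 0&0&0&-R_g&0\\ 0&0&0&0&-[E_l] \end{bmatrix}\nabla\bar H(x) + \begin{bmatrix}\nabla S(\tau_c^{-1}x_c)-\nabla S(\tau_c^{-1}\bar x_c)\\0\\0\\0\\0\end{bmatrix}, $$ with $x=\operatorname{col}(x_c,\varphi,p_g,E_g,E_l)$, differential variables $x_c,\varphi,p_g,E_g$ and algebraic variable $E_l$. Suppose that $D_c\in\mathbb R^{n\times(n-1)}$ is the incidence matrix of a tree graph, and that the equilibrium $\bar x$ satisfies $\nabla^2\bar H(\bar x)>0$ (positive definite). Then $\bar x$ is a locally asymptotically stable equilibrium of this system.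
   Context: **Network.** $\mathcal G=(\mathcal V,\mathcal E)$ is a connected undirected graph with nodes $\mathcal V=\{1,\dots,n\}=\mathcal V_g\cup\mathcal V_l$ (disjoint union of $n_g$ generator nodes and $n_l$ load nodes); $\mathcal N_i$ is the set of neighbours of $i$. Each edge $(i,j)\in\mathcal E$ carries $B_{ij}=B_{ji}$ (negative of the line susceptance), and $B_{ii}=\sum_{j\in\mathcal N_i}B_{ij}+\hat B_{ii}$ with $\hat B_{ii}\ge 0$. Node variables are voltage angles $\delta_i$, frequency deviations $\omega_i$ and voltages $E_i>0$ for $i\in\mathcal V$. Write $\delta_{ij}=\delta_i-\delta_j$. Subscripts $g$ and $l$ denote stacked vectors over $\mathcal V_g$ and $\mathcal V_l$ (e.g. $\omega_g,\omega_l,E_g,E_l,P_g,P_l$); matrices with $n$ rows are partitioned accordingly. $[E_l]=\operatorname{diag}_{i\in\mathcal V_l}\{E_i\}$. $\operatorname{col}(\cdot)$ denotes stacking into a column vector. The network dynamics are $$\begin{aligned} \dot\delta_i&=\omega_i, && i\in\mathcal V,\\ M_i\dot\omega_i&=-P_i-A_i\omega_i+P_{gi}, && i\in\mathcal V_g,\\ T_i\dot E_i&=E_{fi}-E_i-(X_{di}-X_{di}')E_i^{-1}Q_i, && i\in\mathcal V_g,\\ P_i&=-A_i\omega_i-P_{li}, && i\in\mathcal V_l,\\ Q_i&=\bar Q_{li}, && i\in\mathcal V_l, \end{aligned}$$ where $P_i=\sum_{j\in\mathcal N_i}B_{ij}E_iE_j\sin\delta_{ij}$ and $Q_i=B_{ii}E_i^2-\sum_{j\in\mathcal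 N_i}B_{ij}E_iE_j\cos\delta_{ij}$. The constants satisfy $M_i,A_i,T_i>0$, $X_{di}-X_{di}'>0$; the excitation voltages $E_{fi}$ and the reactive powers $\bar Q_{li}\ge0$ are constant. Put $A_g=\operatorname{diag}_{i\in\mathcal V_g}\{A_i\}$, $A_l=\operatorname{diag}_{i\in\mathcal V_l}\{A_i\}$, $R_g=\operatorname{diag}_{i\in\mathcal V_g}\{(X_{di}-X_{di}')/T_i\}$, $\bar Q_l=\operatorname{col}_{i\in\mathcal V_l}\{\bar Q_{li}\}$. **Coordinates.** $\hat D\in\mathbb R^{n\times(n-1)}$ is a fixed matrix of full column rank with $\ker\hat D^T=\operatorname{span}\{\mathbf 1_n\}$, partitioned as $\hat D^T=[\hat D_g^T\ \ \hat D_l^T]$; $\varphi=\hat D^T\delta$ (so each $\delta_{ij}$ is a linear function of $\varphi$); $p_i=M_i\omega_i$ for $i\in\mathcal V_g$; $x_p=\operatorname{col}(\varphi,p_g,E_g,E_l)$. The Hamiltonian is $$H_p(x_p)=\tfrac12\sum_{i\in\mathcal V_g}\Big(M_i^{-1}p_i^2+\tfrac{(E_i-E_{fi})^2}{X_{di}-X_{di}'}\Big)+\tfrac12\sum_{i\in\mathcal V}B_{ii}E_i^2-\sum_{(i,j)\in\mathcal E}B_{ij}E_iE_j\cos\delta_{ij},$$ each edge being counted once in the last sum. **Market dynamics.** $C(P_g)$ is a strictly convex cost function and $U(P_l)$ a strictly concave utility function, both twice continuously differentiable; $S=U(P_l)-C(P_g)$. $D_c=\begin{bmatrix} D_{cg}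 \\ D_{cl} \end{bmatrix}\in\mathbb R^{n\times m_c}$ is the incidence matrix of a connected communication graph on $\mathcal V$ with $m_c$ edges (with arbitrary edge orientation). The pricing algorithm is $$\begin{aligned} \tau_g\dot P_g&=-\nabla C(P_g)+\lambda_g-\omega_g, & \tau_l\dot P_l&=\nabla U(P_l)-\lambda_l+\omega_l, & \tau_v\dot v&=-D_{cg}^T\lambda_g-D_{cl}^T\lambda_l,\\ \tau_{\lambda_g}\dot\lambda_g&=D_{cg}v-P_g, & \tau_{\lambda_l}\dot\lambda_l&=D_{cl}v+P_l, \end{aligned}$$ where $\tau_g,\tau_l,\tau_v,\tau_{\lambda_g},\tau_{\lambda_l}$ are symmetric positive definite matrices (or positive scalars). Let $z_c=\operatorname{col}(P_g,P_l,v,\lambda_g,\lambda_l)$, $\tau_c=\operatorname{blockdiag}(\tau_g,\tau_l,\tau_v,\tau_{\lambda_g},\tau_{\lambda_l})$, $x_c=\tau_cz_c$, $H_c(x_c)=\frac12x_c^T\tau_c^{-1}x_c$. $S$ is regarded as a function of $z_c$, so that $\nabla S(z_c)=\operatorname{col}(-\nabla C(P_g),\nabla U(P_l),0,0,0)$. Let $$J_c=\begin{bmatrix}0&0&0&I_{n_g}&0\\0&0&0&0&-I_{n_l}\\0&0&0&-D_{cg}^T&-D_{cl}^T\\-I_{n_g}&0&D_{cg}&0&0\\0&I_{n_l}&D_{cl}&0&0\end{bmatrix},\quad G_1=[I_{n_g}\ 0\ 0\ 0\ 0],\quad G_2=[0\ I_{n_l}\ 0\ 0\ 0].$$ **Closed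 loop and shifted Hamiltonian.** The closed-loop system is the network dynamics (in coordinates $\varphi,p_g,E_g,E_l,\omega_l$) coupled with the pricing algorithm through $P_g,P_l,\omega_g,\omega_l$. Let $(\bar x_c,\bar x_p,\bar\omega_l)$ be an equilibrium of it, with all voltages $\bar E_i>0$; write $\bar x=\operatorname{col}(\bar x_c,\bar x_p)$. Define $$\bar H_p(x_p)=H_p(x_p)-(x_p-\bar x_p)^T\nabla H_p(\bar x_p)-H_p(\bar x_p),$$ and likewise $\bar H_c(x_c)=H_c(x_c)-(x_c-\bar x_c)^T\nabla H_c(\bar x_c)-H_c(\bar x_c)$. Let $\bar H_a(x_p)=E_l^T\nabla_{E_l}H_p(\bar x_p)-\bar Q_l^T\log E_l$ with element-wise logarithm, and $$\bar H(x)=\bar H_p(x_p)+\bar H_a(x_p)+\bar H_c(x_c),\qquad x=\operatorname{col}(x_c,x_p).$$ The eliminated load frequencies are given by $\omega_l=-A_l^{-1}\big(G_2\nabla_{x_c}\bar H+\hat D_l\nabla_\varphi\bar H\big)$, and the displayed system in the claim is then equivalent to the closed loop. The state space is the region where all $E_i>0$, $i\in\mathcal V$. **Stability notion.** Local asymptotic stability of an equilibrium of the differential-algebraic system is in the usual Lyapunov sense, for solutions starting from initial conditions that satisfy the algebraic constraint. *)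

theory Defs
  imports "HOL-Analysis.Analysis"
begin

section \<open>Calculus\<close>

definition grad :: "('a::euclidean_space \<Rightarrow> real) \<Rightarrow> 'a \<Rightarrow> 'a" where
  "grad f x = (THE D. GDERIV f x :> D)"

text \<open>The Hessian at \<open>x\<close>, as the linear map \<open>h \<mapsto> \<nabla>\<^sup>2f(x) h\<close>.\<close>

definition hessian :: "('a::euclidean_space \<Rightarrow> real) \<Rightarrow> 'a \<Rightarrow> 'a \<Rightarrow> 'a" where
  "hessian f x = frechet_derivative (grad f) (at x)"

definition positive_definite :: "('a::euclidean_space \<Rightarrow> 'a) \<Rightarrow> bool" where
  "positive_definite L \<longleftrightarrow> (\<forall>h. h \<noteq> 0 \<longrightarrow> 0 < h \<bullet> L h)"

definition sym_pos_def_matrix :: "real^'n^'n \<Rightarrow> bool" where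
  "sym_pos_def_matrix M \<longleftrightarrow> transpose M = M \<and> positive_definite (\<lambda>h. M *v h)"

definition twice_continuously_differentiable :: "('a::euclidean_space \<Rightarrow> real) \<Rightarrow> bool" where
  "twice_continuously_differentiable f \<longleftrightarrow>
     (\<exists>g. \<exists>H :: 'a \<Rightarrow> 'a \<Rightarrow>\<^sub>L 'a.
        (\<forall>x. GDERIV f x :> g x) \<and>
        (\<forall>x. (g has_derivative blinfun_apply (H x)) (at x)) \<and>
        continuous_on UNIV H)"

definition strictly_convex :: "('a::euclidean_space \<Rightarrow> real) \<Rightarrow> bool" where
  "strictly_convex f \<longleftrightarrow>
     (\<forall>x y. \<forall>t::real. x \<noteq> y \<and> 0 < t \<and> t < 1 \<longrightarrow>
        f ((1 - t) *\<^sub>R x + t *\<^sub>R y) < (1 - t) * f x + t * f y)"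

definition strictly_concave :: "('a::euclidean_space \<Rightarrow> real) \<Rightarrow> bool" where
  "strictly_concave f \<longleftrightarrow> strictly_convex (\<lambda>x. - f x)"

definition shifted :: "('a::euclidean_space \<Rightarrow> real) \<Rightarrow> 'a \<Rightarrow> 'a \<Rightarrow> real" where
  "shifted H xbar x = H x - (x - xbar) \<bullet> grad H xbar - H xbar"

definition diag_mat :: "real^'n \<Rightarrow> real^'n^'n" where
  "diag_mat v = (\<chi> i j. if i = j then v $ i else 0)"


section \<open>Differential-algebraic systems and stability\<close>

text \<open>
  A system \<open>d/dt (proj x) = F x\<close> on the state space \<open>\<Omega>\<close>, where \<open>proj\<close> is the projection that
  replaces the algebraic variables by \<open>0\<close>; the corresponding components of the equation then
  read \<open>0 = F\<^sub>a x\<close>. The algebraic variables of a solution are only required to be continuous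
  (without continuity they could jump between different branches of the constraint).
\<close>

definition dae_solution ::
  "('x::euclidean_space \<Rightarrow> 'x) \<Rightarrow> ('x \<Rightarrow> 'x) \<Rightarrow> 'x set \<Rightarrow> real set \<Rightarrow> (real \<Rightarrow> 'x) \<Rightarrow> bool" where
  "dae_solution proj F \<Omega> I x \<longleftrightarrow>
     continuous_on I x \<and>
     (\<forall>t\<in>I. x t \<in> \<Omega> \<and>
        ((\<lambda>s. proj (x s)) has_vector_derivative F (x t)) (at t within I))"

definition dae_consistent ::
  "('x::euclidean_space \<Rightarrow> 'x) \<Rightarrow> ('x \<Rightarrow> 'x) \<Rightarrow> 'x set \<Rightarrow> 'x set" where
  "dae_consistent proj F \<Omega> = {x \<in> \<Omega>. F x \<in> range proj}"

definition dae_equilibrium :: "('x::euclidean_space \<Rightarrow> 'x) \<Rightarrow> 'x set \<Rightarrow> 'x \<Rightarrow> bool" where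
  "dae_equilibrium F \<Omega> xbar \<longleftrightarrow> xbar \<in> \<Omega> \<and> F xbar = 0"

text \<open>
  Lyapunov stability includes that consistent initial states near the equilibrium admit a
  solution for all times \<open>t \<ge> 0\<close>, so that the notion cannot hold for lack of solutions. The
  bound concerns all solutions, including those given on a bounded time interval only.
\<close>

definition dae_stable ::
  "('x::euclidean_space \<Rightarrow> 'x) \<Rightarrow> ('x \<Rightarrow> 'x) \<Rightarrow> 'x set \<Rightarrow> 'x \<Rightarrow> bool" where
  "dae_stable proj F \<Omega> xbar \<longleftrightarrow>
     (\<forall>\<epsilon>>0. \<exists>\<delta>>0. \<forall>x0\<in>dae_consistent proj F \<Omega>. dist x0 xbar < \<delta> \<longrightarrow>
        (\<exists>x. dae_solution proj F \<Omega> {0..} x \<and> x 0 = x0) \<and>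
        (\<forall>T>0. \<forall>x. dae_solution proj F \<Omega> {0..T} x \<and> x 0 = x0 \<longrightarrow>
           (\<forall>t\<in>{0..T}. dist (x t) xbar < \<epsilon>)))"

definition dae_attractive ::
  "('x::euclidean_space \<Rightarrow> 'x) \<Rightarrow> ('x \<Rightarrow> 'x) \<Rightarrow> 'x set \<Rightarrow> 'x \<Rightarrow> bool" where
  "dae_attractive proj F \<Omega> xbar \<longleftrightarrow>
     (\<exists>\<delta>>0. \<forall>x0\<in>dae_consistent proj F \<Omega>. dist x0 xbar < \<delta> \<longrightarrow>
        (\<forall>x. dae_solution proj F \<Omega> {0..} x \<and> x 0 = x0 \<longrightarrow> (x \<longlongrightarrow> xbar) at_top))"

definition locally_asymptotically_stable_equilibrium ::
  "('x::euclidean_space \<Rightarrow> 'x) \<Rightarrow> ('x \<Rightarrow> 'x) \<Rightarrow> 'x set \<Rightarrow> 'x \<Rightarrow> bool" where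
  "locally_asymptotically_stable_equilibrium proj F \<Omega> xbar \<longleftrightarrow>
     dae_equilibrium F \<Omega> xbar \<and> dae_stable proj F \<Omega> xbar \<and> dae_attractive proj F \<Omega> xbar"


section \<open>Graphs\<close>

text \<open>
  A simple undirected graph on the vertex type is a set of pairs that contains each edge once,
  in an arbitrary orientation.
\<close>

definition simple_graph :: "('v \<times> 'v) set \<Rightarrow> bool" where
  "simple_graph E \<longleftrightarrow> (\<forall>i j. (i, j) \<in> E \<longrightarrow> i \<noteq> j \<and> (j, i) \<notin> E)"

definition adjacency :: "('v \<times> 'v) set \<Rightarrow> ('v \<times> 'v) set" where
  "adjacency E = E \<union> E\<inverse>"

definition neighbours :: "('v \<times> 'v) set \<Rightarrow> 'v \<Rightarrow> 'v set" where
  "neighbours E i = {j. (i, j) \<in> adjacency E}"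

definition connected_graph :: "('v \<times> 'v) set \<Rightarrow> bool" where
  "connected_graph E \<longleftrightarrow> (\<forall>i j. (i, j) \<in> (adjacency E)\<^sup>*)"

definition graph_cycle :: "('v \<times> 'v) set \<Rightarrow> 'v list \<Rightarrow> bool" where
  "graph_cycle E vs \<longleftrightarrow> 3 \<le> length vs \<and> distinct vs \<and>
     (\<forall>k<length vs. (vs ! k, vs ! (Suc k mod length vs)) \<in> adjacency E)"

definition tree_graph :: "('v \<times> 'v) set \<Rightarrow> bool" where
  "tree_graph E \<longleftrightarrow> simple_graph E \<and> connected_graph E \<and> (\<nexists>vs. graph_cycle E vs)"

definition incidence_matrix :: "('v::finite \<times> 'v) set \<Rightarrow> real^'m^'v \<Rightarrow> bool" where
  "incidence_matrix E D \<longleftrightarrow>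
     (\<exists>e :: 'm \<Rightarrow> 'v \<times> 'v. bij_betw e UNIV E \<and>
        D = (\<chi> i k. if i = fst (e k) then 1 else if i = snd (e k) then - 1 else 0))"


section \<open>Power network and market\<close>

text \<open>
  Generator nodes form the type \<open>'g\<close>, load nodes the type \<open>'l\<close>, all nodes the type \<open>'g + 'l\<close>.
  The type \<open>'k\<close> indexes the coordinates of \<open>\<phi>\<close> and the type \<open>'m\<close> the communication edges.
\<close>

record ('g::finite, 'l::finite, 'k::finite, 'm::finite) power_market =
  edges :: "(('g + 'l) \<times> ('g + 'l)) set"
  Bc :: "'g + 'l \<Rightarrow> 'g + 'l \<Rightarrow> real"
  Bhat :: "'g + 'l \<Rightarrow> real"
  Mg :: "real^'g"
  An :: "real^('g + 'l)"
  Tg :: "real^'g"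
  Xd :: "real^'g"
  Xd' :: "real^'g"
  Ef :: "real^'g"
  Qbar :: "real^'l"
  Dhat :: "real^'k^('g + 'l)"
  cost :: "real^'g \<Rightarrow> real"
  utility :: "real^'l \<Rightarrow> real"
  comm_edges :: "(('g + 'l) \<times> ('g + 'l)) set"
  Dc :: "real^'m^('g + 'l)"
  tau_g :: "real^'g^'g"
  tau_l :: "real^'l^'l"
  tau_v :: "real^'m^'m"
  tau_lamg :: "real^'g^'g"
  tau_laml :: "real^'l^'l"

text \<open>
  The market variables \<open>(P\<^sub>g, P\<^sub>l, v, \<lambda>\<^sub>g, \<lambda>\<^sub>l)\<close>, the physical variables \<open>(\<phi>, p\<^sub>g, E\<^sub>g, E\<^sub>l)\<close>,
  and the pair of both.
\<close>

type_synonym ('g, 'l, 'm) market_state =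
  "(real^'g) \<times> (real^'l) \<times> (real^'m) \<times> (real^'g) \<times> (real^'l)"

type_synonym ('g, 'l, 'k) phys_state =
  "(real^'k) \<times> (real^'g) \<times> (real^'g) \<times> (real^'l)"

type_synonym ('g, 'l, 'k, 'm) state =
  "('g, 'l, 'm) market_state \<times> ('g, 'l, 'k) phys_state"

definition gen_part :: "'a^('g::finite + 'l::finite) \<Rightarrow> 'a^'g" where
  "gen_part w = (\<chi> i. w $ Inl i)"

definition load_part :: "'a^('g::finite + 'l::finite) \<Rightarrow> 'a^'l" where
  "load_part w = (\<chi> i. w $ Inr i)"

definition standing_assumptions ::
  "('g::finite, 'l::finite, 'k::finite, 'm::finite) power_market \<Rightarrow> bool" where
  "standing_assumptions pm \<longleftrightarrow>
     simple_graph (edges pm) \<and> connected_graph (edges pm) \<and>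
     (\<forall>i j. (i, j) \<in> adjacency (edges pm) \<longrightarrow> Bc pm i j = Bc pm j i) \<and>
     (\<forall>i. Bc pm i i = (\<Sum>j\<in>neighbours (edges pm) i. Bc pm i j) + Bhat pm i \<and> 0 \<le> Bhat pm i) \<and>
     (\<forall>i. 0 < Mg pm $ i) \<and> (\<forall>i. 0 < An pm $ i) \<and> (\<forall>i. 0 < Tg pm $ i) \<and>
     (\<forall>i. 0 < Xd pm $ i - Xd' pm $ i) \<and> (\<forall>i. 0 \<le> Qbar pm $ i) \<and>
     CARD('k) + 1 = CARD('g + 'l) \<and> rank (Dhat pm) = CARD('k) \<and>
     {\<delta>. transpose (Dhat pm) *v \<delta> = 0} = span {vec 1} \<and>
     strictly_convex (cost pm) \<and> twice_continuously_differentiable (cost pm) \<and>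
     strictly_concave (utility pm) \<and> twice_continuously_differentiable (utility pm) \<and>
     simple_graph (comm_edges pm) \<and> connected_graph (comm_edges pm) \<and>
     incidence_matrix (comm_edges pm) (Dc pm) \<and>
     sym_pos_def_matrix (tau_g pm) \<and> sym_pos_def_matrix (tau_l pm) \<and>
     sym_pos_def_matrix (tau_v pm) \<and> sym_pos_def_matrix (tau_lamg pm) \<and>
     sym_pos_def_matrix (tau_laml pm)"

text \<open>
  Voltage angles from \<open>\<phi> = Dhat\<^sup>T \<delta>\<close>. They are determined up to a common additive constant and
  are used only through the differences \<open>\<delta>\<^sub>i - \<delta>\<^sub>j\<close>, which do not depend on the choice.
\<close>

definition angles ::
  "('g::finite, 'l::finite, 'k::finite, 'm::finite) power_market \<Rightarrow> real^'k \<Rightarrow> real^('g + 'l)" where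
  "angles pm \<phi> = (SOME \<delta>. transpose (Dhat pm) *v \<delta> = \<phi>)"

definition angle_diff ::
  "('g::finite, 'l::finite, 'k::finite, 'm::finite) power_market \<Rightarrow> real^'k \<Rightarrow> 'g + 'l \<Rightarrow> 'g + 'l \<Rightarrow> real"
  where "angle_diff pm \<phi> i j = angles pm \<phi> $ i - angles pm \<phi> $ j"

definition voltages :: "real^'g \<Rightarrow> real^'l \<Rightarrow> real^('g::finite + 'l::finite)" where
  "voltages Eg El = (\<chi> i. case i of Inl a \<Rightarrow> Eg $ a | Inr b \<Rightarrow> El $ b)"

definition active_power ::
  "('g::finite, 'l::finite, 'k::finite, 'm::finite) power_market \<Rightarrow> real^'k \<Rightarrow> real^('g + 'l) \<Rightarrow> real^('g + 'l)"
  where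
  "active_power pm \<phi> E =
     (\<chi> i. \<Sum>j\<in>neighbours (edges pm) i. Bc pm i j * E $ i * E $ j * sin (angle_diff pm \<phi> i j))"

definition reactive_power ::
  "('g::finite, 'l::finite, 'k::finite, 'm::finite) power_market \<Rightarrow> real^'k \<Rightarrow> real^('g + 'l) \<Rightarrow> real^('g + 'l)"
  where
  "reactive_power pm \<phi> E =
     (\<chi> i. Bc pm i i * (E $ i)\<^sup>2 -
        (\<Sum>j\<in>neighbours (edges pm) i. Bc pm i j * E $ i * E $ j * cos (angle_diff pm \<phi> i j)))"


subsection \<open>Closed loop\<close>

definition tau_c ::
  "('g::finite, 'l::finite, 'k::finite, 'm::finite) power_market \<Rightarrow>
   ('g, 'l, 'm) market_state \<Rightarrow> ('g, 'l, 'm) market_state" where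
  "tau_c pm = (\<lambda>(Pg, Pl, v, lamg, laml).
     (tau_g pm *v Pg, tau_l pm *v Pl, tau_v pm *v v, tau_lamg pm *v lamg, tau_laml pm *v laml))"

definition tau_c_inv ::
  "('g::finite, 'l::finite, 'k::finite, 'm::finite) power_market \<Rightarrow>
   ('g, 'l, 'm) market_state \<Rightarrow> ('g, 'l, 'm) market_state" where
  "tau_c_inv pm = (\<lambda>(a, b, c, d, e).
     (matrix_inv (tau_g pm) *v a, matrix_inv (tau_l pm) *v b, matrix_inv (tau_v pm) *v c,
      matrix_inv (tau_lamg pm) *v d, matrix_inv (tau_laml pm) *v e))"

definition omega_g ::
  "('g::finite, 'l::finite, 'k::finite, 'm::finite) power_market \<Rightarrow> real^'g \<Rightarrow> real^'g" where
  "omega_g pm p = (\<chi> i. p $ i / Mg pm $ i)"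

text \<open>
  The pricing algorithm in the variable \<open>x\<^sub>c = \<tau>\<^sub>c z\<^sub>c\<close>: the derivative of \<open>x\<^sub>c\<close> as a function of
  \<open>z\<^sub>c\<close>, \<open>\<omega>\<^sub>g\<close> and \<open>\<omega>\<^sub>l\<close>.
\<close>

definition market_field ::
  "('g::finite, 'l::finite, 'k::finite, 'm::finite) power_market \<Rightarrow>
   ('g, 'l, 'm) market_state \<Rightarrow> real^'g \<Rightarrow> real^'l \<Rightarrow> ('g, 'l, 'm) market_state" where
  "market_field pm = (\<lambda>(Pg, Pl, v, lamg, laml) wg wl.
     (- grad (cost pm) Pg + lamg - wg,
      grad (utility pm) Pl - laml + wl,
      - (transpose (gen_part (Dc pm)) *v lamg) - transpose (load_part (Dc pm)) *v laml,
      gen_part (Dc pm) *v v - Pg,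
      load_part (Dc pm) *v v + Pl))"

text \<open>
  The network dynamics in the coordinates \<open>(\<phi>, p\<^sub>g, E\<^sub>g, E\<^sub>l, \<omega>\<^sub>l)\<close>: the derivatives of \<open>\<phi>\<close>, \<open>p\<^sub>g\<close>
  and \<open>E\<^sub>g\<close>, followed by the residuals of the two algebraic equations at the load nodes.
\<close>

definition network_field ::
  "('g::finite, 'l::finite, 'k::finite, 'm::finite) power_market \<Rightarrow>
   ('g, 'l, 'k) phys_state \<Rightarrow> real^'l \<Rightarrow> real^'g \<Rightarrow> real^'l \<Rightarrow>
   (real^'k) \<times> (real^'g) \<times> (real^'g) \<times> (real^'l) \<times> (real^'l)" where
  "network_field pm = (\<lambda>(\<phi>, p, Eg, El) wl Pg Pl.
     (let E = voltages Eg El; wg = omega_g pm p;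
          P = active_power pm \<phi> E; Q = reactive_power pm \<phi> E
      in (transpose (gen_part (Dhat pm)) *v wg + transpose (load_part (Dhat pm)) *v wl,
          (\<chi> i. - P $ Inl i - An pm $ Inl i * wg $ i + Pg $ i),
          (\<chi> i. (Ef pm $ i - Eg $ i - (Xd pm $ i - Xd' pm $ i) * (1 / Eg $ i) * Q $ Inl i) / Tg pm $ i),
          (\<chi> i. - P $ Inr i - An pm $ Inr i * wl $ i - Pl $ i),
          (\<chi> i. Qbar pm $ i - Q $ Inr i))))"

definition closed_loop_equilibrium ::
  "('g::finite, 'l::finite, 'k::finite, 'm::finite) power_market \<Rightarrow>
   ('g, 'l, 'k, 'm) state \<Rightarrow> real^'l \<Rightarrow> bool" where
  "closed_loop_equilibrium pm = (\<lambda>(xc, \<phi>, p, Eg, El) wl.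
     case tau_c_inv pm xc of (Pg, Pl, v, lamg, laml) \<Rightarrow>
       (\<forall>i. 0 < Eg $ i) \<and> (\<forall>i. 0 < El $ i) \<and>
       market_field pm (Pg, Pl, v, lamg, laml) (omega_g pm p) wl = 0 \<and>
       network_field pm (\<phi>, p, Eg, El) wl Pg Pl = 0)"


subsection \<open>Hamiltonians\<close>

definition hamiltonian_p ::
  "('g::finite, 'l::finite, 'k::finite, 'm::finite) power_market \<Rightarrow> ('g, 'l, 'k) phys_state \<Rightarrow> real"
  where
  "hamiltonian_p pm = (\<lambda>(\<phi>, p, Eg, El).
     (let E = voltages Eg El in
       1/2 * (\<Sum>i\<in>UNIV. (p $ i)\<^sup>2 / Mg pm $ i + (Eg $ i - Ef pm $ i)\<^sup>2 / (Xd pm $ i - Xd' pm $ i))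
       + 1/2 * (\<Sum>i\<in>UNIV. Bc pm i i * (E $ i)\<^sup>2)
       - (\<Sum>(i, j)\<in>edges pm. Bc pm i j * E $ i * E $ j * cos (angle_diff pm \<phi> i j))))"

definition hamiltonian_c ::
  "('g::finite, 'l::finite, 'k::finite, 'm::finite) power_market \<Rightarrow> ('g, 'l, 'm) market_state \<Rightarrow> real"
  where "hamiltonian_c pm xc = 1/2 * (xc \<bullet> tau_c_inv pm xc)"

definition hamiltonian_a_shifted ::
  "('g::finite, 'l::finite, 'k::finite, 'm::finite) power_market \<Rightarrow>
   ('g, 'l, 'k) phys_state \<Rightarrow> ('g, 'l, 'k) phys_state \<Rightarrow> real" where
  "hamiltonian_a_shifted pm xpbar = (\<lambda>(\<phi>, p, Eg, El).
     (case grad (hamiltonian_p pm) xpbar of (d\<phi>, dp, dEg, dEl) \<Rightarrow> El \<bullet> dEl)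
     - Qbar pm \<bullet> (\<chi> i. ln (El $ i)))"

definition hamiltonian_shifted ::
  "('g::finite, 'l::finite, 'k::finite, 'm::finite) power_market \<Rightarrow>
   ('g, 'l, 'k, 'm) state \<Rightarrow> ('g, 'l, 'k, 'm) state \<Rightarrow> real" where
  "hamiltonian_shifted pm = (\<lambda>(xcbar, xpbar) (xc, xp).
     shifted (hamiltonian_p pm) xpbar xp + hamiltonian_a_shifted pm xpbar xp
     + shifted (hamiltonian_c pm) xcbar xc)"


subsection \<open>The system in shifted form\<close>

definition welfare ::
  "('g::finite, 'l::finite, 'k::finite, 'm::finite) power_market \<Rightarrow> ('g, 'l, 'm) market_state \<Rightarrow> real"
  where "welfare pm = (\<lambda>(Pg, Pl, v, lamg, laml). utility pm Pl - cost pm Pg)"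

definition Jc ::
  "('g::finite, 'l::finite, 'k::finite, 'm::finite) power_market \<Rightarrow>
   ('g, 'l, 'm) market_state \<Rightarrow> ('g, 'l, 'm) market_state" where
  "Jc pm = (\<lambda>(a, b, c, d, e).
     (d,
      - e,
      - (transpose (gen_part (Dc pm)) *v d) - transpose (load_part (Dc pm)) *v e,
      - a + gen_part (Dc pm) *v c,
      b + load_part (Dc pm) *v c))"

definition G1 :: "('g::finite, 'l::finite, 'm::finite) market_state \<Rightarrow> real^'g" where
  "G1 = (\<lambda>(a, b, c, d, e). a)"

definition G2 :: "('g::finite, 'l::finite, 'm::finite) market_state \<Rightarrow> real^'l" where
  "G2 = (\<lambda>(a, b, c, d, e). b)"

definition G1T :: "real^'g \<Rightarrow> ('g::finite, 'l::finite, 'm::finite) market_state" where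
  "G1T u = (u, 0, 0, 0, 0)"

definition G2T :: "real^'l \<Rightarrow> ('g::finite, 'l::finite, 'm::finite) market_state" where
  "G2T u = (0, u, 0, 0, 0)"

definition shifted_field ::
  "('g::finite, 'l::finite, 'k::finite, 'm::finite) power_market \<Rightarrow>
   ('g, 'l, 'k, 'm) state \<Rightarrow> ('g, 'l, 'k, 'm) state \<Rightarrow> ('g, 'l, 'k, 'm) state" where
  "shifted_field pm xbar x =
     (let Ag = diag_mat (gen_part (An pm));
          Ali = matrix_inv (diag_mat (load_part (An pm)));
          Dg = gen_part (Dhat pm);
          Dl = load_part (Dhat pm);
          Rg = diag_mat (\<chi> i. (Xd pm $ i - Xd' pm $ i) / Tg pm $ i)
      in case x of (xc, \<phi>, p, Eg, El) \<Rightarrow>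
         case grad (hamiltonian_shifted pm xbar) x of (hc, h\<phi>, hp, hEg, hEl) \<Rightarrow>
           (Jc pm hc - G2T (Ali *v G2 hc) - G2T (Ali *v (Dl *v h\<phi>)) - G1T hp
              + (grad (welfare pm) (tau_c_inv pm xc) - grad (welfare pm) (tau_c_inv pm (fst xbar))),
            - (transpose Dl *v (Ali *v G2 hc)) - transpose Dl *v (Ali *v (Dl *v h\<phi>)) + transpose Dg *v hp,
            G1 hc - Dg *v h\<phi> - Ag *v hp,
            - (Rg *v hEg),
            - (diag_mat El *v hEl)))"

text \<open>The load voltages \<open>E\<^sub>l\<close> are the algebraic variables.\<close>

definition differential_part :: "('g::finite, 'l::finite, 'k::finite, 'm::finite) state \<Rightarrow> ('g, 'l, 'k, 'm) state"
  where "differential_part = (\<lambda>(xc, \<phi>, p, Eg, El). (xc, \<phi>, p, Eg, 0))"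

definition state_space :: "('g::finite, 'l::finite, 'k::finite, 'm::finite) state set" where
  "state_space = {(xc, \<phi>, p, Eg, El). (\<forall>i. 0 < Eg $ i) \<and> (\<forall>i. 0 < El $ i)}"

end

theory Submission
  imports Defs
begin

text \<open>
  The shifted Hamiltonian is a Lyapunov function, and the dissipated power together with the
  structure of the interconnection pins down the equilibrium.

  With \<open>h = \<nabla>H(x)\<close> for the shifted Hamiltonian \<open>H\<close>, the skew-symmetric part of the structure
  matrix cancels in \<open>h \<bullet> F x\<close>. What remains is minus a sum of positive definite quadratic forms
  in \<open>h\<^sub>b + D\<^sub>l h\<^sub>\<phi>\<close> (the deviation of the load frequencies, up to the damping factor), in \<open>h\<^sub>p\<close> and
  in \<open>h\<^sub>E\<^sub>g\<close> (\<open>interconnection_power\<close>), plus a market term that is negative by strict convexity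
  unless generation and demand equal their equilibrium values (\<open>welfare_dissipation\<close>). Stationarity of
  \<open>H\<close> at the equilibrium is the reactive power balance at the loads
  (\<open>hamiltonian_shifted_grad_equilibrium\<close>).

  The differential-algebraic character is treated without solving the constraint explicitly. The
  constraint says that \<open>h\<close> has no component along the algebraic variables \<open>E\<^sub>l\<close>. Near the
  equilibrium the positive Hessian makes \<open>\<nabla>H\<close> strongly monotone, hence \<open>H\<close> convex, and this
  yields everything that is usually drawn from the implicit function theorem. The differential
  part of a consistent state determines the state in a Lipschitz manner (\<open>M_lipschitz\<close>); a
  consistent state over a given differential part is found by minimizing \<open>H\<close> over the algebraic
  variables (\<open>algebraic_part_exists\<close>); and \<open>H\<close> can be differentiated along a solution whose
  algebraic part is merely continuous, because the difference quotient of \<open>H\<close> lies between two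
  quantities in which only differential variables occur (\<open>V_derivative\<close>). Stability is then the
  classical argument with the minimum of \<open>H\<close> on a small sphere, and solutions exist by reduction
  to an ordinary differential equation with globally Lipschitz right-hand side.

  For convergence, LaSalle's principle is used in a form that needs no flow on the limit set.
  By Barbalat's lemma no power is dissipated at limit points of a solution, and a linear
  function of the differential variables that is constant on the limit set has vanishing
  derivative there (\<open>limit_points_no_dissipation\<close>, \<open>limit_points_stationary\<close>). Applied to the
  network: no dissipation fixes generation, demand and frequencies; since these are constant, the
  price shifts vanish and \<open>D h\<^sub>\<phi> = 0\<close>, so \<open>h\<^sub>\<phi> = 0\<close>; since the prices are constant,
  \<open>D\<^sub>c c = 0\<close> for the shift \<open>c\<close> of \<open>v\<close>, and the incidence matrix of a tree is injective. So
  \<open>\<nabla>H = 0\<close> at every limit point, which leaves only the equilibrium.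

  The gradient is never written out in full. Strict differentiability at the equilibrium, which is
  stable under all operations used to build \<open>H\<close>, gives both the strong monotonicity and the
  Lipschitz bounds; explicit components are computed only where the argument needs them.
\<close>

section \<open>Ordinary differential equations on the half line\<close>

text \<open>
  The estimate behind the exponentially weighted norm: integrating a function of growth \<open>exp (k s)\<close>
  and dividing by \<open>exp (k t)\<close> gains a factor \<open>1 / k\<close>.
\<close>

lemma norm_integral_le_exp:
  fixes w :: "real \<Rightarrow> 'a::euclidean_space"
  assumes k: "0 < k" and t: "0 \<le> t" and B: "0 \<le> B"
    and cont: "continuous_on {0..t} w"
    and bound: "\<And>s. s \<in> {0..t} \<Longrightarrow> norm (w s) \<le> B * exp (k * s)"
  shows "norm (exp (- k * t) *\<^sub>R integral {0..t} w) \<le> B / k"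
proof -
  have "((\<lambda>s. B * exp (k * s)) has_integral (B / k * exp (k * t) - B / k * exp (k * 0))) {0..t}"
    using k t by (intro fundamental_theorem_of_calculus)
      (auto intro!: derivative_eq_intros simp flip: has_real_derivative_iff_has_vector_derivative)
  then have "norm (integral {0..t} w) \<le> B / k * exp (k * t) - B / k"
    using integral_norm_bound_integral[OF integrable_continuous_real[OF cont] _ bound]
    by (metis has_integral_integrable_integral exp_zero mult_1_right mult_zero_right)
  also have "\<dots> \<le> B / k * exp (k * t)"
    using k B by simp
  finally have "norm (integral {0..t} w) \<le> B / k * exp (k * t)" .
  then have "exp (- k * t) * norm (integral {0..t} w) \<le> exp (- k * t) * (B / k * exp (k * t))"
    by (intro mult_left_mono) auto
  also have "\<dots> = B / k"
    by (simp add: exp_minus)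
  finally show ?thesis
    by simp
qed

text \<open>
  Global Picard theorem. Writing \<open>y t = y0 + exp (k t) u t\<close> turns the integral equation into a
  fixed point problem for a bounded continuous \<open>u\<close> on the whole line; for \<open>k\<close> at least twice the
  Lipschitz constant the operator is a contraction, so a single fixed point serves all times and
  no pieces have to be glued.
\<close>

lemma global_ode_solution:
  fixes f :: "'a::euclidean_space \<Rightarrow> 'a"
  assumes lip: "\<And>x y. norm (f x - f y) \<le> C * norm (x - y)"
  obtains y where "y 0 = y0"
    and "\<And>t. 0 \<le> t \<Longrightarrow> (y has_vector_derivative f (y t)) (at t within {0..})"
proof -
  \<comment> \<open>The summand 1 keeps \<open>k\<close> positive when \<open>f\<close> is constant.\<close>
  define k where "k = 2 * (\<bar>C\<bar> + 1)"
  have k: "0 < k" unfolding k_def by simp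
  have lip': "norm (f x - f y) \<le> \<bar>C\<bar> * norm (x - y)" for x y
    using lip[of x y] by (meson abs_ge_self mult_right_mono norm_ge_zero order_trans)
  have contf: "continuous_on UNIV f"
    using lip' by (intro lipschitz_on_continuous_on[of "\<bar>C\<bar>"] lipschitz_onI) (auto simp: dist_norm)
  define w where "w u s = f (y0 + exp (k * s) *\<^sub>R apply_bcontfun u s)"
    for u :: "real \<Rightarrow>\<^sub>C 'a" and s
  have contw: "continuous_on S (w u)" for u S
    unfolding w_def
    by (intro continuous_on_compose2[OF contf] continuous_intros) auto
  define I where "I u t = integral {0..t} (w u)" for u t
  have I_deriv: "(I u has_vector_derivative w u t) (at t within {0..})" if "0 \<le> t" for u t
  proof -
    have "(I u has_vector_derivative w u t) (at t within {0..t+1})"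
      unfolding I_def using integral_has_vector_derivative[OF contw, of t 0 "t+1"] that by auto
    moreover have "at t within {0..t+1} = at t within {0..}"
      by (rule at_within_nhd[of _ "{..<t+1}"]) auto
    ultimately show ?thesis by simp
  qed
  have contI: "continuous_on {0..} (I u)" for u
    by (rule continuous_on_vector_derivative) (use I_deriv in auto)
  \<comment> \<open>Extended by the value at 0 to negative times, because \<open>u\<close> lives on the whole line.\<close>
  define T where "T u t = exp (- k * max 0 t) *\<^sub>R I u (max 0 t)" for u t
  have wbound: "norm (w u s) \<le> (norm (f y0) + \<bar>C\<bar> * norm u) * exp (k * s)" if "0 \<le> s" for u s
  proof -
    have e: "1 \<le> exp (k * s)" using that k by simp
    have "norm (w u s) \<le> norm (f y0) + norm (w u s - f y0)"
      by (rule norm_triangle_sub)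
    also have "norm (w u s - f y0) \<le> \<bar>C\<bar> * norm (exp (k * s) *\<^sub>R apply_bcontfun u s)"
      unfolding w_def using lip'[of _ y0] by (metis add_diff_cancel_left')
    also have "\<dots> \<le> \<bar>C\<bar> * (exp (k * s) * norm u)"
      by (intro mult_left_mono) (auto intro!: mult_left_mono norm_bounded)
    also have "norm (f y0) + \<bar>C\<bar> * (exp (k * s) * norm u)
        \<le> norm (f y0) * exp (k * s) + \<bar>C\<bar> * (exp (k * s) * norm u)"
      using e by (simp add: mult_le_cancel_left1)
    finally show ?thesis by (simp add: algebra_simps)
  qed
  have T_bcont: "T u \<in> bcontfun" for u
  proof (rule bcontfun_normI)
    show "continuous_on UNIV (T u)"
      unfolding T_def
      by (intro continuous_intros continuous_on_compose2[OF contI]) auto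
    show "norm (T u t) \<le> (norm (f y0) + \<bar>C\<bar> * norm u) / k" for t
      unfolding T_def I_def
      using k wbound by (intro norm_integral_le_exp contw) (simp_all add: max_def)
  qed
  define TT where "TT u = Bcontfun (T u)" for u
  have TT: "apply_bcontfun (TT u) = T u" for u
    unfolding TT_def by (simp add: Bcontfun_inverse T_bcont)
  have contr: "dist (TT u) (TT v) \<le> 1/2 * dist u v" for u v
  proof (rule dist_bound)
    fix t :: real
    define m where "m = max 0 t"
    have m: "0 \<le> m" unfolding m_def by simp
    have wd: "norm (w u s - w v s) \<le> (\<bar>C\<bar> * dist u v) * exp (k * s)" for s
    proof -
      have "norm (w u s - w v s) \<le> \<bar>C\<bar> * norm (exp (k * s) *\<^sub>R (apply_bcontfun u s - apply_bcontfun v s))"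
        unfolding w_def using lip'
        by (metis (no_types, lifting) add_diff_cancel_left scaleR_diff_right)
      also have "\<dots> \<le> \<bar>C\<bar> * (exp (k * s) * dist u v)"
        by (intro mult_left_mono) (auto intro!: mult_left_mono simp: dist_bounded simp flip: dist_norm)
      finally show ?thesis by (simp add: algebra_simps)
    qed
    have "T u t - T v t = exp (- k * m) *\<^sub>R integral {0..m} (\<lambda>s. w u s - w v s)"
      unfolding T_def I_def m_def[symmetric]
      by (simp add: Henstock_Kurzweil_Integration.integral_diff integrable_continuous_real contw scaleR_diff_right)
    moreover have "norm (exp (- k * m) *\<^sub>R integral {0..m} (\<lambda>s. w u s - w v s)) \<le> (\<bar>C\<bar> * dist u v) / k"
      by (rule norm_integral_le_exp) (use k m contw wd in \<open>auto intro!: continuous_intros\<close>)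
    moreover have "(\<bar>C\<bar> * dist u v) / k \<le> 1/2 * dist u v"
      unfolding k_def by (simp add: field_simps)
    ultimately show "dist (apply_bcontfun (TT u) t) (apply_bcontfun (TT v) t) \<le> 1/2 * dist u v"
      unfolding TT by (metis dist_norm order_trans)
  qed
  obtain u where u: "TT u = u"
    using banach_fix_type[of "1/2" TT] contr by auto
  define y where "y t = y0 + I u t" for t
  have y_eq: "y0 + exp (k * t) *\<^sub>R apply_bcontfun u t = y t" if "0 \<le> t" for t
  proof -
    have "apply_bcontfun u t = exp (- k * t) *\<^sub>R I u t"
      using TT[of u] u that by (simp add: T_def fun_eq_iff max_def)
    then show ?thesis by (simp add: y_def exp_minus)
  qed
  show thesis
  proof (rule that)
    show "y 0 = y0" by (simp add: y_def I_def)
    fix t :: real assume t: "0 \<le> t"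
    have "w u t = f (y t)"
      unfolding w_def using y_eq[OF t] by simp
    then show "(y has_vector_derivative f (y t)) (at t within {0..})"
      using I_deriv[OF t, of u] unfolding y_def
      by (auto intro!: derivative_eq_intros)
  qed
qed

section \<open>Barbalat's lemma and limit points of trajectories\<close>

text \<open>
  If the derivative stayed away from zero at arbitrarily late times, uniform continuity would force
  changes of the function by a fixed amount over intervals of a fixed length.
\<close>

lemma barbalat:
  fixes f :: "real \<Rightarrow> 'a::real_normed_vector"
  assumes deriv: "\<And>t. 0 \<le> t \<Longrightarrow> (f has_vector_derivative f' t) (at t within {0..})"
    and uc: "uniformly_continuous_on {0..} f'"
    and lim: "(f \<longlongrightarrow> c) at_top"
  shows "(f' \<longlongrightarrow> 0) at_top"
proof (rule tendstoI)
  fix e :: real assume e: "0 < e"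
  obtain d where d: "0 < d"
    and ucd: "\<And>s t. \<lbrakk>0 \<le> s; 0 \<le> t; dist s t < d\<rbrakk> \<Longrightarrow> dist (f' s) (f' t) < e / 2"
    using uniformly_continuous_onE[OF uc, of "e/2"] e by (metis atLeast_iff half_gt_zero)
  define h where "h = d / 2"
  have h: "0 < h" "h < d" using d by (auto simp: h_def)
  have diff: "norm (f (t + h) - f t - h *\<^sub>R f' t) \<le> h * (e / 2)" if t: "0 \<le> t" for t
  proof -
    have "norm (f (t + h) - f t - (\<lambda>x. x *\<^sub>R f' t) (t + h - t)) \<le> norm (t + h - t) * (e / 2)"
    proof (rule differentiable_bound_linearization[where S = "{t..t+h}" and f' = "\<lambda>s x. x *\<^sub>R f' s"])
      show "t + s *\<^sub>R (t + h - t) \<in> {t..t+h}" if "s \<in> {0..1}" for s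
        using that h by (auto simp: mult_left_le_one_le)
      show "(f has_derivative (\<lambda>x. x *\<^sub>R f' s)) (at s within {t..t+h})" if "s \<in> {t..t+h}" for s
        using deriv[of s] that t
        by (auto simp: has_vector_derivative_def intro: has_derivative_subset)
      show "onorm ((\<lambda>x. x *\<^sub>R f' s) - (\<lambda>x. x *\<^sub>R f' t)) \<le> e / 2" if "s \<in> {t..t+h}" for s
      proof (rule onorm_le)
        fix x :: real
        have "norm (f' s - f' t) \<le> e / 2"
          using ucd[of s t] that t h by (auto simp: dist_norm)
        then show "norm (((\<lambda>x. x *\<^sub>R f' s) - (\<lambda>x. x *\<^sub>R f' t)) x) \<le> e / 2 * norm x"
          using mult_left_mono[of "norm (f' s - f' t)" "e / 2" "norm x"]
          by (simp add: scaleR_diff_right[symmetric] mult.commute)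
      qed
      show "t \<in> {t..t+h}" using h by simp
    qed
    then show ?thesis using h by simp
  qed
  have "((\<lambda>t. f (t + h)) \<longlongrightarrow> c) at_top"
    by (rule filterlim_compose[OF lim]) (rule filterlim_tendsto_add_at_top[of "\<lambda>_. h", unfolded add.commute[of h]], auto intro: filterlim_ident)
  from tendsto_diff[OF this lim] have "((\<lambda>t. f (t + h) - f t) \<longlongrightarrow> 0) at_top" by simp
  from tendstoD[OF this, of "h * (e / 2)"]
  have "\<forall>\<^sub>F t in at_top. norm (f (t + h) - f t) < h * (e / 2)"
    using h e by simp
  then show "\<forall>\<^sub>F t in at_top. dist (f' t) 0 < e"
    using eventually_ge_at_top[of 0]
  proof eventually_elim
    case (elim t)
    have "norm (h *\<^sub>R f' t) \<le> norm (f (t + h) - f t) + norm (f (t + h) - f t - h *\<^sub>R f' t)"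
      by (metis norm_triangle_sub norm_minus_commute add.commute)
    also have "\<dots> < h * (e / 2) + h * (e / 2)"
      using elim diff[of t] by linarith
    finally have "h * norm (f' t) < h * e" using h by (simp add: algebra_simps)
    then show ?case using h by simp
  qed
qed

text \<open>
  The omega-limit set of a trajectory.
\<close>

definition limit_points :: "(real \<Rightarrow> 'a::topological_space) \<Rightarrow> 'a set" where
  "limit_points x = {z. \<exists>s::nat \<Rightarrow> real. filterlim s at_top sequentially \<and> (x \<circ> s) \<longlonglongrightarrow> z}"

lemma limit_points_subset:
  assumes "closed K" and "\<And>t. 0 \<le> t \<Longrightarrow> x t \<in> K"
  shows "limit_points x \<subseteq> K"
proof
  fix z assume "z \<in> limit_points x"
  then obtain s :: "nat \<Rightarrow> real" where s: "filterlim s at_top sequentially" "(x \<circ> s) \<longlonglongrightarrow> z"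
    by (auto simp: limit_points_def)
  have "\<forall>\<^sub>F n in sequentially. x (s n) \<in> K"
    using filterlim_at_top[THEN iffD1, OF s(1), rule_format, of 0]
    by (rule eventually_mono) (use assms in auto)
  with s(2) assms(1) show "z \<in> K"
    by (metis (mono_tags, lifting) Lim_in_closed_set comp_apply eventually_mono trivial_limit_sequentially)
qed

lemma limit_points_eq:
  fixes q :: "'a::metric_space \<Rightarrow> 'b::metric_space"
  assumes "closed K" and "\<And>t. 0 \<le> t \<Longrightarrow> x t \<in> K" and "continuous_on K q"
    and "((\<lambda>t. q (x t)) \<longlongrightarrow> c) at_top" and "z \<in> limit_points x"
  shows "q z = c"
proof -
  obtain s :: "nat \<Rightarrow> real" where s: "filterlim s at_top sequentially" "(x \<circ> s) \<longlonglongrightarrow> z"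
    using assms(5) by (auto simp: limit_points_def)
  have "\<forall>\<^sub>F n in sequentially. x (s n) \<in> K"
    using filterlim_at_top[THEN iffD1, OF s(1), rule_format, of 0]
    by (rule eventually_mono) (use assms in auto)
  moreover have "z \<in> K"
    by (rule subsetD[OF limit_points_subset[OF assms(1,2)] assms(5)])
  ultimately have "(\<lambda>n. q (x (s n))) \<longlonglongrightarrow> q z"
    using continuous_on_tendsto_compose[OF assms(3) s(2)] by simp
  moreover have "(\<lambda>n. q (x (s n))) \<longlonglongrightarrow> c"
    using filterlim_compose[OF assms(4) s(1)] .
  ultimately show ?thesis by (rule LIMSEQ_unique)
qed

text \<open>
  Otherwise some sequence of times would keep the values away from \<open>c\<close>, and by compactness a
  subsequence of states would converge to a limit point.
\<close>

lemma tendsto_if_constant_on_limit_points: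
  fixes q :: "'a::metric_space \<Rightarrow> 'b::metric_space"
  assumes "compact K" and "\<And>t. 0 \<le> t \<Longrightarrow> x t \<in> K" and "continuous_on K q"
    and "\<And>z. z \<in> limit_points x \<Longrightarrow> q z = c"
  shows "((\<lambda>t. q (x t)) \<longlongrightarrow> c) at_top"
proof (rule ccontr)
  assume "\<not> ((\<lambda>t. q (x t)) \<longlongrightarrow> c) at_top"
  then obtain e where e: "0 < e" and "\<not> (\<forall>\<^sub>F t in at_top. dist (q (x t)) c < e)"
    by (auto simp: tendsto_iff)
  then have "\<forall>n::nat. \<exists>t\<ge>real n. e \<le> dist (q (x t)) c"
    by (auto simp: eventually_at_top_linorder not_less)
  then obtain s where s: "\<And>n::nat. real n \<le> s n" "\<And>n. e \<le> dist (q (x (s n))) c"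
    by metis
  have s0: "0 \<le> s n" for n using s(1)[of n] by (meson of_nat_0_le_iff order_trans)
  obtain z r where z: "z \<in> K" and r: "strict_mono r" and lim: "((x \<circ> s) \<circ> r) \<longlonglongrightarrow> z"
    using assms(1,2) s0 unfolding compact_def by (metis comp_apply)
  have inf: "filterlim (s \<circ> r) at_top sequentially"
  proof (rule filterlim_at_top_mono[OF filterlim_real_sequentially])
    show "\<forall>\<^sub>F n in sequentially. real n \<le> (s \<circ> r) n"
      using s(1) seq_suble[OF r] by (auto intro!: always_eventually) (metis of_nat_mono order_trans)
  qed
  have "z \<in> limit_points x"
    unfolding limit_points_def using inf lim by (auto simp: comp_assoc)
  then have "q z = c" using assms(4) by blast
  moreover have "(\<lambda>n. q (x (s (r n)))) \<longlonglongrightarrow> q z"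
    using continuous_on_tendsto_compose[OF assms(3) lim z] s0 assms(2) by simp
  ultimately have "\<forall>\<^sub>F n in sequentially. dist (q (x (s (r n)))) c < e"
    using e unfolding tendsto_iff by blast
  then obtain n where "dist (q (x (s (r n)))) c < e"
    using eventually_happens by force
  then show False using s(2)[of "r n"] by simp
qed

section \<open>Systems driven by a strongly monotone gradient\<close>

text \<open>
  The form in which the convexity bounds are used: an increment that is controlled by the increment
  of a differentiable curve, with a vanishing factor, has derivative zero.
\<close>

lemma has_real_derivative_zero_from_bound:
  fixes f :: "real \<Rightarrow> real" and b :: "real \<Rightarrow> 'a::real_normed_vector"
  assumes b: "(b has_vector_derivative b') (at t within I)"
    and a: "(a \<longlongrightarrow> 0) (at t within I)"
    and le: "\<And>s. s \<in> I \<Longrightarrow> \<bar>f s - f t\<bar> \<le> a s * norm (b s - b t)"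
    and a0: "\<And>s. 0 \<le> a s"
  shows "(f has_real_derivative 0) (at t within I)"
  unfolding has_field_derivative_iff
proof (rule Lim_null_comparison)
  have "((\<lambda>s. norm (b s - b t - (s - t) *\<^sub>R b') / norm (s - t)) \<longlongrightarrow> 0) (at t within I)"
    using b by (simp add: has_vector_derivative_def has_derivative_iff_norm)
  from tendstoD[OF this, of 1]
  have "\<forall>\<^sub>F s in at t within I. norm (b s - b t - (s - t) *\<^sub>R b') / norm (s - t) < 1"
    by simp
  then show "\<forall>\<^sub>F s in at t within I. norm ((f s - f t) / (s - t)) \<le> a s * (1 + norm b')"
    unfolding eventually_at_topological
  proof (elim exE conjE, intro exI conjI ballI impI)
    fix S s assume S: "\<forall>s\<in>S. s \<noteq> t \<longrightarrow> s \<in> I \<longrightarrow> norm (b s - b t - (s - t) *\<^sub>R b') / norm (s - t) < 1"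
      and s: "s \<in> S" "s \<noteq> t" "s \<in> I"
    have "norm (b s - b t) \<le> norm ((s - t) *\<^sub>R b') + norm (b s - b t - (s - t) *\<^sub>R b')"
      by (rule norm_triangle_sub)
    also have "norm (b s - b t - (s - t) *\<^sub>R b') \<le> \<bar>s - t\<bar>"
      using bspec[OF S s(1)] s(2,3) by (simp add: divide_less_eq)
    finally have "norm (b s - b t) \<le> \<bar>s - t\<bar> * (1 + norm b')"
      by (simp add: distrib_left)
    then have "\<bar>f s - f t\<bar> \<le> a s * (\<bar>s - t\<bar> * (1 + norm b'))"
      using le[OF s(3)] mult_left_mono[OF _ a0[of s]] by (meson order_trans)
    then show "norm ((f s - f t) / (s - t)) \<le> a s * (1 + norm b')"
      using s(2) by (simp add: abs_divide divide_le_eq algebra_simps)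
  qed
  show "((\<lambda>s. a s * (1 + norm b')) \<longlongrightarrow> 0) (at t within I)"
    using tendsto_mult_left_zero[OF a] .
qed

text \<open>
  Argument of the first exit time: a continuous curve that starts inside the ball and leaves it
  meets the sphere a first time.
\<close>

lemma remains_in_ball:
  fixes x :: "real \<Rightarrow> 'a::metric_space"
  assumes cont: "continuous_on {0..T} x" and init: "dist (x 0) a < s"
    and no_exit: "\<And>t1. \<lbrakk>0 < t1; t1 \<le> T; \<And>t. t \<in> {0..t1} \<Longrightarrow> dist (x t) a \<le> s; dist (x t1) a = s\<rbrakk> \<Longrightarrow> False"
    and t: "t \<in> {0..T}"
  shows "dist (x t) a < s"
proof (rule ccontr)
  assume "\<not> dist (x t) a < s"
  define S where "S = {t \<in> {0..T}. s \<le> dist (x t) a}"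
  have contd: "continuous_on {0..T} (\<lambda>t. dist (x t) a)"
    by (intro continuous_intros cont)
  have "closed S"
    unfolding S_def
    by (intro continuous_closed_preimage[of "{0..T}" "\<lambda>t. dist (x t) a" "{s..}", unfolded vimage_def, simplified]
        continuous_on_closed_Collect_le contd continuous_intros closed_atLeastAtMost)
  moreover have "bounded S"
    by (rule bounded_subset[of "{0..T}"]) (auto simp: S_def)
  ultimately have "compact S" by (simp add: compact_eq_bounded_closed)
  moreover have "S \<noteq> {}" using t \<open>\<not> dist (x t) a < s\<close> by (auto simp: S_def)
  ultimately have "\<exists>t1\<in>S. \<forall>t\<in>S. t1 \<le> t" by (rule compact_attains_inf)
  then obtain t1 where t1: "t1 \<in> S" "\<And>t. t \<in> S \<Longrightarrow> t1 \<le> t" by auto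
  have t1T: "0 \<le> t1" "t1 \<le> T" "s \<le> dist (x t1) a" using t1 by (auto simp: S_def)
  have "t1 \<noteq> 0" using t1T init by auto
  have less: "dist (x t) a < s" if "t \<in> {0..<t1}" for t
    using t1(2)[of t] that t1T unfolding S_def by fastforce
  obtain u where u: "0 \<le> u" "u \<le> t1" "dist (x u) a = s"
    using IVT'[of "\<lambda>t. dist (x t) a" 0 s t1] init t1T continuous_on_subset[OF contd] by force
  then have "u = t1" using less[of u] by force
  then show False
    using no_exit[of t1] less u t1T \<open>t1 \<noteq> 0\<close> by (metis atLeastAtMost_iff atLeastLessThan_iff less_eq_real_def order_less_le)
qed

lemma dae_solution_subset:
  assumes "dae_solution P F \<Omega> I x" and "J \<subseteq> I"
  shows "dae_solution P F \<Omega> J x"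
  using assms unfolding dae_solution_def
  by (meson continuous_on_subset has_vector_derivative_within_subset subsetD)

text \<open>
  A differential-algebraic system \<open>d/dt (P x) = F x\<close> on a ball around the equilibrium \<open>xb\<close>, with
  Lyapunov function \<open>V\<close> and \<open>g = \<nabla>V\<close>. The differential variables are selected by the orthogonal
  projection \<open>P\<close>, and the algebraic equations say that \<open>g\<close> has no component along the algebraic
  variables. Only the differential part of \<open>F\<close> is Lipschitz by assumption; on consistent states
  it is all of \<open>F\<close>.
\<close>

locale gradient_dae =
  fixes P F g :: "'x::euclidean_space \<Rightarrow> 'x" and \<Omega> :: "'x set" and V :: "'x \<Rightarrow> real"
    and xb :: 'x and r c C :: real
  assumes lin_P: "linear P"
    and P_idem: "P (P x) = P x"
    and P_sym: "P x \<bullet> y = x \<bullet> P y"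
    and r_pos: "0 < r" and c_pos: "0 < c"
    and ball_sub: "cball xb r \<subseteq> \<Omega>"
    and V_grad: "x \<in> cball xb r \<Longrightarrow> GDERIV V x :> g x"
    and g_mono: "\<lbrakk>x \<in> cball xb r; y \<in> cball xb r\<rbrakk> \<Longrightarrow> c * (norm (x - y))\<^sup>2 \<le> (g x - g y) \<bullet> (x - y)"
    and g_lip: "\<lbrakk>x \<in> cball xb r; y \<in> cball xb r\<rbrakk> \<Longrightarrow> norm (g x - g y) \<le> C * norm (x - y)"
    and F_lip: "\<lbrakk>x \<in> cball xb r; y \<in> cball xb r\<rbrakk> \<Longrightarrow> norm (P (F x) - P (F y)) \<le> C * norm (x - y)"
    and g_xb: "g xb = 0"
    and constraint: "x \<in> \<Omega> \<Longrightarrow> F x \<in> range P \<longleftrightarrow> P (g x) = g x"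
    and dissipation: "\<lbrakk>x \<in> cball xb r; P (g x) = g x\<rbrakk> \<Longrightarrow> g x \<bullet> F x \<le> 0"
begin

text \<open>
  The constraint manifold near the equilibrium; it is compact because the ball is closed.
\<close>

definition M :: "'x set" where "M = {x \<in> cball xb r. P (g x) = g x}"

lemma range_P: "y \<in> range P \<longleftrightarrow> P y = y"
  using P_idem by (metis rangeE rangeI)

lemma norm_P_le: "norm (P x) \<le> norm x"
proof -
  have "(norm (P x))\<^sup>2 = x \<bullet> P x"
    unfolding power2_norm_eq_inner by (simp add: P_sym P_idem)
  also have "\<dots> \<le> norm x * norm (P x)" by (rule norm_cauchy_schwarz)
  finally show ?thesis
    by (cases "P x = 0") (auto simp: power2_eq_square)
qed

lemma bl_P: "bounded_linear P"
  using lin_P by (simp add: linear_linear)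

lemma contP: "continuous_on S P"
  by (rule linear_continuous_on[OF bl_P])

lemma cont_g: "continuous_on (cball xb r) g"
proof -
  have "norm (g x - g y) \<le> \<bar>C\<bar> * norm (x - y)" if "x \<in> cball xb r" "y \<in> cball xb r" for x y
    using g_lip[OF that] by (meson abs_ge_self mult_right_mono norm_ge_zero order_trans)
  then show ?thesis
    by (intro lipschitz_on_continuous_on[of "\<bar>C\<bar>"] lipschitz_onI) (auto simp: dist_norm)
qed

lemma cont_V: "continuous_on (cball xb r) V"
  using V_grad by (meson gderiv_def has_derivative_at_withinI has_derivative_continuous_on)

lemma compact_M: "compact M"
proof -
  have "closed {x \<in> cball xb r. P (g x) - g x = 0}"
    by (intro continuous_closed_preimage_constant continuous_intros cont_g
        continuous_on_compose2[OF contP cont_g]) auto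
  moreover have "M = {x \<in> cball xb r. P (g x) - g x = 0}" by (auto simp: M_def)
  moreover have "bounded M" by (rule bounded_subset[OF bounded_cball[of xb r]]) (auto simp: M_def)
  ultimately show ?thesis by (simp add: compact_eq_bounded_closed)
qed

lemma M_tangent: "x \<in> M \<Longrightarrow> P (F x) = F x"
  using constraint[of x] range_P ball_sub by (auto simp: M_def)

lemma cont_F: "continuous_on M F"
proof -
  have "norm (F x - F y) \<le> \<bar>C\<bar> * norm (x - y)" if "x \<in> M" "y \<in> M" for x y
    using F_lip[of x y] that M_tangent
    by (simp add: M_def) (meson abs_ge_self mult_right_mono norm_ge_zero order_trans)
  then show ?thesis
    by (intro lipschitz_on_continuous_on[of "\<bar>C\<bar>"] lipschitz_onI) (auto simp: dist_norm)
qed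

text \<open>
  A function with strongly monotone gradient lies strictly above its tangents, by the mean value
  theorem on the segment from \<open>x\<close> to \<open>y\<close>.
\<close>

lemma gradient_inequality:
  assumes x: "x \<in> cball xb r" and y: "y \<in> cball xb r" and "x \<noteq> y"
  shows "V x + g x \<bullet> (y - x) < V y"
proof -
  define p where "p s = x + s *\<^sub>R (y - x)" for s :: real
  have p: "p s \<in> cball xb r" if "0 \<le> s" "s \<le> 1" for s
    using convexD_alt[OF convex_cball x y that] by (simp add: p_def algebra_simps)
  have "((\<lambda>s. V (p s)) has_real_derivative g (p s) \<bullet> (y - x)) (at s)" if "0 \<le> s" "s \<le> 1" for s
  proof -
    have "(p has_derivative (\<lambda>h. h *\<^sub>R (y - x))) (at s)"
      unfolding p_def by (auto intro!: derivative_eq_intros)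
    from has_derivative_compose[OF this V_grad[OF p[OF that], unfolded gderiv_def]]
    show ?thesis
      unfolding has_field_derivative_def
      by (rule has_derivative_eq_rhs) (auto simp: inner_commute)
  qed
  from MVT2[of 0 1, OF _ this] obtain s where s: "0 < s" "s < 1"
    and eq: "V y - V x = g (p s) \<bullet> (y - x)"
    by (auto simp: p_def)
  have "0 < c * (norm (p s - x))\<^sup>2"
    using c_pos s assms(3) by (simp add: p_def)
  also have "\<dots> \<le> (g (p s) - g x) \<bullet> (p s - x)"
    using g_mono p s x by simp
  also have "\<dots> = s * ((g (p s) - g x) \<bullet> (y - x))" by (simp add: p_def)
  finally have "0 < (g (p s) - g x) \<bullet> (y - x)"
    using s by (simp add: zero_less_mult_iff)
  then show ?thesis using eq by (simp add: inner_diff_left)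
qed

lemma sphere_barrier:
  assumes "0 < s" "s \<le> r"
  obtains m where "V xb < m" and "\<And>x. dist x xb = s \<Longrightarrow> m \<le> V x"
proof (cases "sphere xb s = {}")
  case True
  then have "dist x xb \<noteq> s" for x by (auto simp: dist_commute)
  then show thesis using that[of "V xb + 1"] by auto
next
  case False
  have sub: "sphere xb s \<subseteq> cball xb r" using assms by auto
  obtain z where z: "z \<in> sphere xb s" "\<And>x. x \<in> sphere xb s \<Longrightarrow> V z \<le> V x"
    using continuous_attains_inf[OF compact_sphere False continuous_on_subset[OF cont_V sub]] by blast
  have "V xb < V z"
    using gradient_inequality[of xb z] z sub assms g_xb r_pos by auto
  then show thesis
    using that[of "V z"] z by (auto simp: dist_commute)
qed

lemma V_near: "V xb < m \<Longrightarrow> \<exists>d>0. \<forall>x. dist x xb < d \<longrightarrow> V x < m"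
proof -
  assume m: "V xb < m"
  have "isCont V xb"
    using V_grad[of xb] r_pos by (simp add: gderiv_def has_derivative_continuous)
  from order_tendstoD(2)[OF this[unfolded isCont_def] m] obtain d where "d > 0"
    "\<And>x. x \<noteq> xb \<Longrightarrow> dist x xb < d \<Longrightarrow> V x < m"
    by (auto simp: eventually_at)
  then show ?thesis using m by metis
qed

text \<open>
  The derivative of a curve in the range of \<open>P\<close> stays in that range, so solutions satisfy the
  algebraic equations. An isolated time would not determine a derivative.
\<close>

lemma solution_tangent:
  assumes sol: "dae_solution P F \<Omega> I x" and t: "t \<in> I" "t islimpt I"
  shows "P (g (x t)) = g (x t)"
proof -
  have d: "((\<lambda>s. P (x s)) has_vector_derivative F (x t)) (at t within I)" and "x t \<in> \<Omega>"
    using sol t by (auto simp: dae_solution_def)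
  from bounded_linear.has_vector_derivative[OF bl_P this(1)]
  have "((\<lambda>s. P (x s)) has_vector_derivative P (F (x t))) (at t within I)"
    by (simp add: P_idem)
  with d have "P (F (x t)) = F (x t)"
    using vector_derivative_unique_within t(2) trivial_limit_within by blast
  then show ?thesis using constraint[OF \<open>x t \<in> \<Omega>\<close>] range_P by simp
qed

text \<open>
  The chain rule, although \<open>x\<close> itself may fail to be differentiable: by the gradient inequality
  \<open>V (x s) - V (x t)\<close> lies between \<open>g (x t) \<bullet> (x s - x t)\<close> and \<open>g (x s) \<bullet> (x s - x t)\<close>, and since
  \<open>g\<close> is in the range of \<open>P\<close> along a solution, \<open>x s - x t\<close> may be replaced by its differentiable
  part \<open>P (x s - x t)\<close>.
\<close>

lemma V_derivative:
  assumes sol: "dae_solution P F \<Omega> I x" and lim: "\<And>t. t \<in> I \<Longrightarrow> t islimpt I"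
    and ball: "\<And>t. t \<in> I \<Longrightarrow> x t \<in> cball xb r" and t: "t \<in> I"
  shows "((\<lambda>s. V (x s)) has_real_derivative g (x t) \<bullet> F (x t)) (at t within I)"
proof -
  have Pg: "P (g (x s)) = g (x s)" if "s \<in> I" for s
    using solution_tangent[OF sol that lim[OF that]] .
  have d: "((\<lambda>s. P (x s)) has_vector_derivative F (x t)) (at t within I)"
    using sol t by (auto simp: dae_solution_def)
  have d1: "((\<lambda>s. g (x t) \<bullet> P (x s)) has_real_derivative g (x t) \<bullet> F (x t)) (at t within I)"
    using bounded_linear.has_vector_derivative[OF bounded_linear_inner_right d]
    by (simp add: has_real_derivative_iff_has_vector_derivative)
  have swap: "g (x s) \<bullet> v = g (x s) \<bullet> P v" if "s \<in> I" for s v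
    using Pg[OF that] P_sym by metis
  have weak: "V (x u) + g (x u) \<bullet> (x v - x u) \<le> V (x v)" if "u \<in> I" "v \<in> I" for u v
    using gradient_inequality[OF ball[OF that(1)] ball[OF that(2)]] by (cases "x u = x v") auto
  have d0: "((\<lambda>s. V (x s) - g (x t) \<bullet> P (x s)) has_real_derivative 0) (at t within I)"
  proof (rule has_real_derivative_zero_from_bound[OF d])
    have "continuous_on I (\<lambda>s. g (x s))"
      using sol ball by (intro continuous_on_compose2[OF cont_g]) (auto simp: dae_solution_def)
    then have "((\<lambda>s. g (x s)) \<longlongrightarrow> g (x t)) (at t within I)"
      using t by (auto simp: continuous_on)
    then show "((\<lambda>s. norm (g (x s) - g (x t))) \<longlongrightarrow> 0) (at t within I)"
      using LIM_zero tendsto_norm_zero by blast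
    fix s assume s: "s \<in> I"
    have lin: "P (x s - x t) = P (x s) - P (x t)" using linear_diff[OF lin_P] .
    have lo: "g (x t) \<bullet> (P (x s) - P (x t)) \<le> V (x s) - V (x t)"
      using weak[OF t s] swap[OF t, of "x s - x t"] lin by simp
    have hi: "V (x s) - V (x t) \<le> g (x s) \<bullet> (P (x s) - P (x t))"
      using weak[OF s t] swap[OF s, of "x s - x t"] lin
      by (simp add: inner_diff_right)
    have "\<bar>(V (x s) - g (x t) \<bullet> P (x s)) - (V (x t) - g (x t) \<bullet> P (x t))\<bar>
        \<le> (g (x s) - g (x t)) \<bullet> (P (x s) - P (x t))"
      using lo hi by (simp add: inner_diff_left inner_diff_right)
    also have "\<dots> \<le> norm (g (x s) - g (x t)) * norm (P (x s) - P (x t))"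
      by (rule norm_cauchy_schwarz)
    finally show "\<bar>(V (x s) - g (x t) \<bullet> P (x s)) - (V (x t) - g (x t) \<bullet> P (x t))\<bar>
        \<le> norm (g (x s) - g (x t)) * norm (P (x s) - P (x t))" .
  qed simp
  show ?thesis
    using DERIV_add[OF d0 d1] by simp
qed

lemma V_nonincreasing:
  assumes sol: "dae_solution P F \<Omega> {0..T} x"
    and ball: "\<And>t. t \<in> {0..T} \<Longrightarrow> x t \<in> cball xb r" and s: "0 \<le> s" "s \<le> T"
  shows "V (x T) \<le> V (x s)"
proof (cases "s = T")
  case False
  have lim: "t islimpt {0..T}" if "t \<in> {0..T}" for t using that False s by simp
  have d: "((\<lambda>s. V (x s)) has_real_derivative g (x t) \<bullet> F (x t)) (at t within {0..T})"
    if "t \<in> {0..T}" for t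
    by (rule V_derivative[OF sol lim ball that])
  show ?thesis
  proof (rule DERIV_nonpos_imp_decreasing_open[of s T])
    have "continuous_on {0..T} (\<lambda>s. V (x s))"
      using d by (rule DERIV_continuous_on)
    then show "continuous_on {s..T} (\<lambda>s. V (x s))"
      by (rule continuous_on_subset) (use s in auto)
    fix t assume t: "s < t" "t < T"
    with s have "t \<in> {0..T}" by simp
    with t s have "g (x t) \<bullet> F (x t) \<le> 0"
      using dissipation[OF ball solution_tangent[OF sol _ lim]] by blast
    then show "\<exists>y. ((\<lambda>s. V (x s)) has_real_derivative y) (at t) \<and> y \<le> 0"
      using d[of t] at_within_Icc_at[of 0 t T] t s by auto
  qed (use s in simp)
qed simp

lemma solution_stays:
  assumes s: "0 < s" "s \<le> r" and barrier: "\<And>x. dist x xb = s \<Longrightarrow> m \<le> V x"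
    and init: "dist (x 0) xb < s" "V (x 0) < m"
    and sol: "dae_solution P F \<Omega> {0..T} x" and t: "t \<in> {0..T}"
  shows "dist (x t) xb < s"
proof (rule remains_in_ball[where x = x and a = xb and s = s and T = T, OF _ init(1) _ t])
  show "continuous_on {0..T} x" using sol by (simp add: dae_solution_def)
  fix t1 assume t1: "0 < t1" "t1 \<le> T" "\<And>t. t \<in> {0..t1} \<Longrightarrow> dist (x t) xb \<le> s" "dist (x t1) xb = s"
  have "V (x t1) \<le> V (x 0)"
    using t1 s by (intro V_nonincreasing dae_solution_subset[OF sol]) (force simp: dist_commute)+
  then show False using barrier[OF t1(4)] init(2) by simp
qed

text \<open>
  Substitute for the implicit function theorem. A minimizer of \<open>V\<close> over all points of a small ball
  with differential part \<open>y\<close> lies in the interior, because \<open>V\<close> is larger on the sphere than at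
  \<open>xb + (y - P xb)\<close>; so the derivative of \<open>V\<close> in the algebraic directions vanishes there.
\<close>

lemma algebraic_part_exists:
  assumes s: "0 < s" "s \<le> r"
  obtains \<rho> where "0 < \<rho>"
    and "\<And>y. \<lbrakk>P y = y; dist y (P xb) < \<rho>\<rbrakk> \<Longrightarrow> \<exists>x. dist x xb < s \<and> P x = y \<and> P (g x) = g x"
proof -
  obtain m where m: "V xb < m" "\<And>x. dist x xb = s \<Longrightarrow> m \<le> V x"
    using sphere_barrier[OF s] by blast
  obtain d where d: "0 < d" "\<And>x. dist x xb < d \<Longrightarrow> V x < m"
    using V_near[OF m(1)] by blast
  show thesis
  proof (rule that[of "min d s"])
    show "0 < min d s" using d s by simp
    fix y assume y: "P y = y" "dist y (P xb) < min d s"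
    define K where "K = {x \<in> cball xb s. P x = y}"
    define x1 where "x1 = xb + (y - P xb)"
    have "P x1 = y"
      by (simp add: x1_def linear_add[OF lin_P] linear_diff[OF lin_P] P_idem y)
    moreover have x1: "dist x1 xb < min d s" using y by (simp add: x1_def dist_norm)
    ultimately have "x1 \<in> K" by (auto simp: K_def dist_commute)
    have "closed K"
      unfolding K_def by (intro continuous_closed_preimage_constant contP) auto
    moreover have "bounded K" by (rule bounded_subset[OF bounded_cball[of xb s]]) (auto simp: K_def)
    ultimately have "compact K" by (simp add: compact_eq_bounded_closed)
    moreover have "K \<subseteq> cball xb r" using s by (auto simp: K_def)
    ultimately obtain x where x: "x \<in> K" "\<And>z. z \<in> K \<Longrightarrow> V x \<le> V z"
      using continuous_attains_inf[of K V] continuous_on_subset[OF cont_V] \<open>x1 \<in> K\<close> by (metis empty_iff)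
    have "V x < m" using x(2)[OF \<open>x1 \<in> K\<close>] d(2)[of x1] x1 by simp
    then have "dist x xb \<noteq> s" using m(2) by force
    then have dx: "dist x xb < s" using x(1) by (auto simp: K_def dist_commute)
    define h where "h = g x - P (g x)"
    have Ph: "P h = 0" by (simp add: h_def linear_diff[OF lin_P] P_idem)
    have "((\<lambda>u. V (x + u *\<^sub>R h)) has_real_derivative g x \<bullet> h) (at 0)"
    proof -
      have "((\<lambda>u::real. x + u *\<^sub>R h) has_derivative (\<lambda>u. u *\<^sub>R h)) (at 0)"
        by (auto intro!: derivative_eq_intros)
      from has_derivative_compose[OF this, of V "\<lambda>h. h \<bullet> g x"]
      have "((\<lambda>u. V (x + u *\<^sub>R h)) has_derivative (\<lambda>u. (u *\<^sub>R h) \<bullet> g x)) (at 0)"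
        using V_grad[of x] dx s by (simp add: gderiv_def dist_commute)
      then show ?thesis
        unfolding has_field_derivative_def
        by (rule has_derivative_eq_rhs) (auto simp: inner_commute)
    qed
    moreover
    \<comment> \<open>For \<open>\<bar>u\<bar> < e\<close> the point \<open>x + u h\<close> stays in the ball, also when \<open>h = 0\<close>.\<close>
    define e where "e = (s - dist x xb) / (norm h + 1)"
    have n: "0 < norm h + 1" using norm_ge_zero[of h] by linarith
    have e: "0 < e" using dx n by (simp add: e_def)
    have "V x \<le> V (x + u *\<^sub>R h)" if "\<bar>u\<bar> < e" for u
    proof (rule x(2))
      have "\<bar>u\<bar> * (norm h + 1) \<le> s - dist x xb" using that n by (simp add: e_def field_simps)
      then have "norm (u *\<^sub>R h) \<le> s - dist x xb" by (simp add: algebra_simps)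
      then have "dist (x + u *\<^sub>R h) xb \<le> s"
        using norm_triangle_ineq[of "x - xb" "u *\<^sub>R h"] by (simp add: dist_norm algebra_simps)
      then show "x + u *\<^sub>R h \<in> K"
        using x(1) Ph by (simp add: K_def dist_commute linear_add[OF lin_P] linear_scale[OF lin_P])
    qed
    ultimately have "g x \<bullet> h = 0"
      using DERIV_local_min[of "\<lambda>u. V (x + u *\<^sub>R h)" _ 0 e] e by simp
    moreover have "P (g x) \<bullet> h = 0" using P_sym Ph by simp
    ultimately have "h = 0" unfolding h_def by (metis inner_diff_left inner_eq_zero_iff diff_self)
    then show "\<exists>x. dist x xb < s \<and> P x = y \<and> P (g x) = g x"
      using dx x(1) by (auto simp: K_def h_def)
  qed
qed

text \<open>
  For consistent states, strong monotonicity bounds the full difference by the differential one,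
  because \<open>g x - g y\<close> only sees \<open>P (x - y)\<close>.
\<close>

lemma M_lipschitz:
  assumes "x \<in> M" "y \<in> M"
  shows "norm (x - y) \<le> \<bar>C\<bar> / c * norm (P x - P y)"
proof (cases "x = y")
  case False
  have xy: "x \<in> cball xb r" "y \<in> cball xb r" "P (g x) = g x" "P (g y) = g y"
    using assms by (auto simp: M_def)
  have "c * (norm (x - y))\<^sup>2 \<le> (g x - g y) \<bullet> (x - y)" using g_mono xy by simp
  also have "\<dots> = (g x - g y) \<bullet> (P x - P y)"
    using P_sym[of "g x - g y" "x - y"] xy by (simp add: linear_diff[OF lin_P])
  also have "\<dots> \<le> norm (g x - g y) * norm (P x - P y)" by (rule norm_cauchy_schwarz)
  also have "\<dots> \<le> (\<bar>C\<bar> * norm (x - y)) * norm (P x - P y)"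
    using g_lip[OF xy(1,2)] abs_ge_self[of C]
    by (intro mult_right_mono) (meson mult_right_mono norm_ge_zero order_trans, simp)
  finally have "norm (x - y) * (c * norm (x - y)) \<le> norm (x - y) * (\<bar>C\<bar> * norm (P x - P y))"
    by (simp add: power2_eq_square algebra_simps)
  then have "c * norm (x - y) \<le> \<bar>C\<bar> * norm (P x - P y)"
    using False by simp
  then show ?thesis using c_pos by (simp add: field_simps)
qed simp

text \<open>
  Any solution is confined by the barrier on a small sphere. For existence, the consistent state
  \<open>\<Psi> y\<close> over \<open>y\<close> reduces the system to \<open>y' = F (\<Psi> y)\<close> on a ball in the range of \<open>P\<close>, and composing
  with the nearest-point map of that ball makes the right-hand side globally Lipschitz. The
  confinement shows that the modification is never felt.
\<close>

theorem stable: "dae_stable P F \<Omega> xb"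
  unfolding dae_stable_def
proof (intro allI impI)
  fix \<epsilon> :: real assume \<epsilon>: "0 < \<epsilon>"
  obtain \<rho> where \<rho>: "0 < \<rho>"
    "\<And>y. \<lbrakk>P y = y; dist y (P xb) < \<rho>\<rbrakk> \<Longrightarrow> \<exists>x. dist x xb < r \<and> P x = y \<and> P (g x) = g x"
    using algebraic_part_exists[of r] r_pos by auto
  define s where "s = min (\<rho> / 2) (min \<epsilon> r)"
  have s: "0 < s" "s \<le> r" "s \<le> \<epsilon>" "s < \<rho>" using \<rho> \<epsilon> r_pos by (auto simp: s_def)
  obtain m where m: "V xb < m" "\<And>x. dist x xb = s \<Longrightarrow> m \<le> V x"
    using sphere_barrier[OF s(1,2)] by blast
  obtain d where d: "0 < d" "\<And>x. dist x xb < d \<Longrightarrow> V x < m"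
    using V_near[OF m(1)] by blast
  define S where "S = {y. P y = y} \<inter> cball (P xb) s"
  have S: "closed S" "convex S" "S \<noteq> {}"
  proof -
    have "subspace {y. P y = y}"
      by (auto simp: subspace_def linear_0[OF lin_P] linear_add[OF lin_P] linear_scale[OF lin_P])
    then show "closed S" "convex S"
      unfolding S_def
      by (intro closed_Int closed_subspace closed_cball convex_Int convex_cball subspace_imp_convex; assumption)+
    have "P xb \<in> S" using s P_idem by (simp add: S_def)
    then show "S \<noteq> {}" by blast
  qed
  define \<Psi> where "\<Psi> y = (SOME x. x \<in> M \<and> P x = y)" for y
  have \<Psi>: "\<Psi> y \<in> M" "P (\<Psi> y) = y" if "y \<in> S" for y
  proof -
    have "\<exists>x. dist x xb < r \<and> P x = y \<and> P (g x) = g x"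
      by (rule \<rho>(2)) (use that s in \<open>auto simp: S_def dist_commute\<close>)
    then obtain x where "dist x xb < r" "P x = y" "P (g x) = g x" by blast
    then have "x \<in> M \<and> P x = y" by (simp add: M_def dist_commute)
    then have "\<exists>x. x \<in> M \<and> P x = y" ..
    from someI_ex[OF this] show "\<Psi> y \<in> M" "P (\<Psi> y) = y" by (auto simp: \<Psi>_def)
  qed
  define \<Phi> where "\<Phi> y = \<Psi> (closest_point S y)" for y
  have cpS: "closest_point S y \<in> S" for y
    using closest_point_in_set[OF S(1,3)] .
  have \<Phi>_M: "\<Phi> y \<in> M" for y
    unfolding \<Phi>_def by (rule \<Psi>(1)[OF cpS])
  have \<Phi>_lip: "norm (\<Phi> y - \<Phi> z) \<le> \<bar>C\<bar> / c * norm (y - z)" for y z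
  proof -
    have "norm (\<Phi> y - \<Phi> z) \<le> \<bar>C\<bar> / c * norm (P (\<Phi> y) - P (\<Phi> z))"
      by (rule M_lipschitz[OF \<Phi>_M \<Phi>_M])
    also have "\<dots> = \<bar>C\<bar> / c * dist (closest_point S y) (closest_point S z)"
      by (simp add: \<Phi>_def \<Psi>(2)[OF cpS] dist_norm)
    also have "\<dots> \<le> \<bar>C\<bar> / c * dist y z"
      using c_pos by (intro mult_left_mono closest_point_lipschitz S) auto
    finally show ?thesis by (simp add: dist_norm)
  qed
  have F\<Phi>_lip: "norm (F (\<Phi> y) - F (\<Phi> z)) \<le> (\<bar>C\<bar> * (\<bar>C\<bar> / c)) * norm (y - z)" for y z
  proof -
    have "norm (F (\<Phi> y) - F (\<Phi> z)) \<le> C * norm (\<Phi> y - \<Phi> z)"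
      using F_lip[of "\<Phi> y" "\<Phi> z"] M_tangent[OF \<Phi>_M] \<Phi>_M by (simp add: M_def)
    also have "\<dots> \<le> \<bar>C\<bar> * norm (\<Phi> y - \<Phi> z)"
      by (intro mult_right_mono) auto
    also have "\<dots> \<le> \<bar>C\<bar> * (\<bar>C\<bar> / c * norm (y - z))"
      by (intro mult_left_mono \<Phi>_lip) auto
    finally show ?thesis by (simp add: mult.assoc)
  qed
  have exist: "\<exists>x. dae_solution P F \<Omega> {0..} x \<and> x 0 = x0"
    if x0: "x0 \<in> dae_consistent P F \<Omega>" "dist x0 xb < min d s" for x0
  proof -
    have x0M: "x0 \<in> M"
      using x0 s constraint by (auto simp: dae_consistent_def M_def dist_commute)
    obtain y where y0: "y 0 = P x0"
      and y: "\<And>t. 0 \<le> t \<Longrightarrow> (y has_vector_derivative F (\<Phi> (y t))) (at t within {0..})"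
      using global_ode_solution[of "\<lambda>y. F (\<Phi> y)", OF F\<Phi>_lip] by metis
    define x where "x t = \<Phi> (y t)" for t
    have conty: "continuous_on {0..} y"
      by (rule continuous_on_vector_derivative) (use y in auto)
    have "continuous_on UNIV \<Phi>"
      using \<Phi>_lip c_pos
      by (intro lipschitz_on_continuous_on[of "\<bar>C\<bar> / c"] lipschitz_onI) (auto simp: dist_norm)
    then have contx: "continuous_on {0..} x"
      unfolding x_def using conty by (rule continuous_on_compose2) auto
    have Py: "P (y t) = y t" if t: "0 \<le> t" for t
    proof -
      have "((\<lambda>t. y t - P (y t)) has_vector_derivative 0) (at t within {0..})" if "t \<in> {0..}" for t
      proof -
        have d: "(y has_vector_derivative F (\<Phi> (y t))) (at t within {0..})"
          using y that by simp
        show ?thesis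
          using has_vector_derivative_diff[OF d bounded_linear.has_vector_derivative[OF bl_P d]]
            M_tangent[OF \<Phi>_M] by simp
      qed
      from has_vector_derivative_zero_constant[OF _ this] obtain a
        where a: "\<And>t. t \<in> {0..} \<Longrightarrow> y t - P (y t) = a" by auto
      have "a = 0" using a[of 0] y0 P_idem by simp
      then show ?thesis using a[of t] t by simp
    qed
    have PxS: "P (x t) = y t" if "y t \<in> S" for t
      using \<Psi>(2)[OF that] closest_point_self[OF that] by (simp add: x_def \<Phi>_def)
    have sol: "dae_solution P F \<Omega> J x" if J: "J \<subseteq> {0..}" "\<And>t. t \<in> J \<Longrightarrow> y t \<in> S" for J
      unfolding dae_solution_def
    proof (intro conjI ballI)
      show "continuous_on J x" using contx J(1) by (rule continuous_on_subset)
      fix t assume t: "t \<in> J"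
      show "x t \<in> \<Omega>" using \<Phi>_M[of "y t"] ball_sub by (auto simp: x_def M_def)
      have "(y has_vector_derivative F (x t)) (at t within J)"
        using y[of t] t J(1) has_vector_derivative_within_subset unfolding x_def by blast
      then show "((\<lambda>s. P (x s)) has_vector_derivative F (x t)) (at t within J)"
        by (rule has_vector_derivative_transform[OF t PxS[OF J(2)], rotated])
    qed
    have y0': "dist (y 0) (P xb) < s"
      using norm_P_le[of "x0 - xb"] x0(2) by (simp add: y0 dist_norm linear_diff[OF lin_P])
    then have "y 0 \<in> S" using Py[of 0] by (simp add: S_def dist_commute)
    have "norm (x 0 - x0) \<le> \<bar>C\<bar> / c * norm (P (x 0) - P x0)"
      using M_lipschitz[OF _ x0M] \<Phi>_M by (simp add: x_def)
    then have xx0: "x 0 = x0" using PxS[OF \<open>y 0 \<in> S\<close>] y0 by simp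
    \<comment> \<open>Exit is excluded for \<open>y\<close>, not for \<open>x\<close>: until then \<open>y\<close> is in \<open>S\<close>, so \<open>x\<close> solves the original
      system and is confined by the barrier, and \<open>P\<close> does not increase distances.\<close>
    have stay: "dist (y t) (P xb) < s" if t: "0 \<le> t" for t
    proof (rule remains_in_ball[where x = y and a = "P xb" and s = s and T = t, OF _ y0'])
      show "continuous_on {0..t} y" using conty by (rule continuous_on_subset) auto
      show "t \<in> {0..t}" using t by simp
      fix t1 assume t1: "0 < t1" "\<And>t. t \<in> {0..t1} \<Longrightarrow> dist (y t) (P xb) \<le> s" "dist (y t1) (P xb) = s"
      have inS: "y t \<in> S" if "t \<in> {0..t1}" for t
        using t1(2)[OF that] Py that by (auto simp: S_def dist_commute)
      have "dist (x t1) xb < s"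
      proof (rule solution_stays[OF s(1,2) m(2)])
        show "dae_solution P F \<Omega> {0..t1} x" using inS by (intro sol) auto
        show "dist (x 0) xb < s" "V (x 0) < m" using xx0 x0(2) d(2) by auto
      qed (use t1 in auto)
      moreover have "dist (y t1) (P xb) \<le> dist (x t1) xb"
        using norm_P_le[of "x t1 - xb"] PxS[OF inS[of t1]] t1(1)
        by (simp add: dist_norm linear_diff[OF lin_P])
      ultimately show False using t1(3) by simp
    qed
    have "dae_solution P F \<Omega> {0..} x"
      using stay Py by (intro sol) (auto simp: S_def dist_commute less_imp_le)
    then show ?thesis using xx0 by blast
  qed
  show "\<exists>\<delta>>0. \<forall>x0\<in>dae_consistent P F \<Omega>. dist x0 xb < \<delta> \<longrightarrow>
        (\<exists>x. dae_solution P F \<Omega> {0..} x \<and> x 0 = x0) \<and>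
        (\<forall>T>0. \<forall>x. dae_solution P F \<Omega> {0..T} x \<and> x 0 = x0 \<longrightarrow>
           (\<forall>t\<in>{0..T}. dist (x t) xb < \<epsilon>))"
  proof (rule exI[of _ "min d s"], intro conjI ballI impI allI exist)
    show "0 < min d s" using d s by simp
    fix x0 T x t
    assume x0: "dist x0 xb < min d s" and x: "dae_solution P F \<Omega> {0..T} x \<and> x 0 = x0"
      and t: "t \<in> {0..T}"
    have "dist (x t) xb < s"
      by (rule solution_stays[OF s(1,2) m(2), of x T]) (use x0 x t d in auto)
    then show "dist (x t) xb < \<epsilon>" using s by simp
  qed
qed

lemma trajectory_uniformly_continuous:
  assumes sol: "dae_solution P F \<Omega> {0..} x" and M: "\<And>t. 0 \<le> t \<Longrightarrow> x t \<in> M"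
  shows "uniformly_continuous_on {0..} x"
proof -
  have "compact (F ` M)" by (intro compact_continuous_image cont_F compact_M)
  then obtain B where B: "\<And>z. z \<in> M \<Longrightarrow> norm (F z) \<le> B" "0 < B"
    unfolding compact_eq_bounded_closed bounded_pos by auto
  have "norm (P (x t) - P (x s)) \<le> B * norm (t - s)" if "t \<in> {0..}" "s \<in> {0..}" for t s
  proof (rule differentiable_bound[where S = "{0..}" and f = "\<lambda>t. P (x t)" and f' = "\<lambda>t u. u *\<^sub>R F (x t)"])
    show "((\<lambda>t. P (x t)) has_derivative (\<lambda>u. u *\<^sub>R F (x t))) (at t within {0..})" if "t \<in> {0..}" for t
      using sol that by (auto simp: dae_solution_def has_vector_derivative_def)
    show "onorm (\<lambda>u. u *\<^sub>R F (x t)) \<le> B" if "t \<in> {0..}" for t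
      using B(1)[OF M, of t] that
      by (intro onorm_le) (auto simp: mult.commute[of B] intro: mult_left_mono)
  qed (use that in auto)
  then have lip: "norm (x t - x s) \<le> (\<bar>C\<bar> / c * B) * norm (t - s)" if "t \<in> {0..}" "s \<in> {0..}" for t s
    using M_lipschitz[OF M M, of t s] that c_pos
      mult_left_mono[of "norm (P (x t) - P (x s))" "B * norm (t - s)" "\<bar>C\<bar> / c"]
    by (fastforce simp: mult.assoc)
  have "(\<bar>C\<bar> / c * B)-lipschitz_on {0..} x"
    using lip c_pos B(2) by (intro lipschitz_onI) (auto simp: dist_norm)
  then show ?thesis by (rule lipschitz_on_uniformly_continuous)
qed

lemma uniformly_continuous_along_trajectory:
  fixes q :: "'x \<Rightarrow> 'b::metric_space"
  assumes sol: "dae_solution P F \<Omega> {0..} x" and M: "\<And>t. 0 \<le> t \<Longrightarrow> x t \<in> M"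
    and q: "continuous_on M q"
  shows "uniformly_continuous_on {0..} (\<lambda>t. q (x t))"
proof -
  have "uniformly_continuous_on M q"
    by (rule compact_uniformly_continuous[OF q compact_M])
  then have "uniformly_continuous_on (x ` {0..}) q"
    using M unfolding uniformly_continuous_on_def by (metis (no_types, lifting) atLeast_iff imageE)
  from uniformly_continuous_on_compose[OF trajectory_uniformly_continuous[OF sol M] this]
  show ?thesis by simp
qed

lemma closed_M: "closed M"
  using compact_M by (rule compact_imp_closed)

text \<open>
  \<open>V\<close> decreases along the solution to a limit, so Barbalat's lemma applies to its derivative.
\<close>

lemma limit_points_no_dissipation:
  assumes sol: "dae_solution P F \<Omega> {0..} x" and M: "\<And>t. 0 \<le> t \<Longrightarrow> x t \<in> M"
    and z: "z \<in> limit_points x"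
  shows "g z \<bullet> F z = 0"
proof -
  have ball: "x t \<in> cball xb r" if "0 \<le> t" for t using M[OF that] by (simp add: M_def)
  have anti: "V (x t) \<le> V (x s)" if "0 \<le> s" "s \<le> t" for s t
    by (rule V_nonincreasing[OF dae_solution_subset[OF sol]]) (use that ball in auto)
  have low: "V xb \<le> V (x t)" if "0 \<le> t" for t
    using gradient_inequality[of xb "x t"] ball[OF that] g_xb r_pos by (cases "x t = xb") auto
  define l where "l = Inf ((\<lambda>t. V (x t)) ` {0..})"
  have bdd: "bdd_below ((\<lambda>t. V (x t)) ` {0..})" using low by (intro bdd_belowI2) auto
  have lim: "((\<lambda>t. V (x t)) \<longlongrightarrow> l) at_top"
  proof (rule tendstoI)
    fix e :: real assume e: "0 < e"
    obtain t0 where t0: "0 \<le> t0" "V (x t0) < l + e"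
      using cInf_less_iff[OF _ bdd, of "l + e"] e by (auto simp: l_def)
    show "\<forall>\<^sub>F t in at_top. dist (V (x t)) l < e"
      using eventually_ge_at_top[of t0]
    proof eventually_elim
      case (elim t)
      have "l \<le> V (x t)" unfolding l_def using elim t0 by (intro cInf_lower bdd) auto
      then show ?case using anti[OF t0(1) elim] t0(2) by (simp add: dist_real_def)
    qed
  qed
  have "((\<lambda>t. g (x t) \<bullet> F (x t)) \<longlongrightarrow> 0) at_top"
  proof (rule barbalat[OF _ _ lim])
    fix t :: real assume t: "0 \<le> t"
    have limpt: "t islimpt {0..}" if "t \<in> {0..}" for t :: real
      by (rule islimpt_subset[of t "{t..t+1}"]) (use that in auto)
    show "((\<lambda>t. V (x t)) has_vector_derivative g (x t) \<bullet> F (x t)) (at t within {0..})"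
      using V_derivative[OF sol limpt, of t] ball t
      by (simp add: has_real_derivative_iff_has_vector_derivative)
  next
    have "continuous_on M (\<lambda>z. g z \<bullet> F z)"
      by (intro continuous_intros cont_F continuous_on_subset[OF cont_g]) (auto simp: M_def)
    then show "uniformly_continuous_on {0..} (\<lambda>t. g (x t) \<bullet> F (x t))"
      using uniformly_continuous_along_trajectory[OF sol M] by blast
  qed
  moreover have "continuous_on M (\<lambda>z. g z \<bullet> F z)"
    by (intro continuous_intros cont_F continuous_on_subset[OF cont_g]) (auto simp: M_def)
  ultimately show ?thesis
    using z by (intro limit_points_eq[where q = "\<lambda>z. g z \<bullet> F z" and K = M and x = x] closed_M M)
qed

text \<open>
  A replacement for the invariance of the limit set: a linear observable \<open>A\<close> of the differential
  variables that is constant there converges along the solution, and then so does its derivative,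
  to zero.
\<close>

lemma limit_points_stationary:
  fixes A :: "'x \<Rightarrow> 'b::real_normed_vector"
  assumes sol: "dae_solution P F \<Omega> {0..} x" and M: "\<And>t. 0 \<le> t \<Longrightarrow> x t \<in> M"
    and A: "bounded_linear A" "\<And>z. A (P z) = A z"
    and const: "\<And>z. z \<in> limit_points x \<Longrightarrow> A z = a"
    and z: "z \<in> limit_points x"
  shows "A (F z) = 0"
proof -
  have contA: "continuous_on M (\<lambda>z. A (F z))"
    by (intro bounded_linear.continuous_on[OF A(1)] cont_F)
  have lim: "((\<lambda>t. A (x t)) \<longlongrightarrow> a) at_top"
    by (rule tendsto_if_constant_on_limit_points[OF compact_M M linear_continuous_on[OF A(1)] const])
  have "((\<lambda>t. A (F (x t))) \<longlongrightarrow> 0) at_top"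
  proof (rule barbalat[OF _ _ lim])
    fix t :: real assume t: "0 \<le> t"
    then have "((\<lambda>t. P (x t)) has_vector_derivative F (x t)) (at t within {0..})"
      using sol by (auto simp: dae_solution_def)
    from bounded_linear.has_vector_derivative[OF A(1) this]
    show "((\<lambda>t. A (x t)) has_vector_derivative A (F (x t))) (at t within {0..})"
      by (simp add: A(2))
  qed (rule uniformly_continuous_along_trajectory[OF sol M contA])
  then show ?thesis
    using z by (intro limit_points_eq[where q = "\<lambda>z. A (F z)" and K = M and x = x] closed_M M contA)
qed

text \<open>
  The hypothesis is all that remains to be shown in LaSalle's principle: solutions that start close
  enough stay in the compact set \<open>M\<close>, hence converge to their limit set.
\<close>

theorem attractive:
  assumes lasalle: "\<And>x. \<lbrakk>dae_solution P F \<Omega> {0..} x; \<And>t. 0 \<le> t \<Longrightarrow> x t \<in> M\<rbrakk> \<Longrightarrow> limit_points x \<subseteq> {xb}"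
  shows "dae_attractive P F \<Omega> xb"
proof -
  obtain m where m: "V xb < m" "\<And>x. dist x xb = r \<Longrightarrow> m \<le> V x"
    using sphere_barrier[OF r_pos order_refl] by blast
  obtain d where d: "0 < d" "\<And>x. dist x xb < d \<Longrightarrow> V x < m"
    using V_near[OF m(1)] by blast
  have "(x \<longlongrightarrow> xb) at_top"
    if x0: "dist x0 xb < min d r" and x: "dae_solution P F \<Omega> {0..} x \<and> x 0 = x0" for x0 x
  proof -
    have ball: "x t \<in> cball xb r" if "0 \<le> t" for t
      using solution_stays[OF r_pos order_refl m(2), of x t t] dae_solution_subset[of P F \<Omega> "{0..}" x "{0..t}"]
        x x0 d(2) that by (auto simp: dist_commute less_imp_le)
    have limpt: "t islimpt {0..}" if "t \<in> {0..}" for t :: real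
      by (rule islimpt_subset[of t "{t..t+1}"]) (use that in auto)
    have M: "x t \<in> M" if "0 \<le> t" for t
      using ball[OF that] solution_tangent[of "{0..}" x t] x that limpt by (simp add: M_def)
    have "limit_points x \<subseteq> {xb}"
      by (rule lasalle) (use x M in auto)
    then have "z = xb" if "z \<in> limit_points x" for z using that by auto
    then show ?thesis
      by (intro tendsto_if_constant_on_limit_points[where q = "\<lambda>z. z" and K = M] compact_M M
          continuous_on_id)
  qed
  then show ?thesis
    unfolding dae_attractive_def using d r_pos by (intro exI[of _ "min d r"]) auto
qed

end

section \<open>Strict differentiability\<close>

text \<open>
  Strict (Peano) differentiability at a point. It controls differences of values at two nearby points
  and thus implies a local Lipschitz bound, while still being preserved by composition, so it
  can be verified at the equilibrium alone.
\<close>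

definition strictly_differentiable ::
  "('a::real_normed_vector \<Rightarrow> 'b::real_normed_vector) \<Rightarrow> 'a \<Rightarrow> bool" where
  "strictly_differentiable f a \<longleftrightarrow> (\<exists>f'. bounded_linear f' \<and>
     (\<forall>e>0. \<exists>d>0. \<forall>x\<in>ball a d. \<forall>y\<in>ball a d. norm (f x - f y - f' (x - y)) \<le> e * norm (x - y)))"

lemma strictly_differentiableI:
  assumes "bounded_linear f'"
    and "\<And>e. 0 < e \<Longrightarrow> \<exists>d>0. \<forall>x\<in>ball a d. \<forall>y\<in>ball a d. norm (f x - f y - f' (x - y)) \<le> e * norm (x - y)"
  shows "strictly_differentiable f a"
  using assms unfolding strictly_differentiable_def by blast

lemma strictly_differentiable_derivative:
  assumes "strictly_differentiable f a"
  obtains f' where "(f has_derivative f') (at a)" and "bounded_linear f'"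
    and "\<And>e. 0 < e \<Longrightarrow> \<exists>d>0. \<forall>x\<in>ball a d. \<forall>y\<in>ball a d. norm (f x - f y - f' (x - y)) \<le> e * norm (x - y)"
proof -
  obtain f' where f': "bounded_linear f'"
    "\<And>e. 0 < e \<Longrightarrow> \<exists>d>0. \<forall>x\<in>ball a d. \<forall>y\<in>ball a d. norm (f x - f y - f' (x - y)) \<le> e * norm (x - y)"
    using assms unfolding strictly_differentiable_def by blast
  have "(f has_derivative f') (at a)"
    unfolding has_derivative_at_alt
  proof (intro conjI f' allI impI)
    fix e :: real assume "0 < e"
    from f'(2)[OF this] obtain d where d: "0 < d"
      "\<And>x y. x \<in> ball a d \<Longrightarrow> y \<in> ball a d \<Longrightarrow> norm (f x - f y - f' (x - y)) \<le> e * norm (x - y)" by blast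
    have "norm (f y - f a - f' (y - a)) \<le> e * norm (y - a)" if "norm (y - a) < d" for y
      using d(2)[of y a] d(1) that by (simp add: dist_norm norm_minus_commute)
    then show "\<exists>d>0. \<forall>y. norm (y - a) < d \<longrightarrow> norm (f y - f a - f' (y - a)) \<le> e * norm (y - a)"
      using d(1) by blast
  qed
  then show thesis using that f' by blast
qed

lemma strictly_differentiable_lipschitz:
  assumes "strictly_differentiable f a"
  obtains d K where "0 < d" and "0 < K"
    and "\<And>x y. \<lbrakk>x \<in> ball a d; y \<in> ball a d\<rbrakk> \<Longrightarrow> norm (f x - f y) \<le> K * norm (x - y)"
proof -
  obtain f' where f': "bounded_linear f'"
    "\<And>e. 0 < e \<Longrightarrow> \<exists>d>0. \<forall>x\<in>ball a d. \<forall>y\<in>ball a d. norm (f x - f y - f' (x - y)) \<le> e * norm (x - y)"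
    using strictly_differentiable_derivative[OF assms] by metis
  obtain B where B: "0 < B" "\<And>x. norm (f' x) \<le> norm x * B"
    using bounded_linear.pos_bounded[OF f'(1)] by blast
  obtain d where d: "0 < d"
    "\<And>x y. x \<in> ball a d \<Longrightarrow> y \<in> ball a d \<Longrightarrow> norm (f x - f y - f' (x - y)) \<le> 1 * norm (x - y)"
    using f'(2)[of 1] by auto
  show thesis
  proof (rule that[of d "B + 1"])
    fix x y assume "x \<in> ball a d" "y \<in> ball a d"
    from d(2)[OF this] B(2)[of "x - y"] norm_triangle_sub[of "f x - f y" "f' (x - y)"]
    show "norm (f x - f y) \<le> (B + 1) * norm (x - y)" by (simp add: algebra_simps)
  qed (use d B in auto)
qed

lemma strictly_differentiable_isCont:
  "strictly_differentiable f a \<Longrightarrow> isCont f a"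
  by (meson strictly_differentiable_derivative has_derivative_continuous)

lemma strictly_differentiable_linear:
  assumes "bounded_linear f" shows "strictly_differentiable f a"
proof (rule strictly_differentiableI[OF assms])
  interpret bounded_linear f by fact
  show "\<exists>d>0. \<forall>x\<in>ball a d. \<forall>y\<in>ball a d. norm (f x - f y - f (x - y)) \<le> e * norm (x - y)"
    if "0 < e" for e :: real
    using that by (intro exI[of _ 1]) (auto simp: diff)
qed

lemma strictly_differentiable_const: "strictly_differentiable (\<lambda>x. k) a"
  by (rule strictly_differentiableI[of "\<lambda>_. 0"]) (auto intro!: exI[of _ 1])

lemma strictly_differentiable_compose:
  assumes f: "strictly_differentiable f a" and g: "strictly_differentiable g (f a)"
  shows "strictly_differentiable (\<lambda>x. g (f x)) a"
proof -
  obtain f' where f': "bounded_linear f'"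
    "\<And>e. 0 < e \<Longrightarrow> \<exists>d>0. \<forall>x\<in>ball a d. \<forall>y\<in>ball a d. norm (f x - f y - f' (x - y)) \<le> e * norm (x - y)"
    using strictly_differentiable_derivative[OF f] by metis
  obtain g' where g': "bounded_linear g'"
    "\<And>e. 0 < e \<Longrightarrow> \<exists>d>0. \<forall>x\<in>ball (f a) d. \<forall>y\<in>ball (f a) d. norm (g x - g y - g' (x - y)) \<le> e * norm (x - y)"
    using strictly_differentiable_derivative[OF g] by metis
  obtain B where B: "0 < B" "\<And>x. norm (g' x) \<le> norm x * B"
    using bounded_linear.pos_bounded[OF g'(1)] by blast
  obtain d0 K where K: "0 < d0" "0 < K"
    "\<And>x y. \<lbrakk>x \<in> ball a d0; y \<in> ball a d0\<rbrakk> \<Longrightarrow> norm (f x - f y) \<le> K * norm (x - y)"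
    using strictly_differentiable_lipschitz[OF f] by metis
  show ?thesis
  proof (rule strictly_differentiableI[of "\<lambda>x. g' (f' x)"])
    show "bounded_linear (\<lambda>x. g' (f' x))"
      by (rule bounded_linear_compose[OF g'(1) f'(1)])
    fix e :: real assume e: "0 < e"
    have "0 < e / (2 * B)" "0 < e / (2 * K)" using e B K by auto
    obtain d1 where d1: "0 < d1"
      "\<And>x y. \<lbrakk>x \<in> ball a d1; y \<in> ball a d1\<rbrakk> \<Longrightarrow> norm (f x - f y - f' (x - y)) \<le> e / (2 * B) * norm (x - y)"
      using f'(2)[OF \<open>0 < e / (2 * B)\<close>] by blast
    obtain d2 where d2: "0 < d2"
      "\<And>x y. \<lbrakk>x \<in> ball (f a) d2; y \<in> ball (f a) d2\<rbrakk> \<Longrightarrow> norm (g x - g y - g' (x - y)) \<le> e / (2 * K) * norm (x - y)"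
      using g'(2)[OF \<open>0 < e / (2 * K)\<close>] by blast
    define d where "d = min (min d0 d1) (d2 / K)"
    have fb: "f x \<in> ball (f a) d2" if "x \<in> ball a d" for x
    proof -
      have "norm (f a - f x) \<le> K * norm (a - x)" using K that by (auto simp: d_def)
      also have "\<dots> < K * (d2 / K)" using that K by (intro mult_strict_left_mono) (auto simp: d_def dist_norm)
      finally show ?thesis using K by (simp add: dist_norm)
    qed
    have "norm (g (f x) - g (f y) - g' (f' (x - y))) \<le> e * norm (x - y)"
      if xy: "x \<in> ball a d" "y \<in> ball a d" for x y
    proof -
      have eq: "g (f x) - g (f y) - g' (f' (x - y))
          = (g (f x) - g (f y) - g' (f x - f y)) + g' (f x - f y - f' (x - y))"
        by (simp add: bounded_linear.linear[OF g'(1)] linear_diff)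
      have "norm (g (f x) - g (f y) - g' (f' (x - y)))
          \<le> norm (g (f x) - g (f y) - g' (f x - f y)) + norm (g' (f x - f y - f' (x - y)))"
        by (metis eq norm_triangle_ineq)
      also have "norm (g (f x) - g (f y) - g' (f x - f y)) \<le> e / (2 * K) * norm (f x - f y)"
        by (rule d2(2)[OF fb[OF xy(1)] fb[OF xy(2)]])
      also have "\<dots> \<le> e / (2 * K) * (K * norm (x - y))"
        using K e xy by (intro mult_left_mono K(3)) (auto simp: d_def)
      also have "norm (g' (f x - f y - f' (x - y))) \<le> norm (f x - f y - f' (x - y)) * B"
        by (rule B(2))
      also have "\<dots> \<le> (e / (2 * B) * norm (x - y)) * B"
        using B xy by (intro mult_right_mono d1(2)) (auto simp: d_def)
      also have "e / (2 * K) * (K * norm (x - y)) + (e / (2 * B) * norm (x - y)) * B = e * norm (x - y)"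
        using K B by (simp add: field_simps)
      finally show ?thesis by simp
    qed
    moreover have "0 < d" using K d1 d2 by (simp add: d_def)
    ultimately show "\<exists>d>0. \<forall>x\<in>ball a d. \<forall>y\<in>ball a d.
        norm (g (f x) - g (f y) - g' (f' (x - y))) \<le> e * norm (x - y)" by blast
  qed
qed

lemma strictly_differentiable_Pair:
  assumes f: "strictly_differentiable f a" and g: "strictly_differentiable g a"
  shows "strictly_differentiable (\<lambda>x. (f x, g x)) a"
proof -
  obtain f' where f': "bounded_linear f'"
    "\<And>e. 0 < e \<Longrightarrow> \<exists>d>0. \<forall>x\<in>ball a d. \<forall>y\<in>ball a d. norm (f x - f y - f' (x - y)) \<le> e * norm (x - y)"
    using strictly_differentiable_derivative[OF f] by metis
  obtain g' where g': "bounded_linear g'"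
    "\<And>e. 0 < e \<Longrightarrow> \<exists>d>0. \<forall>x\<in>ball a d. \<forall>y\<in>ball a d. norm (g x - g y - g' (x - y)) \<le> e * norm (x - y)"
    using strictly_differentiable_derivative[OF g] by metis
  show ?thesis
  proof (rule strictly_differentiableI[of "\<lambda>x. (f' x, g' x)"])
    show "bounded_linear (\<lambda>x. (f' x, g' x))" by (rule bounded_linear_Pair[OF f'(1) g'(1)])
    fix e :: real assume "0 < e"
    then have e2: "0 < e / 2" by simp
    obtain d1 where d1: "0 < d1"
      "\<And>x y. \<lbrakk>x \<in> ball a d1; y \<in> ball a d1\<rbrakk> \<Longrightarrow> norm (f x - f y - f' (x - y)) \<le> e / 2 * norm (x - y)"
      using f'(2)[OF e2] by blast
    obtain d2 where d2: "0 < d2"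
      "\<And>x y. \<lbrakk>x \<in> ball a d2; y \<in> ball a d2\<rbrakk> \<Longrightarrow> norm (g x - g y - g' (x - y)) \<le> e / 2 * norm (x - y)"
      using g'(2)[OF e2] by blast
    have "norm ((f x, g x) - (f y, g y) - (f' (x - y), g' (x - y))) \<le> e * norm (x - y)"
      if "x \<in> ball a (min d1 d2)" "y \<in> ball a (min d1 d2)" for x y
    proof -
      have "norm (f x - f y - f' (x - y), g x - g y - g' (x - y))
        \<le> norm (f x - f y - f' (x - y)) + norm (g x - g y - g' (x - y))"
        by (rule norm_Pair_le)
      then show ?thesis using d1(2)[of x y] d2(2)[of x y] that by simp
    qed
    then show "\<exists>d>0. \<forall>x\<in>ball a d. \<forall>y\<in>ball a d.
        norm ((f x, g x) - (f y, g y) - (f' (x - y), g' (x - y))) \<le> e * norm (x - y)"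
      using d1 d2 by (intro exI[of _ "min d1 d2"]) auto
  qed
qed

lemma strictly_differentiable_add:
  "\<lbrakk>strictly_differentiable f a; strictly_differentiable g a\<rbrakk>
    \<Longrightarrow> strictly_differentiable (\<lambda>x. f x + g x) a"
  by (rule strictly_differentiable_compose[OF strictly_differentiable_Pair, of f a g "\<lambda>z. fst z + snd z",
        unfolded fst_conv snd_conv])
    (auto intro!: strictly_differentiable_linear bounded_linear_add bounded_linear_fst bounded_linear_snd)

lemma strictly_differentiable_scaleR:
  fixes f :: "'a::real_normed_vector \<Rightarrow> real" and g :: "'a \<Rightarrow> 'b::real_normed_vector"
  assumes "strictly_differentiable f a" "strictly_differentiable g a"
  shows "strictly_differentiable (\<lambda>x. f x *\<^sub>R g x) a"
proof -
  have "strictly_differentiable (\<lambda>z::real \<times> 'b. fst z *\<^sub>R snd z) (r, v)" for r v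
  proof (rule strictly_differentiableI[of "\<lambda>h. r *\<^sub>R snd h + fst h *\<^sub>R v"])
    show "bounded_linear (\<lambda>h. r *\<^sub>R snd h + fst h *\<^sub>R v)"
      by (intro bounded_linear_intros)
    fix e :: real assume e: "0 < e"
    have "norm (fst x *\<^sub>R snd x - fst y *\<^sub>R snd y - (r *\<^sub>R snd (x - y) + fst (x - y) *\<^sub>R v)) \<le> e * norm (x - y)"
      if "x \<in> ball (r, v) (e / 2)" "y \<in> ball (r, v) (e / 2)" for x y :: "real \<times> 'b"
    proof -
      have b: "norm (snd x - v) \<le> e / 2" "\<bar>fst y - r\<bar> \<le> e / 2"
        using that dist_snd_le[of x "(r, v)"] dist_fst_le[of y "(r, v)"]
        by (auto simp: dist_commute simp flip: dist_norm dist_real_def)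
      have xy: "\<bar>fst x - fst y\<bar> \<le> norm (x - y)" "norm (snd x - snd y) \<le> norm (x - y)"
        using dist_fst_le[of x y] dist_snd_le[of x y] by (auto simp: dist_norm)
      have "fst x *\<^sub>R snd x - fst y *\<^sub>R snd y - (r *\<^sub>R snd (x - y) + fst (x - y) *\<^sub>R v)
        = (fst x - fst y) *\<^sub>R (snd x - v) + (fst y - r) *\<^sub>R (snd x - snd y)"
        by (simp add: algebra_simps)
      then have "norm (fst x *\<^sub>R snd x - fst y *\<^sub>R snd y - (r *\<^sub>R snd (x - y) + fst (x - y) *\<^sub>R v))
        \<le> \<bar>fst x - fst y\<bar> * norm (snd x - v) + \<bar>fst y - r\<bar> * norm (snd x - snd y)"
        by (metis norm_scaleR norm_triangle_ineq)
      also have "\<dots> \<le> norm (x - y) * (e / 2) + (e / 2) * norm (x - y)"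
        using b xy e
        by (intro add_mono mult_mono) auto
      finally show ?thesis by simp
    qed
    then show "\<exists>d>0. \<forall>x\<in>ball (r, v) d. \<forall>y\<in>ball (r, v) d.
        norm (fst x *\<^sub>R snd x - fst y *\<^sub>R snd y - (r *\<^sub>R snd (x - y) + fst (x - y) *\<^sub>R v)) \<le> e * norm (x - y)"
      using e by (intro exI[of _ "e / 2"]) auto
  qed
  from strictly_differentiable_compose[OF strictly_differentiable_Pair[OF assms] this]
  show ?thesis by simp
qed

text \<open>
  The mean value inequality for \<open>f\<close> minus its derivative at \<open>a\<close>.
\<close>

lemma strictly_differentiable_C1:
  assumes deriv: "\<forall>\<^sub>F x in nhds a. (f has_derivative f' x) (at x)"
    and cont: "\<And>e. 0 < e \<Longrightarrow> \<forall>\<^sub>F x in nhds a. \<forall>h. norm (f' x h - f' a h) \<le> e * norm h"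
  shows "strictly_differentiable f a"
proof (rule strictly_differentiableI[of "f' a"])
  show bl: "bounded_linear (f' a)"
    using eventually_nhds_x_imp_x[OF deriv] has_derivative_bounded_linear by blast
  fix e :: real assume e: "0 < e"
  from eventually_conj[OF deriv cont[OF e]] obtain d where d: "0 < d"
    "\<And>x. x \<in> ball a d \<Longrightarrow> (f has_derivative f' x) (at x) \<and> (\<forall>h. norm (f' x h - f' a h) \<le> e * norm h)"
    by (auto simp: eventually_nhds_metric dist_commute)
  have "norm ((f x - f' a x) - (f y - f' a y)) \<le> e * norm (x - y)"
    if "x \<in> ball a d" "y \<in> ball a d" for x y
  proof (rule differentiable_bound[where S = "ball a d" and f = "\<lambda>x. f x - f' a x" and f' = "\<lambda>x h. f' x h - f' a h"])
    show "((\<lambda>x. f x - f' a x) has_derivative (\<lambda>h. f' x h - f' a h)) (at x within ball a d)" if "x \<in> ball a d" for x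
      using d(2)[OF that] by (intro has_derivative_diff bounded_linear_imp_has_derivative bl) (auto intro: has_derivative_at_withinI)
    show "onorm (\<lambda>h. f' x h - f' a h) \<le> e" if "x \<in> ball a d" for x
      using d(2)[OF that] e by (intro onorm_bound) auto
  qed (use that in auto)
  then have "norm (f x - f y - f' a (x - y)) \<le> e * norm (x - y)" if "x \<in> ball a d" "y \<in> ball a d" for x y
    using that by (simp add: linear_diff[OF bounded_linear.linear[OF bl]] algebra_simps)
  then show "\<exists>d>0. \<forall>x\<in>ball a d. \<forall>y\<in>ball a d. norm (f x - f y - f' a (x - y)) \<le> e * norm (x - y)"
    using d(1) by blast
qed

lemma strictly_differentiable_real_C1:
  fixes f :: "real \<Rightarrow> real"
  assumes "\<forall>\<^sub>F x in nhds a. (f has_real_derivative f' x) (at x)" and "isCont f' a"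
  shows "strictly_differentiable f a"
proof (rule strictly_differentiable_C1[where f' = "\<lambda>x h. f' x * h"])
  show "\<forall>\<^sub>F x in nhds a. (f has_derivative (\<lambda>h. f' x * h)) (at x)"
    using assms(1) by (simp add: has_field_derivative_def)
  fix e :: real assume "0 < e"
  then have "\<forall>\<^sub>F x in nhds a. dist (f' x) (f' a) < e"
    using assms(2) by (auto simp: isCont_def tendsto_at_iff_tendsto_nhds dest: tendstoD)
  then show "\<forall>\<^sub>F x in nhds a. \<forall>h. norm (f' x * h - f' a * h) \<le> e * norm h"
    by (rule eventually_mono)
      (auto simp: dist_real_def abs_mult left_diff_distrib[symmetric] intro!: mult_right_mono)
qed

lemma strictly_differentiable_cong:
  assumes "strictly_differentiable f a" and "\<forall>\<^sub>F x in nhds a. f x = g x"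
  shows "strictly_differentiable g a"
proof -
  obtain f' where f': "bounded_linear f'"
    "\<And>e. 0 < e \<Longrightarrow> \<exists>d>0. \<forall>x\<in>ball a d. \<forall>y\<in>ball a d. norm (f x - f y - f' (x - y)) \<le> e * norm (x - y)"
    using strictly_differentiable_derivative[OF assms(1)] by metis
  obtain d0 where d0: "0 < d0" "\<And>x. x \<in> ball a d0 \<Longrightarrow> f x = g x"
    using assms(2) by (auto simp: eventually_nhds_metric dist_commute)
  show ?thesis
  proof (rule strictly_differentiableI[OF f'(1)])
    fix e :: real assume "0 < e"
    from f'(2)[OF this] obtain d where "0 < d"
      "\<forall>x\<in>ball a d. \<forall>y\<in>ball a d. norm (f x - f y - f' (x - y)) \<le> e * norm (x - y)" by blast
    then show "\<exists>d>0. \<forall>x\<in>ball a d. \<forall>y\<in>ball a d. norm (g x - g y - f' (x - y)) \<le> e * norm (x - y)"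
      using d0 by (intro exI[of _ "min d d0"]) (auto simp flip: d0(2))
  qed
qed

text \<open>
  The constant is half the minimum \<open>2 c\<close> of the quadratic form on the unit sphere; the other half
  absorbs the error of linearization.
\<close>

lemma positive_definite_strong_monotonicity:
  fixes g :: "'a::euclidean_space \<Rightarrow> 'a"
  assumes sd: "strictly_differentiable g a" and L: "(g has_derivative L) (at a)"
    and pd: "positive_definite L"
  obtains d c where "0 < d" and "0 < c"
    and "\<And>x y. \<lbrakk>x \<in> ball a d; y \<in> ball a d\<rbrakk> \<Longrightarrow> c * (norm (x - y))\<^sup>2 \<le> (g x - g y) \<bullet> (x - y)"
proof -
  obtain g' where g': "(g has_derivative g') (at a)"
    "\<And>e. 0 < e \<Longrightarrow> \<exists>d>0. \<forall>x\<in>ball a d. \<forall>y\<in>ball a d. norm (g x - g y - g' (x - y)) \<le> e * norm (x - y)"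
    using strictly_differentiable_derivative[OF sd] by metis
  have "g' = L" by (rule has_derivative_unique[OF g'(1) L])
  have bl: "bounded_linear L" using L by (rule has_derivative_bounded_linear)
  have "sphere (0::'a) 1 \<noteq> {}" by simp
  moreover have "continuous_on (sphere 0 1) (\<lambda>h. h \<bullet> L h)"
    by (intro continuous_intros linear_continuous_on[OF bl])
  ultimately obtain u where u: "u \<in> sphere 0 1" "\<And>h. h \<in> sphere 0 1 \<Longrightarrow> u \<bullet> L u \<le> h \<bullet> L h"
    using continuous_attains_inf[OF compact_sphere] by blast
  define c where "c = (u \<bullet> L u) / 2"
  have "u \<noteq> 0" using u(1) by auto
  then have c: "0 < c" using pd unfolding c_def positive_definite_def by simp
  have coercive: "2 * c * (norm h)\<^sup>2 \<le> h \<bullet> L h" for h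
  proof (cases "h = 0")
    case False
    have "2 * c \<le> (h /\<^sub>R norm h) \<bullet> L (h /\<^sub>R norm h)"
      using u(2)[of "h /\<^sub>R norm h"] False by (simp add: c_def)
    also have "\<dots> = (h \<bullet> L h) / (norm h)\<^sup>2"
      by (simp add: linear_scale[OF bounded_linear.linear[OF bl]] power2_eq_square divide_inverse)
    finally show ?thesis using False by (simp add: field_simps)
  qed simp
  obtain d where d: "0 < d"
    "\<And>x y. \<lbrakk>x \<in> ball a d; y \<in> ball a d\<rbrakk> \<Longrightarrow> norm (g x - g y - L (x - y)) \<le> c * norm (x - y)"
    using g'(2)[OF c] \<open>g' = L\<close> by blast
  show thesis
  proof (rule that[OF d(1) c])
    fix x y assume xy: "x \<in> ball a d" "y \<in> ball a d"
    have "- ((g x - g y - L (x - y)) \<bullet> (x - y)) \<le> norm (g x - g y - L (x - y)) * norm (x - y)"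
      using Cauchy_Schwarz_ineq2[of "g x - g y - L (x - y)" "x - y"] by linarith
    also have "\<dots> \<le> c * norm (x - y) * norm (x - y)"
      by (rule mult_right_mono[OF d(2)[OF xy]]) simp
    finally have "(x - y) \<bullet> L (x - y) - c * (norm (x - y))\<^sup>2 \<le> (g x - g y) \<bullet> (x - y)"
      by (simp add: inner_diff_left[of "g x - g y"] inner_commute[of "L (x - y)"] power2_eq_square)
    then show "c * (norm (x - y))\<^sup>2 \<le> (g x - g y) \<bullet> (x - y)"
      using coercive[of "x - y"] by linarith
  qed
qed

section \<open>Functions with strictly differentiable gradient\<close>

lemma GDERIV_unique:
  assumes "GDERIV f x :> D" "GDERIV f x :> D'" shows "D = D'"
proof -
  have "(\<lambda>h. h \<bullet> D) = (\<lambda>h. h \<bullet> D')"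
    using assms unfolding gderiv_def by (rule has_derivative_unique)
  then have "(D - D') \<bullet> (D - D') = 0" by (metis inner_diff_right cancel_comm_monoid_add_class.diff_cancel)
  then show ?thesis by simp
qed

lemma grad_eq: "GDERIV f x :> D \<Longrightarrow> grad f x = D"
  unfolding grad_def by (rule the_equality) (auto dest: GDERIV_unique)

lemma GDERIV_directional:
  assumes "GDERIV f x :> D"
  shows "((\<lambda>s. f (x + s *\<^sub>R h)) has_real_derivative D \<bullet> h) (at 0)"
proof -
  have "((\<lambda>s::real. x + s *\<^sub>R h) has_derivative (\<lambda>s. s *\<^sub>R h)) (at 0)"
    by (auto intro!: derivative_eq_intros)
  from has_derivative_compose[OF this, of f "\<lambda>h. h \<bullet> D"]
  have "((\<lambda>s. f (x + s *\<^sub>R h)) has_derivative (\<lambda>s. (s *\<^sub>R h) \<bullet> D)) (at 0)"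
    using assms by (simp add: gderiv_def)
  then show ?thesis
    unfolding has_field_derivative_def by (rule has_derivative_eq_rhs) (auto simp: inner_commute)
qed

text \<open>
  A pointwise substitute for being twice continuously differentiable near \<open>a\<close>.
\<close>

definition strictly_C2 :: "('a::euclidean_space \<Rightarrow> real) \<Rightarrow> 'a \<Rightarrow> bool" where
  "strictly_C2 f a \<longleftrightarrow>
     (\<exists>g. (\<forall>\<^sub>F x in nhds a. GDERIV f x :> g x) \<and> strictly_differentiable g a)"

lemma strictly_C2I:
  "\<lbrakk>\<forall>\<^sub>F x in nhds a. GDERIV f x :> g x; strictly_differentiable g a\<rbrakk> \<Longrightarrow> strictly_C2 f a"
  unfolding strictly_C2_def by blast

lemma strictly_C2_grad:
  assumes "strictly_C2 f a"
  shows "\<forall>\<^sub>F x in nhds a. GDERIV f x :> grad f x" and "strictly_differentiable (grad f) a"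
    and "GDERIV f a :> grad f a"
proof -
  obtain g where g: "\<forall>\<^sub>F x in nhds a. GDERIV f x :> g x" "strictly_differentiable g a"
    using assms unfolding strictly_C2_def by blast
  show 1: "\<forall>\<^sub>F x in nhds a. GDERIV f x :> grad f x"
    using g(1) by (rule eventually_mono) (simp add: grad_eq)
  have "\<forall>\<^sub>F x in nhds a. g x = grad f x"
    using g(1) by (rule eventually_mono) (simp add: grad_eq)
  with g(2) show "strictly_differentiable (grad f) a" by (rule strictly_differentiable_cong)
  show "GDERIV f a :> grad f a" using eventually_nhds_x_imp_x[OF 1] .
qed

lemma strictly_C2_hessian:
  assumes "strictly_C2 f a"
  shows "(grad f has_derivative hessian f a) (at a)"
proof -
  obtain f' where "(grad f has_derivative f') (at a)"
    using strictly_differentiable_derivative[OF strictly_C2_grad(2)[OF assms]] by metis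
  then show ?thesis unfolding hessian_def using frechet_derivative_at by metis
qed

text \<open>
  The gradient is continuous at \<open>a\<close>, so the function is continuously differentiable in the sense
  of \<open>strictly_differentiable_C1\<close>. This is what makes products of such functions have strictly
  differentiable gradients.
\<close>

lemma strictly_C2_imp_strictly_differentiable:
  assumes "strictly_C2 f a" shows "strictly_differentiable f a"
proof (rule strictly_differentiable_C1[where f' = "\<lambda>x h. h \<bullet> grad f x"])
  show "\<forall>\<^sub>F x in nhds a. (f has_derivative (\<lambda>h. h \<bullet> grad f x)) (at x)"
    using strictly_C2_grad(1)[OF assms] by (simp add: gderiv_def)
  fix e :: real assume "0 < e"
  then have "\<forall>\<^sub>F x in nhds a. dist (grad f x) (grad f a) < e"
    using strictly_differentiable_isCont[OF strictly_C2_grad(2)[OF assms]]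
    by (auto simp: isCont_def tendsto_at_iff_tendsto_nhds dest: tendstoD)
  then show "\<forall>\<^sub>F x in nhds a. \<forall>h. norm (h \<bullet> grad f x - h \<bullet> grad f a) \<le> e * norm h"
  proof (rule eventually_mono, intro allI)
    fix x h assume d: "dist (grad f x) (grad f a) < e"
    have "\<bar>h \<bullet> (grad f x - grad f a)\<bar> \<le> norm h * norm (grad f x - grad f a)"
      by (rule Cauchy_Schwarz_ineq2)
    also have "\<dots> \<le> norm h * e" using d by (intro mult_left_mono) (auto simp: dist_norm)
    finally show "norm (h \<bullet> grad f x - h \<bullet> grad f a) \<le> e * norm h"
      by (simp add: inner_diff_right mult.commute)
  qed
qed

lemma GDERIV_linear:
  fixes f :: "'a::euclidean_space \<Rightarrow> real"
  assumes "bounded_linear f" shows "GDERIV f x :> adjoint f 1"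
proof -
  have "(\<lambda>h. h \<bullet> adjoint f 1) = f"
    using adjoint_works[OF bounded_linear.linear[OF assms], of _ 1] by (simp add: fun_eq_iff)
  then show ?thesis
    unfolding gderiv_def using bounded_linear_imp_has_derivative[OF assms] by simp
qed

lemma strictly_C2_linear: "bounded_linear f \<Longrightarrow> strictly_C2 f a"
  by (rule strictly_C2I[where g = "\<lambda>_. adjoint f 1"])
    (auto intro!: always_eventually GDERIV_linear strictly_differentiable_const)

lemma strictly_C2_const: "strictly_C2 (\<lambda>_. k) a"
  by (rule strictly_C2I[where g = "\<lambda>_. 0"])
    (auto intro!: always_eventually GDERIV_const strictly_differentiable_const)

lemma strictly_C2_add:
  assumes "strictly_C2 f a" "strictly_C2 g a" shows "strictly_C2 (\<lambda>x. f x + g x) a"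
proof (rule strictly_C2I)
  show "\<forall>\<^sub>F x in nhds a. GDERIV (\<lambda>x. f x + g x) x :> grad f x + grad g x"
    using eventually_conj[OF strictly_C2_grad(1)[OF assms(1)] strictly_C2_grad(1)[OF assms(2)]]
    by (rule eventually_mono) (blast intro: GDERIV_add)
  show "strictly_differentiable (\<lambda>x. grad f x + grad g x) a"
    by (rule strictly_differentiable_add[OF strictly_C2_grad(2)[OF assms(1)] strictly_C2_grad(2)[OF assms(2)]])
qed

lemma strictly_C2_mult:
  assumes "strictly_C2 f a" "strictly_C2 g a" shows "strictly_C2 (\<lambda>x. f x * g x) a"
proof (rule strictly_C2I)
  note sd = strictly_C2_imp_strictly_differentiable[OF assms(1)] strictly_C2_imp_strictly_differentiable[OF assms(2)]
    strictly_C2_grad(2)[OF assms(1)] strictly_C2_grad(2)[OF assms(2)]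
  show "\<forall>\<^sub>F x in nhds a. GDERIV (\<lambda>x. f x * g x) x :> f x *\<^sub>R grad g x + g x *\<^sub>R grad f x"
    using eventually_conj[OF strictly_C2_grad(1)[OF assms(1)] strictly_C2_grad(1)[OF assms(2)]]
    by (rule eventually_mono) (blast intro: GDERIV_mult)
  show "strictly_differentiable (\<lambda>x. f x *\<^sub>R grad g x + g x *\<^sub>R grad f x) a"
    by (intro strictly_differentiable_add strictly_differentiable_scaleR sd)
qed

lemma strictly_C2_diff:
  assumes "strictly_C2 f a" "strictly_C2 g a" shows "strictly_C2 (\<lambda>x. f x - g x) a"
  using strictly_C2_add[OF assms(1) strictly_C2_mult[OF strictly_C2_const[of "-1"] assms(2)]] by simp

lemma strictly_C2_power2:
  "strictly_C2 f a \<Longrightarrow> strictly_C2 (\<lambda>x. (f x)\<^sup>2) a"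
  unfolding power2_eq_square by (rule strictly_C2_mult)

lemma strictly_C2_divide_const:
  "strictly_C2 f a \<Longrightarrow> strictly_C2 (\<lambda>x. f x / k) a"
  using strictly_C2_mult[OF strictly_C2_const[of "1 / k"], of f a] by simp

lemma strictly_C2_sum:
  "(\<And>i. i \<in> I \<Longrightarrow> strictly_C2 (f i) a) \<Longrightarrow> strictly_C2 (\<lambda>x. \<Sum>i\<in>I. f i x) a"
  by (induction I rule: infinite_finite_induct) (auto intro: strictly_C2_const strictly_C2_add)

lemma strictly_C2_compose_real:
  assumes f: "strictly_C2 f a"
    and \<psi>: "\<forall>\<^sub>F u in nhds (f a). (\<psi> has_real_derivative \<psi>' u) (at u)"
    and \<psi>': "strictly_differentiable \<psi>' (f a)"
  shows "strictly_C2 (\<lambda>x. \<psi> (f x)) a"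
proof (rule strictly_C2I[where g = "\<lambda>x. \<psi>' (f x) *\<^sub>R grad f x"])
  have sd: "strictly_differentiable f a" by (rule strictly_C2_imp_strictly_differentiable[OF f])
  have "filterlim f (nhds (f a)) (nhds a)"
    using strictly_differentiable_isCont[OF sd] by (simp add: isCont_def tendsto_at_iff_tendsto_nhds)
  from eventually_conj[OF strictly_C2_grad(1)[OF f] eventually_compose_filterlim[OF \<psi> this]]
  show "\<forall>\<^sub>F x in nhds a. GDERIV (\<lambda>x. \<psi> (f x)) x :> \<psi>' (f x) *\<^sub>R grad f x"
    by (rule eventually_mono) (auto intro: GDERIV_DERIV_compose)
  show "strictly_differentiable (\<lambda>x. \<psi>' (f x) *\<^sub>R grad f x) a"
    by (rule strictly_differentiable_scaleR[OF strictly_differentiable_compose[OF sd \<psi>'] strictly_C2_grad(2)[OF f]])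
qed

lemma strictly_C2_cos: "strictly_C2 f a \<Longrightarrow> strictly_C2 (\<lambda>x. cos (f x)) a"
proof (erule strictly_C2_compose_real[where \<psi>' = "\<lambda>u. - sin u"])
  show "strictly_differentiable (\<lambda>u::real. - sin u) (f a)"
    by (rule strictly_differentiable_real_C1[where f' = "\<lambda>u. - cos u"])
      (auto intro!: always_eventually derivative_eq_intros)
qed (auto intro!: always_eventually derivative_eq_intros)

lemma strictly_C2_ln:
  assumes "strictly_C2 f a" "0 < f a" shows "strictly_C2 (\<lambda>x. ln (f x)) a"
proof (rule strictly_C2_compose_real[where \<psi>' = "\<lambda>u. 1 / u", OF assms(1)])
  have pos: "\<forall>\<^sub>F u in nhds (f a). 0 < u"
    using assms(2) eventually_nhds_in_open[of "{0<..}" "f a"] by simp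
  show "\<forall>\<^sub>F u in nhds (f a). (ln has_real_derivative 1 / u) (at u)"
    using pos by (rule eventually_mono) (auto intro!: derivative_eq_intros)
  show "strictly_differentiable (\<lambda>u. 1 / u) (f a)"
  proof (rule strictly_differentiable_real_C1[where f' = "\<lambda>u. - (1 / (u * u))"])
    show "\<forall>\<^sub>F u in nhds (f a). ((\<lambda>u. 1 / u) has_real_derivative - (1 / (u * u))) (at u)"
      using pos by (rule eventually_mono) (auto intro!: derivative_eq_intros)
    show "isCont (\<lambda>u. - (1 / (u * u))) (f a)"
      using assms(2) by (auto intro!: continuous_intros)
  qed
qed

lemma strictly_C2_inner:
  fixes A B :: "'a::euclidean_space \<Rightarrow> 'b::euclidean_space"
  assumes "bounded_linear A" "bounded_linear B" shows "strictly_C2 (\<lambda>x. A x \<bullet> B x) a"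
proof -
  have "strictly_C2 (\<lambda>x. \<Sum>b\<in>Basis. (A x \<bullet> b) * (B x \<bullet> b)) a"
    by (intro strictly_C2_sum strictly_C2_mult strictly_C2_linear
        bounded_linear_compose[OF bounded_linear_inner_left] assms)
  then show ?thesis by (simp add: euclidean_inner[symmetric])
qed

lemma GDERIV_compose_linear:
  fixes A :: "'a::euclidean_space \<Rightarrow> 'b::euclidean_space"
  assumes "bounded_linear A" and "GDERIV f (A x) :> D"
  shows "GDERIV (\<lambda>x. f (A x)) x :> adjoint A D"
proof -
  have "((\<lambda>x. f (A x)) has_derivative (\<lambda>h. A h \<bullet> D)) (at x)"
    using has_derivative_compose[OF bounded_linear_imp_has_derivative[OF assms(1)] assms(2)[unfolded gderiv_def]] .
  then show ?thesis
    unfolding gderiv_def by (simp add: adjoint_works[OF bounded_linear.linear[OF assms(1)]])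
qed

lemma strictly_C2_compose_linear:
  fixes A :: "'a::euclidean_space \<Rightarrow> 'b::euclidean_space"
  assumes A: "bounded_linear A" and f: "strictly_C2 f (A a)"
  shows "strictly_C2 (\<lambda>x. f (A x)) a"
proof (rule strictly_C2I[where g = "\<lambda>x. adjoint A (grad f (A x))"])
  have "filterlim A (nhds (A a)) (nhds a)"
    using linear_continuous_at[OF A] by (simp add: isCont_def tendsto_at_iff_tendsto_nhds)
  from eventually_compose_filterlim[OF strictly_C2_grad(1)[OF f] this]
  show "\<forall>\<^sub>F x in nhds a. GDERIV (\<lambda>x. f (A x)) x :> adjoint A (grad f (A x))"
    by (rule eventually_mono) (rule GDERIV_compose_linear[OF A])
  have "bounded_linear (adjoint A)"
    using adjoint_linear[OF bounded_linear.linear[OF A]] by (simp add: linear_linear)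
  then show "strictly_differentiable (\<lambda>x. adjoint A (grad f (A x))) a"
    by (rule strictly_differentiable_compose[OF strictly_differentiable_compose[OF
            strictly_differentiable_linear[OF A] strictly_C2_grad(2)[OF f]]
        strictly_differentiable_linear])
qed

lemma twice_continuously_differentiable_grad:
  assumes "twice_continuously_differentiable f"
  shows "GDERIV f x :> grad f x" and "strictly_differentiable (grad f) x"
proof -
  obtain g and H :: "'a \<Rightarrow> 'a \<Rightarrow>\<^sub>L 'a" where g: "\<And>x. GDERIV f x :> g x"
    and H: "\<And>x. (g has_derivative blinfun_apply (H x)) (at x)" "continuous_on UNIV H"
    using assms unfolding twice_continuously_differentiable_def by blast
  have eq: "grad f = g" using grad_eq[OF g] by auto
  show "GDERIV f x :> grad f x" using g eq by simp
  show "strictly_differentiable (grad f) x"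
    unfolding eq
  proof (rule strictly_differentiable_C1[where f' = "\<lambda>x. blinfun_apply (H x)"])
    fix e :: real assume "0 < e"
    then have "\<forall>\<^sub>F y in nhds x. dist (H y) (H x) < e"
      using H(2) by (auto simp: continuous_on_eq_continuous_at isCont_def tendsto_at_iff_tendsto_nhds dest: tendstoD)
    then show "\<forall>\<^sub>F y in nhds x. \<forall>h. norm (blinfun_apply (H y) h - blinfun_apply (H x) h) \<le> e * norm h"
    proof (rule eventually_mono, intro allI)
      fix y h assume d: "dist (H y) (H x) < e"
      have "norm (blinfun_apply (H y - H x) h) \<le> norm (H y - H x) * norm h" by (rule norm_blinfun)
      also have "\<dots> \<le> e * norm h" using d by (intro mult_right_mono) (auto simp: dist_norm)
      finally show "norm (blinfun_apply (H y) h - blinfun_apply (H x) h) \<le> e * norm h"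
        by (simp add: blinfun.diff_left)
    qed
  qed (use H in simp)
qed

text \<open>
  A strictly convex function lies strictly above its tangents: the tangent inequality at the
  midpoint \<open>m\<close> follows from difference quotients, and strict convexity at \<open>m\<close> makes it strict at
  the endpoint.
\<close>

lemma strictly_convex_grad_strictly_monotone:
  assumes conv: "strictly_convex f" and grad: "\<And>x. GDERIV f x :> g x" and "x \<noteq> y"
  shows "0 < (g x - g y) \<bullet> (x - y)"
proof -
  have tangent: "f u + g u \<bullet> (v - u) < f v" if "u \<noteq> v" for u v
  proof -
    define m where "m = (1 - 1/2) *\<^sub>R u + (1/2::real) *\<^sub>R v"
    have m: "m - u = (1/2) *\<^sub>R (v - u)"
    proof -
      have "m - ((1 - 1/2) *\<^sub>R u + (1/2) *\<^sub>R u) = (1/2) *\<^sub>R (v - u)"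
        unfolding m_def by (simp only: add_diff_add diff_self add_0 scaleR_diff_right)
      then show ?thesis by (simp only: scaleR_collapse)
    qed
    then have "m \<noteq> u" using that by auto
    have fm: "f m < (1 - 1/2) * f u + 1/2 * f v"
      unfolding m_def by (rule conv[unfolded strictly_convex_def, rule_format]) (use that in simp)
    have d: "((\<lambda>s. f (u + s *\<^sub>R (m - u))) has_real_derivative g u \<bullet> (m - u)) (at 0 within {0<..})"
      using GDERIV_directional[OF grad[of u], of "m - u"] by (rule has_field_derivative_at_within)
    have "g u \<bullet> (m - u) \<le> f m - f u"
    proof (rule tendsto_upperbound[OF d[unfolded has_field_derivative_iff]])
      show "\<forall>\<^sub>F s in at 0 within {0<..}. (f (u + s *\<^sub>R (m - u)) - f (u + 0 *\<^sub>R (m - u))) / (s - 0) \<le> f m - f u"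
        unfolding eventually_at
      proof (intro exI[of _ 1] conjI ballI impI)
        fix s :: real assume s: "s \<in> {0<..}" "s \<noteq> 0 \<and> dist s 0 < 1"
        have "f ((1 - s) *\<^sub>R u + s *\<^sub>R m) < (1 - s) * f u + s * f m"
          by (rule conv[unfolded strictly_convex_def, rule_format]) (use \<open>m \<noteq> u\<close> s in \<open>auto simp: dist_real_def\<close>)
        moreover have "(1 - s) *\<^sub>R u + s *\<^sub>R m = u + s *\<^sub>R (m - u)" by (simp add: algebra_simps)
        ultimately have "f (u + s *\<^sub>R (m - u)) - f u \<le> (f m - f u) * s"
          by (simp add: algebra_simps)
        then show "(f (u + s *\<^sub>R (m - u)) - f (u + 0 *\<^sub>R (m - u))) / (s - 0) \<le> f m - f u"
          using s by (simp add: pos_divide_le_eq)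
      qed simp
    qed simp
    then show ?thesis using fm m by simp
  qed
  from tangent[OF assms(3)] tangent[of y x] assms(3) show ?thesis
    by (simp add: inner_diff_left inner_diff_right)
qed

section \<open>A criterion for local asymptotic stability\<close>

text \<open>
  The Lyapunov criterion in a form that speaks only of the vector field. The hypothesis of
  detectability quantifies over all sets \<open>\<Lambda>\<close> that share the known properties of a limit set:
  consistency, no dissipation, and stationarity of those linear observables that are constant on
  \<open>\<Lambda>\<close>. It has to force \<open>grad V\<close> to vanish; near \<open>xb\<close> that singles out \<open>xb\<close> by monotonicity.
\<close>

theorem locally_asymptotically_stable_by_shifted_energy:
  fixes P F :: "'x::euclidean_space \<Rightarrow> 'x" and V :: "'x \<Rightarrow> real"
  assumes P: "linear P" "\<And>x. P (P x) = P x" "\<And>x y. P x \<bullet> y = x \<bullet> P y"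
    and \<Omega>: "open \<Omega>" "xb \<in> \<Omega>"
    and V: "strictly_C2 V xb" "grad V xb = 0" "positive_definite (hessian V xb)"
    and F: "strictly_differentiable (\<lambda>x. P (F x)) xb" "F xb = 0"
    and constraint: "\<And>x. x \<in> \<Omega> \<Longrightarrow> F x \<in> range P \<longleftrightarrow> P (grad V x) = grad V x"
    and dissipation: "\<And>x. \<lbrakk>x \<in> \<Omega>; P (grad V x) = grad V x\<rbrakk> \<Longrightarrow> grad V x \<bullet> F x \<le> 0"
    and detectable: "\<And>\<Lambda>. \<lbrakk>\<And>z. z \<in> \<Lambda> \<Longrightarrow> z \<in> \<Omega> \<and> P (grad V z) = grad V z \<and> grad V z \<bullet> F z = 0;
        \<And>A a. \<lbrakk>linear A; \<And>z. A (P z) = A z; \<And>z. z \<in> \<Lambda> \<Longrightarrow> A z = a\<rbrakk> \<Longrightarrow> \<forall>z\<in>\<Lambda>. A (F z) = (0::'x)\<rbrakk>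
      \<Longrightarrow> \<forall>z\<in>\<Lambda>. grad V z = 0"
  shows "locally_asymptotically_stable_equilibrium P F \<Omega> xb"
proof -
  obtain d1 c where d1: "0 < d1" "0 < c" "\<And>x y. \<lbrakk>x \<in> ball xb d1; y \<in> ball xb d1\<rbrakk>
      \<Longrightarrow> c * (norm (x - y))\<^sup>2 \<le> (grad V x - grad V y) \<bullet> (x - y)"
    using positive_definite_strong_monotonicity[OF strictly_C2_grad(2)[OF V(1)] strictly_C2_hessian[OF V(1)] V(3)]
    by metis
  obtain d2 K where d2: "0 < d2" "0 < K" "\<And>x y. \<lbrakk>x \<in> ball xb d2; y \<in> ball xb d2\<rbrakk>
      \<Longrightarrow> norm (grad V x - grad V y) \<le> K * norm (x - y)"
    using strictly_differentiable_lipschitz[OF strictly_C2_grad(2)[OF V(1)]] by metis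
  obtain d3 K' where d3: "0 < d3" "0 < K'" "\<And>x y. \<lbrakk>x \<in> ball xb d3; y \<in> ball xb d3\<rbrakk>
      \<Longrightarrow> norm (P (F x) - P (F y)) \<le> K' * norm (x - y)"
    using strictly_differentiable_lipschitz[OF F(1)] by metis
  obtain d4 where d4: "0 < d4" "\<And>x. x \<in> ball xb d4 \<Longrightarrow> GDERIV V x :> grad V x"
    using strictly_C2_grad(1)[OF V(1)] by (auto simp: eventually_nhds_metric dist_commute)
  obtain d5 where d5: "0 < d5" "ball xb d5 \<subseteq> \<Omega>"
    using \<Omega> open_contains_ball by blast
  define r where "r = Min {d1, d2, d3, d4, d5} / 2"
  have r: "0 < r" "r < d1" "r < d2" "r < d3" "r < d4" "r < d5"
    using d1(1) d2(1) d3(1) d4(1) d5(1) by (auto simp: r_def min_def)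
  have sub: "cball xb r \<subseteq> \<Omega>" using d5(2) r by auto
  interpret gradient_dae P F "grad V" \<Omega> V xb r c "max K K'"
  proof (rule gradient_dae.intro)
    fix x y assume xy: "x \<in> cball xb r" "y \<in> cball xb r"
    show "c * (norm (x - y))\<^sup>2 \<le> (grad V x - grad V y) \<bullet> (x - y)"
      by (rule d1(3)) (use xy r in auto)
    have "norm (grad V x - grad V y) \<le> K * norm (x - y)"
      by (rule d2(3)) (use xy r in auto)
    also have "\<dots> \<le> max K K' * norm (x - y)" by (intro mult_right_mono) auto
    finally show "norm (grad V x - grad V y) \<le> max K K' * norm (x - y)" .
    have "norm (P (F x) - P (F y)) \<le> K' * norm (x - y)"
      by (rule d3(3)) (use xy r in auto)
    also have "\<dots> \<le> max K K' * norm (x - y)" by (intro mult_right_mono) auto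
    finally show "norm (P (F x) - P (F y)) \<le> max K K' * norm (x - y)" .
  next
    fix x assume x: "x \<in> cball xb r"
    show "GDERIV V x :> grad V x" by (rule d4(2)) (use x r in auto)
    show "P (grad V x) = grad V x \<Longrightarrow> grad V x \<bullet> F x \<le> 0"
      using dissipation x sub by blast
  qed (use P V(2) r(1) d1(2) sub constraint in auto)
  have "limit_points x \<subseteq> {xb}" if sol: "dae_solution P F \<Omega> {0..} x" and M: "\<And>t. 0 \<le> t \<Longrightarrow> x t \<in> M" for x
  proof -
    have L: "limit_points x \<subseteq> M"
      by (rule limit_points_subset[OF closed_M M])
    have "\<forall>z\<in>limit_points x. grad V z = 0"
    proof (rule detectable)
      fix z assume z: "z \<in> limit_points x"
      show "z \<in> \<Omega> \<and> P (grad V z) = grad V z \<and> grad V z \<bullet> F z = 0"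
      proof -
        have "z \<in> M" using z L by blast
        then have "z \<in> \<Omega>" "P (grad V z) = grad V z" using sub by (auto simp: M_def subset_eq)
        then show ?thesis using limit_points_no_dissipation[OF sol M z] by blast
      qed
    next
      fix A :: "'x \<Rightarrow> 'x" and a
      assume A: "linear A" "\<And>z. A (P z) = A z" "\<And>z. z \<in> limit_points x \<Longrightarrow> A z = a"
      have bl: "bounded_linear A" using A(1) by (simp add: linear_linear)
      show "\<forall>z\<in>limit_points x. A (F z) = 0"
        using limit_points_stationary[OF sol M bl A(2,3)] by blast
    qed
    moreover have "z = xb" if "z \<in> M" "grad V z = 0" for z
      using g_mono[of z xb] that V(2) r(1) c_pos by (auto simp: M_def mult_le_0_iff)
    ultimately show ?thesis using L by blast
  qed
  then have "dae_attractive P F \<Omega> xb" by (rule attractive)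
  then show ?thesis
    using stable \<Omega>(2) F(2)
    by (simp add: locally_asymptotically_stable_equilibrium_def dae_equilibrium_def)
qed

section \<open>Linear algebra of the network\<close>

lemma inner_transpose_mult:
  fixes A :: "real^'n^'m" shows "x \<bullet> (transpose A *v y) = (A *v x) \<bullet> y"
  by (simp add: dot_lmul_matrix[symmetric] inner_commute)

lemma positive_definite_matrix_inv:
  fixes A :: "real^'n^'n"
  assumes "sym_pos_def_matrix A"
  shows "A *v (matrix_inv A *v x) = x"
    and "(matrix_inv A *v x) \<bullet> y = x \<bullet> (matrix_inv A *v y)"
proof -
  have "x = 0" if "A *v x = 0" for x
    using assms that unfolding sym_pos_def_matrix_def positive_definite_def by fastforce
  then obtain B where "B ** A = mat 1"
    using matrix_left_invertible_ker by blast
  then have "\<exists>B. A ** B = mat 1 \<and> B ** A = mat 1" using matrix_left_right_inverse by blast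
  then have inv: "A ** matrix_inv A = mat 1" "matrix_inv A ** A = mat 1"
    unfolding matrix_inv_def by (metis (mono_tags, lifting) someI_ex)+
  show 1: "A *v (matrix_inv A *v x) = x" for x
    by (simp add: matrix_vector_mul_assoc inv)
  have sym: "(A *v u) \<bullet> v = u \<bullet> (A *v v)" for u v
    using inner_transpose_mult[of u A v] assms unfolding sym_pos_def_matrix_def by metis
  show "(matrix_inv A *v x) \<bullet> y = x \<bullet> (matrix_inv A *v y)"
    using sym[of "matrix_inv A *v x" "matrix_inv A *v y"] by (simp add: 1)
qed

lemma diag_mat_mult: "diag_mat v *v x = (\<chi> i. v $ i * x $ i)"
  by (simp add: diag_mat_def matrix_vector_mult_def vec_eq_iff if_distrib[of "\<lambda>a. a * _"] cong: if_cong)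

lemma diag_mat_positive_definite:
  assumes "\<And>i. 0 < v $ i" shows "sym_pos_def_matrix (diag_mat v)"
proof -
  have "0 < h \<bullet> (diag_mat v *v h)" if "h \<noteq> 0" for h
  proof -
    obtain j where j: "h $ j \<noteq> 0" using \<open>h \<noteq> 0\<close> by (auto simp: vec_eq_iff)
    have "h \<bullet> (diag_mat v *v h) = (\<Sum>i\<in>UNIV. v $ i * (h $ i)\<^sup>2)"
      by (simp add: inner_vec_def diag_mat_mult power2_eq_square mult_ac)
    also have "\<dots> > 0"
      using j assms by (intro sum_pos2[of _ j]) (auto simp: less_imp_le)
    finally show ?thesis .
  qed
  moreover have "transpose (diag_mat v) = diag_mat v"
    by (simp add: diag_mat_def transpose_def vec_eq_iff)
  ultimately show ?thesis by (simp add: sym_pos_def_matrix_def positive_definite_def)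
qed

lemma sym_pos_def_matrix_nonneg:
  assumes "sym_pos_def_matrix A"
  shows "0 \<le> x \<bullet> (A *v x)" and "x \<bullet> (A *v x) = 0 \<Longrightarrow> x = 0"
  using assms unfolding sym_pos_def_matrix_def positive_definite_def
  by (cases "x = 0"; fastforce)+

lemma matrix_inv_positive_definite:
  assumes "sym_pos_def_matrix A" shows "0 \<le> x \<bullet> (matrix_inv A *v x)" and "x \<bullet> (matrix_inv A *v x) = 0 \<Longrightarrow> x = 0"
proof -
  have eq: "x \<bullet> (matrix_inv A *v x) = (matrix_inv A *v x) \<bullet> (A *v (matrix_inv A *v x))"
    by (simp add: positive_definite_matrix_inv[OF assms] inner_commute)
  show "0 \<le> x \<bullet> (matrix_inv A *v x)" unfolding eq by (rule sym_pos_def_matrix_nonneg[OF assms])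
  assume "x \<bullet> (matrix_inv A *v x) = 0"
  then have "matrix_inv A *v x = 0" using eq sym_pos_def_matrix_nonneg(2)[OF assms] by metis
  then show "x = 0" using positive_definite_matrix_inv(1)[OF assms, of x] by simp
qed

lemma stacked_mult_eq_0:
  fixes A :: "real^'k^('g::finite + 'l::finite)"
  assumes "gen_part A *v x = 0" "load_part A *v x = 0" shows "A *v x = 0"
proof -
  have "(A *v x) $ i = 0" for i
  proof (cases i)
    case (Inl a)
    then show ?thesis using assms(1)
      by (simp add: gen_part_def matrix_vector_mult_def vec_eq_iff)
  next
    case (Inr a)
    then show ?thesis using assms(2)
      by (simp add: load_part_def matrix_vector_mult_def vec_eq_iff)
  qed
  then show ?thesis by (simp add: vec_eq_iff)
qed

text \<open>
  Potentials with equal values at the ends of every edge are constant on a connected graph.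
\<close>

lemma incidence_transpose_kernel:
  fixes D :: "real^'m^'v::finite"
  assumes "connected_graph E" "incidence_matrix E D" "transpose D *v \<delta> = 0"
  shows "\<delta> $ i = \<delta> $ j"
proof -
  obtain e where e: "bij_betw e UNIV E"
    "D = (\<chi> i k. if i = fst (e k) then 1 else if i = snd (e k) then - 1 else 0)"
    using assms(2) unfolding incidence_matrix_def by blast
  have edge: "\<delta> $ a = \<delta> $ b" if ab: "(a, b) \<in> E" for a b
  proof (cases "a = b")
    case False
    obtain k where k: "e k = (a, b)" using ab e(1) unfolding bij_betw_def by force
    have "0 = (transpose D *v \<delta>) $ k" using assms(3) by simp
    also have "\<dots> = (\<Sum>i\<in>UNIV. (if i = a then 1 else if i = b then - 1 else 0) * \<delta> $ i)"
      by (simp add: matrix_vector_mult_def transpose_def e(2) k cong: if_cong)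
    also have "\<dots> = (\<Sum>i\<in>UNIV. (if i = a then \<delta> $ i else 0) - (if i = b then \<delta> $ i else 0))"
      by (rule sum.cong) (use False in auto)
    also have "\<dots> = \<delta> $ a - \<delta> $ b" by (simp add: sum_subtractf)
    finally show ?thesis by simp
  qed simp
  have "(i, j) \<in> (adjacency E)\<^sup>*" using assms(1) by (simp add: connected_graph_def)
  then show ?thesis
    by (induction rule: rtrancl_induct) (auto simp: adjacency_def dest: edge)
qed

text \<open>
  By connectedness the orthogonal complement of the range of \<open>D\<close> is spanned by the constant vector,
  so \<open>D\<close> has rank \<open>n - 1\<close>, which is the number of its columns.
\<close>

lemma tree_incidence_injective:
  fixes D :: "real^'m^'v::finite"
  assumes "connected_graph E" "incidence_matrix E D" "CARD('m) + 1 = CARD('v)"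
    and "D *v c = 0"
  shows "c = 0"
proof -
  have "{y. \<forall>x\<in>range ((*v) D). orthogonal x y} \<subseteq> span {vec 1}"
  proof
    fix y :: "real^'v" assume y: "y \<in> {y. \<forall>x\<in>range ((*v) D). orthogonal x y}"
    have "transpose D *v y = 0"
      using y inner_transpose_mult[of "transpose D *v y" D y] by (auto simp: orthogonal_def)
    from incidence_transpose_kernel[OF assms(1,2) this]
    have "y = (y $ i) *\<^sub>R vec 1" for i by (simp add: vec_eq_iff)
    then show "y \<in> span {vec 1}" by (metis insertI1 span_base span_scale)
  qed
  then have "dim {y. \<forall>x\<in>range ((*v) D). orthogonal x y} \<le> dim (span {vec 1 :: real^'v})"
    by (rule dim_subset)
  also have "\<dots> \<le> 1"
    using dim_le_card[of "{vec 1 :: real^'v}" "{vec 1}"] by (simp add: span_base)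
  finally have le: "dim {y. \<forall>x\<in>range ((*v) D). orthogonal x y} \<le> 1" .
  have "dim {y \<in> UNIV. \<forall>x\<in>range ((*v) D). orthogonal x y} + dim (range ((*v) D)) = dim (UNIV :: (real^'v) set)"
    by (rule dim_subspace_orthogonal_to_vectors)
      (auto simp: linear_subspace_image)
  then have "CARD('m) \<le> rank D" using le assms(3) by (simp add: rank_dim_range)
  then have "rank D = CARD('m)" using rank_bound[of D] by simp
  then have "inj ((*v) D)" by (simp add: full_rank_injective)
  then show ?thesis using assms(4) by (metis injD matrix_vector_mult_0_right)
qed

section \<open>The Hamiltonian of the network\<close>

text \<open>
  Two choices of angles for the same \<open>\<phi>\<close> differ by a constant vector, so the choice in the definition
  of the angles cancels in differences.
\<close>

lemma angle_diff_linear: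
  fixes pm :: "('g::finite, 'l::finite, 'k::finite, 'm::finite) power_market"
  assumes "standing_assumptions pm"
  shows "linear (\<lambda>\<phi>. angle_diff pm \<phi> i j)"
proof -
  have rank: "rank (Dhat pm) = CARD('k)" and ker: "{\<delta>. transpose (Dhat pm) *v \<delta> = 0} = span {vec 1}"
    using assms by (simp_all add: standing_assumptions_def)
  have "surj ((*v) (transpose (Dhat pm)))"
    using rank by (metis full_rank_surjective rank_transpose)
  then have "\<exists>\<delta>. transpose (Dhat pm) *v \<delta> = \<phi>" for \<phi> by (metis surjD)
  then have ang: "transpose (Dhat pm) *v angles pm \<phi> = \<phi>" for \<phi>
    unfolding angles_def by (rule someI_ex)
  have const: "\<delta> $ i = \<delta> $ j" if "transpose (Dhat pm) *v \<delta> = 0" for \<delta>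
  proof -
    have "\<delta> \<in> span {vec 1}" using that ker by blast
    then obtain k where "\<delta> = k *\<^sub>R vec 1" by (auto simp: span_singleton)
    then show ?thesis by simp
  qed
  show ?thesis
  proof (rule linearI)
    fix \<phi> \<psi> :: "real^'k" and a :: real
    have "transpose (Dhat pm) *v (angles pm (\<phi> + \<psi>) - angles pm \<phi> - angles pm \<psi>) = 0"
      by (simp add: matrix_vector_mult_diff_distrib ang del: transpose_matrix_vector)
    from const[OF this]
    show "angle_diff pm (\<phi> + \<psi>) i j = angle_diff pm \<phi> i j + angle_diff pm \<psi> i j"
      by (simp add: angle_diff_def)
    have "transpose (Dhat pm) *v (angles pm (a *\<^sub>R \<phi>) - a *\<^sub>R angles pm \<phi>) = 0"
      by (simp add: matrix_vector_mult_diff_distrib matrix_vector_mult_scaleR ang del: transpose_matrix_vector)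
    from const[OF this]
    show "angle_diff pm (a *\<^sub>R \<phi>) i j = a *\<^sub>R angle_diff pm \<phi> i j"
      by (simp add: angle_diff_def right_diff_distrib)
  qed
qed

lemma voltages_simps [simp]:
  "voltages Eg El $ Inl a = Eg $ a" "voltages Eg El $ Inr b = El $ b"
  by (simp_all add: voltages_def)

text \<open>
  \<open>H\<^sub>p\<close> is a polynomial in linear coordinates and cosines of linear coordinates.
\<close>

lemma hamiltonian_p_strictly_C2:
  fixes pm :: "('g::finite, 'l::finite, 'k::finite, 'm::finite) power_market"
  assumes "standing_assumptions pm"
  shows "strictly_C2 (hamiltonian_p pm) xp"
proof -
  have p: "strictly_C2 (\<lambda>x::('g, 'l, 'k) phys_state. fst (snd x) $ i) xp" for i
    by (rule strictly_C2_linear) (simp add: linear_conv_bounded_linear[symmetric] linear_iff)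
  have Eg: "strictly_C2 (\<lambda>x::('g, 'l, 'k) phys_state. fst (snd (snd x)) $ i) xp" for i
    by (rule strictly_C2_linear) (simp add: linear_conv_bounded_linear[symmetric] linear_iff)
  have E: "strictly_C2 (\<lambda>x::('g, 'l, 'k) phys_state. voltages (fst (snd (snd x))) (snd (snd (snd x))) $ i) xp" for i
    by (rule strictly_C2_linear, cases i) (simp_all add: linear_conv_bounded_linear[symmetric] linear_iff)
  have ang: "strictly_C2 (\<lambda>x::('g, 'l, 'k) phys_state. angle_diff pm (fst x) i j) xp" for i j
    using bounded_linear_compose[OF linear_conv_bounded_linear[THEN iffD1, OF angle_diff_linear[OF assms]] bounded_linear_fst]
    by (rule strictly_C2_linear)
  have eq: "hamiltonian_p pm = (\<lambda>x. 
      1/2 * (\<Sum>i\<in>UNIV. (fst (snd x) $ i)\<^sup>2 / Mg pm $ i + (fst (snd (snd x)) $ i - Ef pm $ i)\<^sup>2 / (Xd pm $ i - Xd' pm $ i))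
       + 1/2 * (\<Sum>i\<in>UNIV. Bc pm i i * (voltages (fst (snd (snd x))) (snd (snd (snd x))) $ i)\<^sup>2)
       - (\<Sum>e\<in>edges pm. Bc pm (fst e) (snd e) * voltages (fst (snd (snd x))) (snd (snd (snd x))) $ fst e
           * voltages (fst (snd (snd x))) (snd (snd (snd x))) $ snd e * cos (angle_diff pm (fst x) (fst e) (snd e))))"
    by (auto simp: hamiltonian_p_def fun_eq_iff Let_def case_prod_beta)
  show ?thesis
    unfolding eq
    by (intro strictly_C2_diff strictly_C2_add strictly_C2_mult strictly_C2_const strictly_C2_sum
        strictly_C2_divide_const strictly_C2_power2 strictly_C2_cos p Eg E ang)
qed

lemma tau_c_inv_linear: "linear (tau_c_inv pm)"
  by (simp add: linear_iff tau_c_inv_def case_prod_beta matrix_vector_right_distrib matrix_vector_mult_scaleR)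

lemma hamiltonian_c_strictly_C2: "strictly_C2 (hamiltonian_c pm) xc"
proof -
  have lin: "bounded_linear (tau_c_inv pm)"
    using tau_c_inv_linear by (simp add: linear_conv_bounded_linear)
  show ?thesis
    using strictly_C2_mult[OF strictly_C2_const[of "1/2"] strictly_C2_inner[OF bounded_linear_ident lin]]
    by (simp add: hamiltonian_c_def[abs_def])
qed

lemma tau_c_inv_symmetric:
  assumes "standing_assumptions pm"
  shows "tau_c_inv pm x \<bullet> y = x \<bullet> tau_c_inv pm y"
  using assms
  by (simp add: tau_c_inv_def case_prod_beta inner_prod_def standing_assumptions_def
      positive_definite_matrix_inv(2))

lemma hamiltonian_c_grad:
  assumes "standing_assumptions pm"
  shows "grad (hamiltonian_c pm) xc = tau_c_inv pm xc"
proof (rule grad_eq)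
  have d: "(tau_c_inv pm has_derivative tau_c_inv pm) (at xc)"
    using tau_c_inv_linear[of pm] by (simp add: linear_linear bounded_linear_imp_has_derivative)
  have "((\<lambda>x. 1/2 * (x \<bullet> tau_c_inv pm x)) has_derivative
      (\<lambda>h. 1/2 * (xc \<bullet> tau_c_inv pm h + h \<bullet> tau_c_inv pm xc))) (at xc)"
    by (intro has_derivative_mult_right has_derivative_inner has_derivative_ident d)
  moreover have eq: "xc \<bullet> tau_c_inv pm h = h \<bullet> tau_c_inv pm xc" for h
    by (metis inner_commute tau_c_inv_symmetric[OF assms])
  ultimately show "GDERIV (hamiltonian_c pm) xc :> tau_c_inv pm xc"
    unfolding gderiv_def hamiltonian_c_def
    by (auto elim!: has_derivative_eq_rhs simp: eq)
qed

text \<open>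
  The component is read off from the derivative in the coordinate direction.
\<close>

lemma hamiltonian_p_grad_momentum:
  fixes pm :: "('g::finite, 'l::finite, 'k::finite, 'm::finite) power_market"
  assumes "standing_assumptions pm"
  shows "fst (snd (grad (hamiltonian_p pm) (\<phi>, p, Eg, El))) = (\<chi> i. p $ i / Mg pm $ i)"
proof -
  let ?x = "(\<phi>, p, Eg, El)"
  have Mg: "Mg pm $ i \<noteq> 0" for i
    using assms unfolding standing_assumptions_def by (metis less_irrefl)
  have "fst (snd (grad (hamiltonian_p pm) ?x)) $ i = p $ i / Mg pm $ i" for i
  proof -
    let ?h = "(0, axis i 1, 0, 0) :: ('g, 'l, 'k) phys_state"
    have "((\<lambda>s. hamiltonian_p pm (?x + s *\<^sub>R ?h)) has_real_derivative grad (hamiltonian_p pm) ?x \<bullet> ?h) (at 0)"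
      by (rule GDERIV_directional[OF strictly_C2_grad(3)[OF hamiltonian_p_strictly_C2[OF assms]]])
    moreover have "((\<lambda>s. hamiltonian_p pm (?x + s *\<^sub>R ?h)) has_real_derivative p $ i / Mg pm $ i) (at 0)"
    proof -
      have "((\<lambda>s. hamiltonian_p pm (?x + s *\<^sub>R ?h)) has_real_derivative
        1/2 * (\<Sum>j\<in>UNIV. 2 * p $ j * axis i 1 $ j / Mg pm $ j)) (at 0)"
        unfolding hamiltonian_p_def Let_def
        by (auto intro!: derivative_eq_intros sum.cong simp: Mg algebra_simps)
      moreover have "(\<Sum>j\<in>UNIV. 2 * p $ j * axis i 1 $ j / Mg pm $ j) = 2 * p $ i / Mg pm $ i"
        by (simp add: axis_def if_distrib[of "\<lambda>a. _ * a"] if_distrib[of "\<lambda>a. a / _"] cong: if_cong)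
      ultimately show ?thesis by simp
    qed
    ultimately have "grad (hamiltonian_p pm) ?x \<bullet> ?h = p $ i / Mg pm $ i"
      by (rule DERIV_unique)
    then show ?thesis by (simp add: inner_prod_def inner_axis)
  qed
  then show ?thesis by (simp add: vec_eq_iff)
qed

text \<open>
  Each edge is listed once in an arbitrary orientation, so the edges at \<open>n\<close> are those leaving and
  those entering \<open>n\<close>.
\<close>

lemma sum_neighbours:
  fixes E :: "('v::finite \<times> 'v) set" and f :: "'v \<Rightarrow> real"
  assumes "simple_graph E"
  shows "(\<Sum>(a, b)\<in>E. (if a = n then f b else 0) + (if b = n then f a else 0)) = (\<Sum>j\<in>neighbours E n. f j)"
proof -
  have out: "(\<Sum>(a, b)\<in>E. if a = n then f b else 0) = (\<Sum>j\<in>{j. (n, j) \<in> E}. f j)"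
  proof -
    have "(\<Sum>(a, b)\<in>E. if a = n then f b else 0) = (\<Sum>e\<in>E. if fst e = n then f (snd e) else 0)"
      by (simp add: case_prod_beta)
    also have "\<dots> = (\<Sum>e\<in>{e \<in> E. fst e = n}. f (snd e))"
      by (simp add: sum.inter_filter)
    also have "\<dots> = (\<Sum>j\<in>{j. (n, j) \<in> E}. f j)"
      by (rule sum.reindex_bij_witness[where i = "\<lambda>j. (n, j)" and j = snd]) auto
    finally show ?thesis .
  qed
  have inn: "(\<Sum>(a, b)\<in>E. if b = n then f a else 0) = (\<Sum>j\<in>{j. (j, n) \<in> E}. f j)"
  proof -
    have "(\<Sum>(a, b)\<in>E. if b = n then f a else 0) = (\<Sum>e\<in>E. if snd e = n then f (fst e) else 0)"
      by (simp add: case_prod_beta)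
    also have "\<dots> = (\<Sum>e\<in>{e \<in> E. snd e = n}. f (fst e))"
      by (simp add: sum.inter_filter)
    also have "\<dots> = (\<Sum>j\<in>{j. (j, n) \<in> E}. f j)"
      by (rule sum.reindex_bij_witness[where i = "\<lambda>j. (j, n)" and j = fst]) auto
    finally show ?thesis .
  qed
  have "neighbours E n = {j. (n, j) \<in> E} \<union> {j. (j, n) \<in> E}"
    by (auto simp: neighbours_def adjacency_def)
  moreover have "{j. (n, j) \<in> E} \<inter> {j. (j, n) \<in> E} = {}"
    using assms by (auto simp: simple_graph_def)
  ultimately have "(\<Sum>j\<in>neighbours E n. f j) = (\<Sum>j\<in>{j. (n, j) \<in> E}. f j) + (\<Sum>j\<in>{j. (j, n) \<in> E}. f j)"
    by (simp add: sum.union_disjoint)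
  then show ?thesis using out inn by (simp add: sum.distrib case_prod_beta)
qed

text \<open>
  The load component of the gradient is the reactive power up to the factor \<open>E\<^sub>i\<close>. It links the
  algebraic load equations to critical points of the shifted Hamiltonian.
\<close>

lemma hamiltonian_p_grad_load_voltage:
  fixes pm :: "('g::finite, 'l::finite, 'k::finite, 'm::finite) power_market"
  assumes sa: "standing_assumptions pm"
  shows "El $ i * snd (snd (snd (grad (hamiltonian_p pm) (\<phi>, p, Eg, El)))) $ i
    = reactive_power pm \<phi> (voltages Eg El) $ Inr i"
proof -
  let ?x = "(\<phi>, p, Eg, El)"
  let ?h = "(0, 0, 0, axis i 1) :: ('g, 'l, 'k) phys_state"
  define E where "E = voltages Eg El"
  define n :: "'g + 'l" where "n = Inr i"
  define u :: "'g + 'l \<Rightarrow> real" where "u j = (if j = n then 1 else 0)" for j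
  define th where "th a b = cos (angle_diff pm \<phi> a b)" for a b
  have v: "voltages Eg (El + s *\<^sub>R axis i 1) $ j = E $ j + s * u j" for s j
    by (cases j) (auto simp: E_def u_def n_def axis_def)
  have "((\<lambda>s. hamiltonian_p pm (?x + s *\<^sub>R ?h)) has_real_derivative grad (hamiltonian_p pm) ?x \<bullet> ?h) (at 0)"
    by (rule GDERIV_directional[OF strictly_C2_grad(3)[OF hamiltonian_p_strictly_C2[OF sa]]])
  moreover have "((\<lambda>s. hamiltonian_p pm (?x + s *\<^sub>R ?h)) has_real_derivative
      1/2 * (\<Sum>j\<in>UNIV. Bc pm j j * (2 * E $ j * u j))
      - (\<Sum>e\<in>edges pm. Bc pm (fst e) (snd e) * (u (fst e) * E $ snd e + E $ fst e * u (snd e)) * th (fst e) (snd e))) (at 0)"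
  proof -
    have eq: "hamiltonian_p pm (?x + s *\<^sub>R ?h) =
       1/2 * (\<Sum>i\<in>UNIV. (p $ i)\<^sup>2 / Mg pm $ i + (Eg $ i - Ef pm $ i)\<^sup>2 / (Xd pm $ i - Xd' pm $ i))
       + 1/2 * (\<Sum>j\<in>UNIV. Bc pm j j * (E $ j + s * u j)\<^sup>2)
       - (\<Sum>e\<in>edges pm. Bc pm (fst e) (snd e) * (E $ fst e + s * u (fst e)) * (E $ snd e + s * u (snd e)) * th (fst e) (snd e))" for s
      by (simp add: hamiltonian_p_def Let_def v th_def case_prod_beta)
    show ?thesis
      unfolding eq
      by (rule derivative_eq_intros refl | simp)+ (simp add: algebra_simps)
  qed
  ultimately have "grad (hamiltonian_p pm) ?x \<bullet> ?h =
      1/2 * (\<Sum>j\<in>UNIV. Bc pm j j * (2 * E $ j * u j))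
      - (\<Sum>e\<in>edges pm. Bc pm (fst e) (snd e) * (u (fst e) * E $ snd e + E $ fst e * u (snd e)) * th (fst e) (snd e))"
    by (rule DERIV_unique)
  moreover have "(\<Sum>j\<in>UNIV. Bc pm j j * (2 * E $ j * u j)) = 2 * Bc pm n n * E $ n"
    by (simp add: u_def if_distrib[of "\<lambda>a. _ * a"] cong: if_cong)
  moreover have "(\<Sum>e\<in>edges pm. Bc pm (fst e) (snd e) * (u (fst e) * E $ snd e + E $ fst e * u (snd e)) * th (fst e) (snd e))
      = (\<Sum>j\<in>neighbours (edges pm) n. Bc pm n j * E $ j * th n j)"
  proof -
    have sym: "Bc pm a b = Bc pm b a" if "(a, b) \<in> edges pm" for a b
      using sa that by (auto simp: standing_assumptions_def adjacency_def)
    have ths: "th a b = th b a" for a b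
      unfolding th_def angle_diff_def by (metis cos_minus minus_diff_eq)
    have "(\<Sum>e\<in>edges pm. Bc pm (fst e) (snd e) * (u (fst e) * E $ snd e + E $ fst e * u (snd e)) * th (fst e) (snd e))
      = (\<Sum>(a, b)\<in>edges pm. (if a = n then Bc pm n b * E $ b * th n b else 0) + (if b = n then Bc pm n a * E $ a * th n a else 0))"
      unfolding case_prod_beta
    proof (rule sum.cong[OF refl])
      fix e assume "e \<in> edges pm"
      then have "Bc pm (fst e) (snd e) = Bc pm (snd e) (fst e)" by (intro sym) simp
      then show "Bc pm (fst e) (snd e) * (u (fst e) * E $ snd e + E $ fst e * u (snd e)) * th (fst e) (snd e)
        = (if fst e = n then Bc pm n (snd e) * E $ snd e * th n (snd e) else 0)
          + (if snd e = n then Bc pm n (fst e) * E $ fst e * th n (fst e) else 0)"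
        using ths[of "fst e" "snd e"] by (auto simp: u_def algebra_simps)
    qed
    also have "\<dots> = (\<Sum>j\<in>neighbours (edges pm) n. Bc pm n j * E $ j * th n j)"
      using sa by (intro sum_neighbours) (simp add: standing_assumptions_def)
    finally show ?thesis .
  qed
  moreover have "grad (hamiltonian_p pm) ?x \<bullet> ?h = snd (snd (snd (grad (hamiltonian_p pm) ?x))) $ i"
    by (simp add: inner_prod_def inner_axis)
  ultimately have "snd (snd (snd (grad (hamiltonian_p pm) ?x))) $ i
      = Bc pm n n * E $ n - (\<Sum>j\<in>neighbours (edges pm) n. Bc pm n j * E $ j * th n j)"
    by simp
  moreover have "E $ n = El $ i" by (simp add: E_def n_def)
  ultimately show ?thesis
    by (simp add: reactive_power_def E_def[symmetric] n_def[symmetric] th_def right_diff_distrib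
        power2_eq_square sum_distrib_left mult_ac)
qed

section \<open>The shifted Hamiltonian\<close>

lemma hamiltonian_a_shifted_strictly_C2:
  fixes pm :: "('g::finite, 'l::finite, 'k::finite, 'm::finite) power_market"
  assumes "\<And>i. 0 < El $ i"
  shows "strictly_C2 (hamiltonian_a_shifted pm xpbar) (\<phi>, p, Eg, El)"
proof -
  have El: "strictly_C2 (\<lambda>x::('g, 'l, 'k) phys_state. snd (snd (snd x)) $ i) (\<phi>, p, Eg, El)" for i
    by (rule strictly_C2_linear) (simp add: linear_conv_bounded_linear[symmetric] linear_iff)
  have eq: "hamiltonian_a_shifted pm xpbar = (\<lambda>x. 
      (\<Sum>i\<in>UNIV. snd (snd (snd x)) $ i * snd (snd (snd (grad (hamiltonian_p pm) xpbar))) $ i)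
      - (\<Sum>i\<in>UNIV. Qbar pm $ i * ln (snd (snd (snd x)) $ i)))"
    by (auto simp: hamiltonian_a_shifted_def fun_eq_iff inner_vec_def case_prod_beta)
  show ?thesis
    unfolding eq
    by (intro strictly_C2_diff strictly_C2_sum strictly_C2_mult strictly_C2_const strictly_C2_ln El)
      (simp add: assms)
qed

lemma hamiltonian_a_shifted_grad:
  fixes pm :: "('g::finite, 'l::finite, 'k::finite, 'm::finite) power_market"
  assumes "\<And>i. 0 < El $ i"
  shows "grad (hamiltonian_a_shifted pm xpbar) (\<phi>, p, Eg, El)
    = (0, 0, 0, snd (snd (snd (grad (hamiltonian_p pm) xpbar))) - (\<chi> i. Qbar pm $ i / El $ i))"
proof (rule grad_eq)
  let ?D = "snd (snd (snd (grad (hamiltonian_p pm) xpbar)))"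
  have eq: "hamiltonian_a_shifted pm xpbar = (\<lambda>x. 
      snd (snd (snd x)) \<bullet> ?D - (\<Sum>i\<in>UNIV. Qbar pm $ i * ln (snd (snd (snd x)) $ i)))"
    by (auto simp: hamiltonian_a_shifted_def fun_eq_iff inner_vec_def case_prod_beta)
  have comp: "((\<lambda>x::('g, 'l, 'k) phys_state. snd (snd (snd x)) $ i) has_derivative (\<lambda>h. snd (snd (snd h)) $ i)) F" for i F
    by (rule bounded_linear_imp_has_derivative) (simp add: linear_conv_bounded_linear[symmetric] linear_iff)
  have "((\<lambda>x. snd (snd (snd x)) \<bullet> ?D) has_derivative (\<lambda>h. snd (snd (snd h)) \<bullet> ?D)) (at (\<phi>, p, Eg, El))"
    by (rule bounded_linear_imp_has_derivative)
      (simp add: linear_conv_bounded_linear[symmetric] linear_iff inner_add_left)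
  moreover have "((\<lambda>x. \<Sum>i\<in>UNIV. Qbar pm $ i * ln (snd (snd (snd x)) $ i)) has_derivative
      (\<lambda>h. \<Sum>i\<in>UNIV. Qbar pm $ i * (snd (snd (snd h)) $ i / El $ i))) (at (\<phi>, p, Eg, El))"
  proof (intro has_derivative_sum has_derivative_mult_right)
    fix i
    show "((\<lambda>x. ln (snd (snd (snd x)) $ i)) has_derivative (\<lambda>h. snd (snd (snd h)) $ i / El $ i)) (at (\<phi>, p, Eg, El))"
      by (rule has_derivative_eq_rhs[OF has_derivative_ln[OF _ comp]]) (simp_all add: assms field_simps fun_eq_iff)
  qed
  ultimately have "((hamiltonian_a_shifted pm xpbar) has_derivative
      (\<lambda>h. snd (snd (snd h)) \<bullet> ?D - (\<Sum>i\<in>UNIV. Qbar pm $ i * (snd (snd (snd h)) $ i / El $ i)))) (at (\<phi>, p, Eg, El))"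
    unfolding eq by (rule has_derivative_diff)
  then show "GDERIV (hamiltonian_a_shifted pm xpbar) (\<phi>, p, Eg, El) :> (0, 0, 0, ?D - (\<chi> i. Qbar pm $ i / El $ i))"
    unfolding gderiv_def
    by (rule has_derivative_eq_rhs)
      (auto simp: fun_eq_iff inner_prod_def inner_vec_def algebra_simps sum_subtractf)
qed

lemma shifted_strictly_C2:
  assumes "strictly_C2 f x" shows "strictly_C2 (shifted f b) x"
proof -
  have "strictly_C2 (\<lambda>x. f x - (x \<bullet> grad f b - b \<bullet> grad f b) - f b) x"
    by (intro strictly_C2_diff strictly_C2_const strictly_C2_linear bounded_linear_inner_left assms)
  then show ?thesis by (simp add: shifted_def[abs_def] inner_diff_left)
qed

lemma shifted_grad:
  assumes "strictly_C2 f x" shows "grad (shifted f b) x = grad f x - grad f b"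
proof (rule grad_eq)
  have "((\<lambda>x. f x - (x - b) \<bullet> grad f b - f b) has_derivative (\<lambda>h. h \<bullet> grad f x - h \<bullet> grad f b)) (at x)"
    using strictly_C2_grad(3)[OF assms] unfolding gderiv_def
    by (auto intro!: derivative_eq_intros)
  then show "GDERIV (shifted f b) x :> grad f x - grad f b"
    by (simp add: gderiv_def shifted_def[abs_def] inner_diff_right)
qed

lemma hamiltonian_shifted_eq:
  "hamiltonian_shifted pm (xcb, xpb) = (\<lambda>x.
     shifted (hamiltonian_p pm) xpb (snd x) + hamiltonian_a_shifted pm xpb (snd x)
     + shifted (hamiltonian_c pm) xcb (fst x))"
  by (auto simp: hamiltonian_shifted_def)

lemma hamiltonian_shifted_strictly_C2:
  assumes "standing_assumptions pm" and "\<And>i. 0 < El $ i"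
  shows "strictly_C2 (hamiltonian_shifted pm (xcb, xpb)) (xc, \<phi>, p, Eg, El)"
  unfolding hamiltonian_shifted_eq
  by (intro strictly_C2_add strictly_C2_compose_linear[OF bounded_linear_fst] strictly_C2_compose_linear[OF bounded_linear_snd])
    (simp_all add: shifted_strictly_C2 hamiltonian_p_strictly_C2 hamiltonian_c_strictly_C2
      hamiltonian_a_shifted_strictly_C2 assms)

lemma hamiltonian_shifted_grad:
  assumes sa: "standing_assumptions pm" and El: "\<And>i. 0 < El $ i"
  shows "grad (hamiltonian_shifted pm (xcb, xpb)) (xc, \<phi>, p, Eg, El) =
    (tau_c_inv pm (xc - xcb),
     grad (hamiltonian_p pm) (\<phi>, p, Eg, El) - grad (hamiltonian_p pm) xpb
     + (0, 0, 0, snd (snd (snd (grad (hamiltonian_p pm) xpb))) - (\<chi> i. Qbar pm $ i / El $ i)))"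
    (is "_ = (?gc, ?gp)")
proof (rule grad_eq)
  let ?xp = "(\<phi>, p, Eg, El)"
  have "GDERIV (shifted (hamiltonian_p pm) xpb) ?xp :> grad (hamiltonian_p pm) ?xp - grad (hamiltonian_p pm) xpb"
    using strictly_C2_grad(3)[OF shifted_strictly_C2[OF hamiltonian_p_strictly_C2[OF sa]]]
    by (simp add: shifted_grad hamiltonian_p_strictly_C2[OF sa])
  moreover have "GDERIV (hamiltonian_a_shifted pm xpb) ?xp :>
     (0, 0, 0, snd (snd (snd (grad (hamiltonian_p pm) xpb))) - (\<chi> i. Qbar pm $ i / El $ i))"
    using strictly_C2_grad(3)[OF hamiltonian_a_shifted_strictly_C2[OF El]]
    by (simp add: hamiltonian_a_shifted_grad[OF El])
  ultimately have P: "GDERIV (\<lambda>y. shifted (hamiltonian_p pm) xpb y + hamiltonian_a_shifted pm xpb y) ?xp :> ?gp"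
    by (rule GDERIV_add)
  have "grad (shifted (hamiltonian_c pm) xcb) xc = ?gc"
    by (simp add: shifted_grad hamiltonian_c_strictly_C2 hamiltonian_c_grad[OF sa] linear_diff[OF tau_c_inv_linear])
  then have Cg: "GDERIV (shifted (hamiltonian_c pm) xcb) xc :> ?gc"
    using strictly_C2_grad(3)[OF shifted_strictly_C2[OF hamiltonian_c_strictly_C2]] by metis
  have "((\<lambda>x. (shifted (hamiltonian_p pm) xpb (snd x) + hamiltonian_a_shifted pm xpb (snd x))
     + shifted (hamiltonian_c pm) xcb (fst x)) has_derivative (\<lambda>h. snd h \<bullet> ?gp + fst h \<bullet> ?gc)) (at (xc, ?xp))"
    using has_derivative_compose[OF has_derivative_snd[OF has_derivative_ident], of _ "\<lambda>h. h \<bullet> ?gp" "(xc, ?xp)" UNIV]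
      has_derivative_compose[OF has_derivative_fst[OF has_derivative_ident], of _ "\<lambda>h. h \<bullet> ?gc" "(xc, ?xp)" UNIV]
      P Cg unfolding gderiv_def by (intro has_derivative_add) auto
  then show "GDERIV (hamiltonian_shifted pm (xcb, xpb)) (xc, ?xp) :> (?gc, ?gp)"
    unfolding gderiv_def hamiltonian_shifted_eq
    by (rule has_derivative_eq_rhs) (auto simp: fun_eq_iff inner_Pair_0 inner_prod_def)
qed

section \<open>The closed loop\<close>

text \<open>
  The linear part of the closed loop: the structure matrix applied to the gradient, without the row
  of the algebraic equations. Here \<open>w\<close> is minus the deviation of the load frequencies.
\<close>

definition interconnection ::
  "('g::finite, 'l::finite, 'k::finite, 'm::finite) power_market \<Rightarrow>
   ('g, 'l, 'k, 'm) state \<Rightarrow> ('g, 'l, 'k, 'm) state" where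
  "interconnection pm = (\<lambda>((a, b, c, d, e), h\<phi>, hp, hEg, hEl).
     (let Ali = matrix_inv (diag_mat (load_part (An pm)));
          w = Ali *v (b + load_part (Dhat pm) *v h\<phi>)
      in ((d - hp, - e - w,
           - (transpose (gen_part (Dc pm)) *v d) - transpose (load_part (Dc pm)) *v e,
           - a + gen_part (Dc pm) *v c, b + load_part (Dc pm) *v c),
          - (transpose (load_part (Dhat pm)) *v w) + transpose (gen_part (Dhat pm)) *v hp,
          a - gen_part (Dhat pm) *v h\<phi> - diag_mat (gen_part (An pm)) *v hp,
          - (diag_mat (\<chi> i. (Xd pm $ i - Xd' pm $ i) / Tg pm $ i) *v hEg),
          0)))"

lemma interconnection_linear: "linear (interconnection pm)"
  by (rule linearI)
    (auto simp: interconnection_def Let_def case_prod_beta matrix_vector_right_distrib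
      matrix_vector_mult_scaleR algebra_simps simp del: transpose_matrix_vector)

lemma shifted_field_eq:
  assumes "grad (hamiltonian_shifted pm xbar) (xc, \<phi>, p, Eg, El) = (hc, h\<phi>, hp, hEg, hEl)"
  shows "shifted_field pm xbar (xc, \<phi>, p, Eg, El) = interconnection pm (hc, h\<phi>, hp, hEg, hEl)
    + (grad (welfare pm) (tau_c_inv pm xc) - grad (welfare pm) (tau_c_inv pm (fst xbar)),
       0, 0, 0, - (diag_mat El *v hEl))"
proof -
  obtain a b c d e where hc: "hc = (a, b, c, d, e)" by (metis prod_cases5)
  show ?thesis
    unfolding shifted_field_def Let_def prod.case assms
    by (simp add: hc interconnection_def Let_def Jc_def G1_def G2_def G1T_def G2T_def
        matrix_vector_right_distrib algebra_simps del: transpose_matrix_vector)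
qed

text \<open>
  The skew-symmetric entries cancel in pairs; the load damping terms complete a square.
\<close>

lemma interconnection_power:
  "(((a, b, c, d, e), h\<phi>, hp, hEg, hEl) :: ('g::finite, 'l::finite, 'k::finite, 'm::finite) state)
     \<bullet> interconnection pm ((a, b, c, d, e), h\<phi>, hp, hEg, hEl)
   = - ((b + load_part (Dhat pm) *v h\<phi>) \<bullet>
        (matrix_inv (diag_mat (load_part (An pm))) *v (b + load_part (Dhat pm) *v h\<phi>)))
     - hp \<bullet> (diag_mat (gen_part (An pm)) *v hp)
     - hEg \<bullet> (diag_mat (\<chi> i. (Xd pm $ i - Xd' pm $ i) / Tg pm $ i) *v hEg)"
proof -
  define w where "w = matrix_inv (diag_mat (load_part (An pm))) *v (b + load_part (Dhat pm) *v h\<phi>)"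
  show ?thesis
    unfolding interconnection_def Let_def prod.case w_def[symmetric]
    by (simp add: inner_diff_right inner_add_right inner_add_left inner_transpose_mult inner_commute
        del: transpose_matrix_vector)
qed

lemma welfare_grad:
  assumes "standing_assumptions pm"
  shows "grad (welfare pm) z = (- grad (cost pm) (fst z), grad (utility pm) (fst (snd z)), 0, 0, 0)"
proof (rule grad_eq)
  have C: "GDERIV (cost pm) x :> grad (cost pm) x" for x
    using assms by (intro twice_continuously_differentiable_grad) (simp add: standing_assumptions_def)
  have U: "GDERIV (utility pm) x :> grad (utility pm) x" for x
    using assms by (intro twice_continuously_differentiable_grad) (simp add: standing_assumptions_def)
  have "((\<lambda>z. utility pm (fst (snd z)) - cost pm (fst z)) has_derivative
      (\<lambda>h. fst (snd h) \<bullet> grad (utility pm) (fst (snd z)) - fst h \<bullet> grad (cost pm) (fst z))) (at z)"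
    using has_derivative_compose[OF has_derivative_fst[OF has_derivative_snd[OF has_derivative_ident]] U[unfolded gderiv_def]]
      has_derivative_compose[OF has_derivative_fst[OF has_derivative_ident] C[unfolded gderiv_def]]
    by (rule has_derivative_diff)
  moreover have "welfare pm = (\<lambda>z. utility pm (fst (snd z)) - cost pm (fst z))"
    by (auto simp: welfare_def)
  ultimately show "GDERIV (welfare pm) z :> (- grad (cost pm) (fst z), grad (utility pm) (fst (snd z)), 0, 0, 0)"
    unfolding gderiv_def by (auto elim!: has_derivative_eq_rhs simp: inner_prod_def)
qed

lemma cost_grad_monotone:
  assumes "standing_assumptions pm"
  shows "x \<noteq> y \<Longrightarrow> 0 < (grad (cost pm) x - grad (cost pm) y) \<bullet> (x - y)"
  using assms
  by (intro strictly_convex_grad_strictly_monotone[of "cost pm"] twice_continuously_differentiable_grad)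
    (simp_all add: standing_assumptions_def)

lemma utility_grad_monotone:
  assumes "standing_assumptions pm" and "x \<noteq> y"
  shows "(grad (utility pm) x - grad (utility pm) y) \<bullet> (x - y) < 0"
proof -
  have "GDERIV (\<lambda>x. - utility pm x) x :> - grad (utility pm) x" for x
    using assms(1) by (intro GDERIV_minus twice_continuously_differentiable_grad) (simp add: standing_assumptions_def)
  moreover have "strictly_convex (\<lambda>x. - utility pm x)"
    using assms(1) by (simp add: standing_assumptions_def strictly_concave_def)
  ultimately have "0 < (- grad (utility pm) x - - grad (utility pm) y) \<bullet> (x - y)"
    using assms(2) strictly_convex_grad_strictly_monotone[of "\<lambda>x. - utility pm x" "\<lambda>x. - grad (utility pm) x"] by blast
  then show ?thesis by (simp add: inner_diff_left)
qed

text \<open>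
  The gradient of the cost and the negative gradient of the utility are strictly monotone, and the
  market term is minus the sum of the two monotonicity expressions.
\<close>

lemma welfare_dissipation:
  assumes sa: "standing_assumptions pm"
  shows "(z - zb) \<bullet> (grad (welfare pm) z - grad (welfare pm) zb) \<le> 0"
    and "(z - zb) \<bullet> (grad (welfare pm) z - grad (welfare pm) zb) = 0 \<Longrightarrow>
      fst z = fst zb \<and> fst (snd z) = fst (snd zb)"
proof -
  have eq: "(z - zb) \<bullet> (grad (welfare pm) z - grad (welfare pm) zb) =
    - ((grad (cost pm) (fst z) - grad (cost pm) (fst zb)) \<bullet> (fst z - fst zb))
    + (grad (utility pm) (fst (snd z)) - grad (utility pm) (fst (snd zb))) \<bullet> (fst (snd z) - fst (snd zb))"
    by (simp add: welfare_grad[OF sa] inner_prod_def inner_diff_left inner_diff_right inner_commute)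
  have C: "0 \<le> (grad (cost pm) (fst z) - grad (cost pm) (fst zb)) \<bullet> (fst z - fst zb)"
    using cost_grad_monotone[OF sa, of "fst z" "fst zb"] by (cases "fst z = fst zb") auto
  have U: "(grad (utility pm) (fst (snd z)) - grad (utility pm) (fst (snd zb))) \<bullet> (fst (snd z) - fst (snd zb)) \<le> 0"
    using utility_grad_monotone[OF sa, of "fst (snd z)" "fst (snd zb)"] by (cases "fst (snd z) = fst (snd zb)") auto
  show "(z - zb) \<bullet> (grad (welfare pm) z - grad (welfare pm) zb) \<le> 0"
    using eq C U by linarith
  assume 0: "(z - zb) \<bullet> (grad (welfare pm) z - grad (welfare pm) zb) = 0"
  then have "\<not> 0 < (grad (cost pm) (fst z) - grad (cost pm) (fst zb)) \<bullet> (fst z - fst zb)"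
    "\<not> (grad (utility pm) (fst (snd z)) - grad (utility pm) (fst (snd zb))) \<bullet> (fst (snd z) - fst (snd zb)) < 0"
    using eq C U by linarith+
  then show "fst z = fst zb \<and> fst (snd z) = fst (snd zb)"
    using cost_grad_monotone[OF sa] utility_grad_monotone[OF sa] by blast
qed

lemma matrix_inv_mult_eq_0:
  "sym_pos_def_matrix A \<Longrightarrow> matrix_inv A *v x = 0 \<longleftrightarrow> x = 0"
  by (metis positive_definite_matrix_inv(1) matrix_vector_mult_0_right)

lemma tau_c_inv_components:
  assumes "standing_assumptions pm"
  shows "fst (tau_c_inv pm x) = 0 \<longleftrightarrow> fst x = 0"
    and "fst (snd (tau_c_inv pm x)) = 0 \<longleftrightarrow> fst (snd x) = 0"
    and "snd (snd (snd (tau_c_inv pm x))) = 0 \<longleftrightarrow> snd (snd (snd x)) = 0"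
  using assms
  by (simp_all add: tau_c_inv_def case_prod_beta standing_assumptions_def prod_eq_iff matrix_inv_mult_eq_0)

lemma open_state_space: "open (state_space :: ('g::finite, 'l::finite, 'k::finite, 'm::finite) state set)"
proof -
  have eq: "(state_space :: ('g, 'l, 'k, 'm) state set) = (\<Inter>i\<in>UNIV. {x::('g, 'l, 'k, 'm) state. 0 < fst (snd (snd (snd x))) $ i})
      \<inter> (\<Inter>i\<in>UNIV. {x. 0 < snd (snd (snd (snd x))) $ i})"
    by (auto simp: state_space_def)
  show ?thesis
    unfolding eq by (intro open_Int open_INT ballI open_Collect_less continuous_intros finite)
qed

lemma differential_part_linear: "linear differential_part"
  by (rule linearI) (auto simp: differential_part_def)

text \<open>
  Shifting removes the gradient in all components but that of \<open>E\<^sub>l\<close>, where the reactive power balance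
  equates \<open>\<nabla>H\<^sub>p\<close> with the gradient \<open>Q / E\<^sub>l\<close> of the logarithmic term.
\<close>

lemma hamiltonian_shifted_grad_equilibrium:
  assumes sa: "standing_assumptions pm" and eq: "closed_loop_equilibrium pm xbar wl"
  shows "grad (hamiltonian_shifted pm xbar) xbar = 0"
proof -
  obtain xc \<phi> p Eg El where xbar: "xbar = (xc, \<phi>, p, Eg, El)" by (metis prod_cases5)
  obtain Pg Pl v lg ll where "tau_c_inv pm xc = (Pg, Pl, v, lg, ll)" by (metis prod_cases5)
  with eq have El: "0 < El $ i" and "network_field pm (\<phi>, p, Eg, El) wl Pg Pl = 0" for i
    by (auto simp: closed_loop_equilibrium_def xbar)
  then have Q: "Qbar pm $ i = reactive_power pm \<phi> (voltages Eg El) $ Inr i" for i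
    by (auto simp: network_field_def Let_def zero_prod_def vec_eq_iff)
  have "snd (snd (snd (grad (hamiltonian_p pm) (\<phi>, p, Eg, El)))) = (\<chi> i. Qbar pm $ i / El $ i)"
    using hamiltonian_p_grad_load_voltage[OF sa, of El _ \<phi> p Eg] El
    by (simp add: vec_eq_iff Q field_simps less_imp_neq[symmetric])
  then show ?thesis
    unfolding xbar by (simp add: hamiltonian_shifted_grad[OF sa El] linear_0[OF tau_c_inv_linear])
      (simp add: zero_prod_def)
qed

lemma closed_loop_field_strictly_differentiable:
  assumes sa: "standing_assumptions pm" and "strictly_C2 (hamiltonian_shifted pm xbar) xbar"
  shows "strictly_differentiable (\<lambda>x. differential_part (shifted_field pm xbar x)) xbar"
proof -
  let ?g = "grad (hamiltonian_shifted pm xbar)"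
  define zb where "zb = tau_c_inv pm (fst xbar)"
  define Cx where "Cx x = - grad (cost pm) (fst (tau_c_inv pm (fst x))) + grad (cost pm) (fst zb)"
    for x :: "('a, 'b, 'c, 'd) state"
  define Ux where "Ux x = grad (utility pm) (fst (snd (tau_c_inv pm (fst x)))) + - grad (utility pm) (fst (snd zb))"
    for x :: "('a, 'b, 'c, 'd) state"
  have eq: "differential_part (shifted_field pm xbar x) =
      interconnection pm (?g x) + ((Cx x, Ux x, 0, 0, 0), 0, 0, 0, 0)" for x
  proof -
    obtain xc \<phi> p Eg El where x: "x = (xc, \<phi>, p, Eg, El)" by (metis prod_cases5)
    obtain hc h\<phi> hp hEg hEl where h: "?g x = (hc, h\<phi>, hp, hEg, hEl)" by (metis prod_cases5)
    have "snd (snd (snd (snd (interconnection pm (?g x))))) = 0"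
      by (simp add: interconnection_def Let_def case_prod_beta)
    moreover have "shifted_field pm xbar x = interconnection pm (?g x)
        + (grad (welfare pm) (tau_c_inv pm xc) - grad (welfare pm) (tau_c_inv pm (fst xbar)), 0, 0, 0, - (diag_mat El *v hEl))"
      using shifted_field_eq[OF h[unfolded x]] h x by simp
    moreover have "xc = fst x" by (simp add: x)
    ultimately show ?thesis
      by (simp add: differential_part_def case_prod_beta welfare_grad[OF sa] Cx_def Ux_def zb_def prod_eq_iff)
  qed
  have blt: "bounded_linear (tau_c_inv pm)"
    using tau_c_inv_linear[of pm] by (simp add: linear_conv_bounded_linear)
  have tcd: "twice_continuously_differentiable (cost pm)" "twice_continuously_differentiable (utility pm)"
    using sa by (simp_all add: standing_assumptions_def)
  have Pg: "bounded_linear (\<lambda>x::('a, 'b, 'c, 'd) state. fst (tau_c_inv pm (fst x)))"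
    by (rule bounded_linear_compose[OF bounded_linear_fst bounded_linear_compose[OF blt bounded_linear_fst]])
  have Pl: "bounded_linear (\<lambda>x::('a, 'b, 'c, 'd) state. fst (snd (tau_c_inv pm (fst x))))"
    by (rule bounded_linear_compose[OF bounded_linear_fst bounded_linear_compose[OF bounded_linear_snd
            bounded_linear_compose[OF blt bounded_linear_fst]]])
  have "strictly_differentiable (\<lambda>x. - grad (cost pm) (fst (tau_c_inv pm (fst x)))) xbar"
    by (rule strictly_differentiable_compose[OF strictly_differentiable_compose[OF
            strictly_differentiable_linear[OF Pg] twice_continuously_differentiable_grad(2)[OF tcd(1)]]
          strictly_differentiable_linear[OF bounded_linear_minus[OF bounded_linear_ident]]])
  then have Cd: "strictly_differentiable Cx xbar"
    unfolding Cx_def by (rule strictly_differentiable_add[OF _ strictly_differentiable_const])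
  have "strictly_differentiable (\<lambda>x. grad (utility pm) (fst (snd (tau_c_inv pm (fst x))))) xbar"
    by (rule strictly_differentiable_compose[OF strictly_differentiable_linear[OF Pl]
          twice_continuously_differentiable_grad(2)[OF tcd(2)]])
  then have Ud: "strictly_differentiable Ux xbar"
    unfolding Ux_def by (rule strictly_differentiable_add[OF _ strictly_differentiable_const])
  have "strictly_differentiable (\<lambda>x. interconnection pm (?g x)) xbar"
    using strictly_differentiable_compose[OF strictly_C2_grad(2)[OF assms(2)]
        strictly_differentiable_linear[OF linear_conv_bounded_linear[THEN iffD1, OF interconnection_linear]]] .
  then show ?thesis
    unfolding eq
    by (intro strictly_differentiable_add strictly_differentiable_Pair strictly_differentiable_const Cd Ud)
qed

theorem theorem7:
  fixes pm :: "('g::finite, 'l::finite, 'k::finite, 'm::finite) power_market"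
    and xbar :: "('g, 'l, 'k, 'm) state"
    and omega_l_bar :: "real^'l"
  assumes "standing_assumptions pm"
    and "closed_loop_equilibrium pm xbar omega_l_bar"
    and "CARD('m) + 1 = CARD('g + 'l)"
    and "tree_graph (comm_edges pm)"
    and "positive_definite (hessian (hamiltonian_shifted pm xbar) xbar)"
  shows "locally_asymptotically_stable_equilibrium
           differential_part (shifted_field pm xbar) state_space xbar"
proof -
  note sa = assms(1)
  let ?V = "hamiltonian_shifted pm xbar" and ?F = "shifted_field pm xbar"
  let ?P = "differential_part :: ('g, 'l, 'k, 'm) state \<Rightarrow> ('g, 'l, 'k, 'm) state"
  define Dl where "Dl = load_part (Dhat pm)"
  define Dg where "Dg = gen_part (Dhat pm)"
  define Ali where "Ali = matrix_inv (diag_mat (load_part (An pm)))"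
  define Ag where "Ag = diag_mat (gen_part (An pm))"
  define Rg where "Rg = diag_mat (\<chi> i. (Xd pm $ i - Xd' pm $ i) / Tg pm $ i)"
  have Al: "sym_pos_def_matrix (diag_mat (load_part (An pm)))"
    using sa by (intro diag_mat_positive_definite) (simp add: load_part_def standing_assumptions_def)
  have Ag: "sym_pos_def_matrix Ag"
    unfolding Ag_def using sa by (intro diag_mat_positive_definite) (simp add: gen_part_def standing_assumptions_def)
  have Rg: "sym_pos_def_matrix Rg"
    unfolding Rg_def using sa by (intro diag_mat_positive_definite) (simp add: standing_assumptions_def)
  obtain xcb \<phi>b pb Egb Elb where xbar: "xbar = (xcb, \<phi>b, pb, Egb, Elb)" by (metis prod_cases5)
  have in_\<Omega>: "xbar \<in> state_space"
    using assms(2) by (auto simp: closed_loop_equilibrium_def xbar state_space_def split: prod.splits)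
  then have Elb: "0 < Elb $ i" for i by (simp add: xbar state_space_def)
  have C2: "strictly_C2 ?V xbar"
    unfolding xbar by (rule hamiltonian_shifted_strictly_C2[OF sa Elb])
  have crit: "grad ?V xbar = 0"
    by (rule hamiltonian_shifted_grad_equilibrium[OF sa assms(2)])
  have diff_part: "?P x = x \<longleftrightarrow> snd (snd (snd (snd x))) = 0" for x
    by (auto simp: differential_part_def case_prod_beta prod_eq_iff)
  have P_idem: "?P (?P x) = ?P x" for x
    by (simp add: differential_part_def case_prod_beta)
  have analysis:
    "?F x \<in> range ?P \<longleftrightarrow> hEl = 0"
    "hc = tau_c_inv pm (fst x - xcb)"
    "hp = (\<chi> i. (fst (snd (snd x)) $ i - pb $ i) / Mg pm $ i)"
    "?F x = interconnection pm (hc, h\<phi>, hp, hEg, hEl)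
      + (grad (welfare pm) (tau_c_inv pm (fst x)) - grad (welfare pm) (tau_c_inv pm xcb), 0, 0, 0,
         - (diag_mat (snd (snd (snd (snd x)))) *v hEl))"
    if x: "x \<in> state_space" and h: "grad ?V x = (hc, h\<phi>, hp, hEg, hEl)" for x hc h\<phi> hp hEg hEl
  proof -
    obtain xc \<phi> p Eg El where x_eq: "x = (xc, \<phi>, p, Eg, El)" by (metis prod_cases5)
    have El: "0 < El $ i" for i using x by (simp add: x_eq state_space_def)
    have g: "(hc, h\<phi>, hp, hEg, hEl) = (tau_c_inv pm (xc - xcb),
     grad (hamiltonian_p pm) (\<phi>, p, Eg, El) - grad (hamiltonian_p pm) (\<phi>b, pb, Egb, Elb)
     + (0, 0, 0, snd (snd (snd (grad (hamiltonian_p pm) (\<phi>b, pb, Egb, Elb)))) - (\<chi> i. Qbar pm $ i / El $ i)))"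
      using h hamiltonian_shifted_grad[OF sa El, of xcb "(\<phi>b, pb, Egb, Elb)" xc \<phi> p Eg] by (simp add: x_eq xbar)
    from arg_cong[OF g, of fst] show "hc = tau_c_inv pm (fst x - xcb)" by (simp add: x_eq)
    from arg_cong[OF g, of "\<lambda>y. fst (snd (snd y))"]
    show "hp = (\<chi> i. (fst (snd (snd x)) $ i - pb $ i) / Mg pm $ i)"
      by (simp add: x_eq hamiltonian_p_grad_momentum[OF sa] vec_eq_iff diff_divide_distrib)
    show F: "?F x = interconnection pm (hc, h\<phi>, hp, hEg, hEl)
      + (grad (welfare pm) (tau_c_inv pm (fst x)) - grad (welfare pm) (tau_c_inv pm xcb), 0, 0, 0,
         - (diag_mat (snd (snd (snd (snd x)))) *v hEl))"
      using shifted_field_eq[of pm xbar xc \<phi> p Eg El hc h\<phi> hp hEg hEl] h by (simp add: x_eq xbar)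
    have "snd (snd (snd (snd (interconnection pm (hc, h\<phi>, hp, hEg, hEl))))) = 0"
      by (simp add: interconnection_def Let_def case_prod_beta)
    then have last: "snd (snd (snd (snd (?F x)))) = - (diag_mat El *v hEl)" using F by (simp add: x_eq)
    have diag: "diag_mat El *v hEl = 0 \<longleftrightarrow> hEl = 0"
      using sym_pos_def_matrix_nonneg(2)[OF diag_mat_positive_definite[OF El], of hEl] by auto
    have range: "?F x \<in> range ?P \<longleftrightarrow> ?P (?F x) = ?F x"
    proof
      assume "?F x \<in> range ?P"
      then obtain y where y: "?F x = ?P y" by (rule rangeE)
      show "?P (?F x) = ?F x" unfolding y by (rule P_idem)
    next
      assume "?P (?F x) = ?F x"
      then show "?F x \<in> range ?P" by (rule range_eqI[OF sym])
    qed
    show "?F x \<in> range ?P \<longleftrightarrow> hEl = 0"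
      unfolding range diff_part last neg_equal_0_iff_equal by (rule diag)
  qed
  have power: "grad ?V x \<bullet> ?F x =
      - ((b + Dl *v h\<phi>) \<bullet> (Ali *v (b + Dl *v h\<phi>))) - hp \<bullet> (Ag *v hp) - hEg \<bullet> (Rg *v hEg)
      + (tau_c_inv pm (fst x) - tau_c_inv pm xcb) \<bullet>
        (grad (welfare pm) (tau_c_inv pm (fst x)) - grad (welfare pm) (tau_c_inv pm xcb))"
    if x: "x \<in> state_space" and h: "grad ?V x = ((a, b, c, d, e), h\<phi>, hp, hEg, 0)" for x a b c d e h\<phi> hp hEg
  proof -
    define dW where "dW = grad (welfare pm) (tau_c_inv pm (fst x)) - grad (welfare pm) (tau_c_inv pm xcb)"
    have hc: "(a, b, c, d, e) = tau_c_inv pm (fst x) - tau_c_inv pm xcb"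
      using analysis(2)[OF x h] by (simp add: linear_diff[OF tau_c_inv_linear])
    have F: "?F x = interconnection pm ((a, b, c, d, e), h\<phi>, hp, hEg, 0) + (dW, 0, 0, 0, 0)"
      using analysis(4)[OF x h] by (simp add: dW_def)
    have W: "((a, b, c, d, e), h\<phi>, hp, hEg, 0 :: real^'l) \<bullet> (dW, 0, 0, 0, 0) = (a, b, c, d, e) \<bullet> dW"
      by (simp add: inner_prod_def)
    show ?thesis
      unfolding h F inner_add_right W interconnection_power Dl_def Ali_def Ag_def Rg_def dW_def[symmetric]
        hc[symmetric] ..
  qed
  have parts: "0 \<le> (b + Dl *v h\<phi>) \<bullet> (Ali *v (b + Dl *v h\<phi>))" "0 \<le> hp \<bullet> (Ag *v hp)" "0 \<le> hEg \<bullet> (Rg *v hEg)"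
    for b h\<phi> hp hEg
    using matrix_inv_positive_definite(1)[OF Al] sym_pos_def_matrix_nonneg(1)[OF Ag]
      sym_pos_def_matrix_nonneg(1)[OF Rg] by (auto simp: Ali_def)
  show ?thesis
  proof (rule locally_asymptotically_stable_by_shifted_energy[where V = ?V])
    show "linear ?P" by (rule differential_part_linear)
    show "?P (?P x) = ?P x" for x by (rule P_idem)
    show "?P x \<bullet> y = x \<bullet> ?P y" for x y by (simp add: differential_part_def case_prod_beta inner_prod_def)
    show "open (state_space :: ('g, 'l, 'k, 'm) state set)" by (rule open_state_space)
    show "strictly_differentiable (\<lambda>x. ?P (?F x)) xbar"
      by (rule closed_loop_field_strictly_differentiable[OF sa C2])
    show "?F xbar = 0"
      using analysis(4)[OF in_\<Omega>, of 0 0 0 0 0] crit linear_0[OF interconnection_linear]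
      by (simp add: xbar zero_prod_def)
  next
    fix x :: "('g, 'l, 'k, 'm) state" assume x: "x \<in> state_space"
    obtain a b c d e h\<phi> hp hEg hEl where h: "grad ?V x = ((a, b, c, d, e), h\<phi>, hp, hEg, hEl)"
      by (metis prod_cases5)
    show "?F x \<in> range ?P \<longleftrightarrow> ?P (grad ?V x) = grad ?V x"
      using analysis(1)[OF x h] by (simp add: h diff_part)
    assume "?P (grad ?V x) = grad ?V x"
    then have "hEl = 0" by (simp add: h diff_part)
    from power[OF x h[unfolded this]] parts(1)[of b h\<phi>] parts(2)[of hp] parts(3)[of hEg]
      welfare_dissipation(1)[OF sa, of "tau_c_inv pm (fst x)" "tau_c_inv pm xcb"]
    show "grad ?V x \<bullet> ?F x \<le> 0" by linarith
  next
    fix \<Lambda> :: "('g, 'l, 'k, 'm) state set"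
    assume lim: "\<And>z. z \<in> \<Lambda> \<Longrightarrow> z \<in> state_space \<and> ?P (grad ?V z) = grad ?V z \<and> grad ?V z \<bullet> ?F z = 0"
      and inv: "\<And>A a. \<lbrakk>linear A; \<And>z. A (?P z) = A z; \<And>z. z \<in> \<Lambda> \<Longrightarrow> A z = a\<rbrakk>
        \<Longrightarrow> \<forall>z\<in>\<Lambda>. A (?F z) = (0::('g, 'l, 'k, 'm) state)"
    \<comment> \<open>All terms of the power balance have the same sign, so each of them vanishes.\<close>
    have step1: "a = 0 \<and> b = 0 \<and> hp = 0 \<and> hEg = 0 \<and> hEl = 0 \<and> Dl *v h\<phi> = 0
        \<and> fst (fst z) = fst xcb \<and> fst (snd (fst z)) = fst (snd xcb) \<and> fst (snd (snd z)) = pb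
        \<and> ?F z = interconnection pm ((0, 0, c, d, e), h\<phi>, 0, 0, 0)"
      if z: "z \<in> \<Lambda>" and h: "grad ?V z = ((a, b, c, d, e), h\<phi>, hp, hEg, hEl)" for z a b c d e h\<phi> hp hEg hEl
    proof -
      have zS: "z \<in> state_space" and hEl: "hEl = 0" and diss: "grad ?V z \<bullet> ?F z = 0"
        using lim[OF z] by (auto simp: h diff_part)
      note h0 = h[unfolded hEl]
      let ?z = "tau_c_inv pm (fst z)" and ?zb = "tau_c_inv pm xcb"
      have W: "(?z - ?zb) \<bullet> (grad (welfare pm) ?z - grad (welfare pm) ?zb) = 0"
        and "(b + Dl *v h\<phi>) \<bullet> (Ali *v (b + Dl *v h\<phi>)) = 0" "hp \<bullet> (Ag *v hp) = 0" "hEg \<bullet> (Rg *v hEg) = 0"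
        using power[OF zS h0] diss parts(1)[of b h\<phi>] parts(2)[of hp] parts(3)[of hEg]
          welfare_dissipation(1)[OF sa, of ?z ?zb] by linarith+
      then have bD: "b + Dl *v h\<phi> = 0" and hp: "hp = 0" and hEg: "hEg = 0"
        using matrix_inv_positive_definite(2)[OF Al] sym_pos_def_matrix_nonneg(2)[OF Ag]
          sym_pos_def_matrix_nonneg(2)[OF Rg] by (auto simp: Ali_def)
      have hc: "(a, b, c, d, e) = tau_c_inv pm (fst z - xcb)" by (rule analysis(2)[OF zS h])
      then have hc': "(a, b, c, d, e) = ?z - ?zb" by (simp add: linear_diff[OF tau_c_inv_linear])
      have same: "fst ?z = fst ?zb" "fst (snd ?z) = fst (snd ?zb)"
        using welfare_dissipation(2)[OF sa W] by auto
      have a: "a = 0" using arg_cong[OF hc', of fst] same by simp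
      have b: "b = 0" using arg_cong[OF hc', of "\<lambda>y. fst (snd y)"] same by simp
      have "fst (fst z) = fst xcb" "fst (snd (fst z)) = fst (snd xcb)"
        using tau_c_inv_components(1,2)[OF sa, of "fst z - xcb"] a b
        unfolding hc[symmetric] by simp_all
      moreover have "fst (snd (snd z)) = pb"
      proof -
        have "(fst (snd (snd z)) $ i - pb $ i) / Mg pm $ i = 0" for i
          using analysis(3)[OF zS h] hp by (simp add: vec_eq_iff)
        moreover have "Mg pm $ i \<noteq> 0" for i
          using sa unfolding standing_assumptions_def by (metis less_irrefl)
        ultimately show ?thesis by (simp add: vec_eq_iff)
      qed
      moreover have "?F z = interconnection pm ((0, 0, c, d, e), h\<phi>, 0, 0, 0)"
        using analysis(4)[OF zS h] a b hp hEg hEl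
        by (simp add: welfare_grad[OF sa] same) (simp add: zero_prod_def[symmetric])
      ultimately show ?thesis using a b bD hp hEg hEl by simp
    qed
    \<comment> \<open>Generation, demand and generator frequencies are constant on the limit set; their rates of
      change contain the price shifts \<open>d\<close>, \<open>e\<close> and \<open>D\<^sub>g h\<phi>\<close>.\<close>
    define A1 :: "('g, 'l, 'k, 'm) state \<Rightarrow> ('g, 'l, 'k, 'm) state" where
      "A1 x = ((fst (fst x), fst (snd (fst x)), 0, 0, 0), 0, fst (snd (snd x)), 0, 0)" for x
    \<comment> \<open>Now the prices are constant as well, and their rate of change is \<open>D\<^sub>c c\<close>.\<close>
    define A2 :: "('g, 'l, 'k, 'm) state \<Rightarrow> ('g, 'l, 'k, 'm) state" where
      "A2 x = ((0, 0, 0, snd (snd (snd (fst x)))), 0, 0, 0, 0)" for x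
    have A1: "A1 (?F z) = 0" if "z \<in> \<Lambda>" for z
    proof -
      have "A1 z = ((fst xcb, fst (snd xcb), 0, 0, 0), 0, pb, 0, 0)" if "z \<in> \<Lambda>" for z
      proof -
        obtain a b c d e h\<phi> hp hEg hEl where h: "grad ?V z = ((a, b, c, d, e), h\<phi>, hp, hEg, hEl)"
          by (metis prod_cases5)
        show ?thesis using step1[OF that h] by (simp add: A1_def)
      qed
      moreover have "linear A1" by (rule linearI) (auto simp: A1_def)
      moreover have "A1 (?P z) = A1 z" for z by (simp add: A1_def differential_part_def case_prod_beta)
      ultimately show ?thesis using inv that by blast
    qed
    have step2: "d = 0 \<and> e = 0 \<and> h\<phi> = 0 \<and> snd (snd (snd (fst z))) = snd (snd (snd xcb))"
      if z: "z \<in> \<Lambda>" and h: "grad ?V z = ((a, b, c, d, e), h\<phi>, hp, hEg, hEl)" for z a b c d e h\<phi> hp hEg hEl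
    proof -
      note s1 = step1[OF z h]
      have Dl0: "load_part (Dhat pm) *v h\<phi> = 0" using s1 by (simp add: Dl_def)
      have zS: "z \<in> state_space" using lim[OF z] by blast
      have "d = 0" "e = 0" and Dg0: "gen_part (Dhat pm) *v h\<phi> = 0"
        using A1[OF z] s1 Dl0 by (auto simp: A1_def interconnection_def Let_def zero_prod_def)
      moreover have "h\<phi> = 0"
      proof -
        have "rank (Dhat pm) = CARD('k)" using sa by (simp add: standing_assumptions_def)
        then have "inj ((*v) (Dhat pm))" by (simp add: full_rank_injective)
        then show ?thesis using stacked_mult_eq_0[OF Dg0 Dl0] by (metis injD matrix_vector_mult_0_right)
      qed
      moreover have "snd (snd (snd (fst z - xcb))) = 0"
        using tau_c_inv_components(3)[OF sa, of "fst z - xcb"] \<open>d = 0\<close> \<open>e = 0\<close>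
        unfolding analysis(2)[OF zS h, symmetric] by (simp add: zero_prod_def)
      ultimately show ?thesis by simp
    qed
    have A2: "A2 (?F z) = 0" if "z \<in> \<Lambda>" for z
    proof -
      have "A2 z = ((0, 0, 0, snd (snd (snd xcb))), 0, 0, 0, 0)" if "z \<in> \<Lambda>" for z
      proof -
        obtain a b c d e h\<phi> hp hEg hEl where h: "grad ?V z = ((a, b, c, d, e), h\<phi>, hp, hEg, hEl)"
          by (metis prod_cases5)
        show ?thesis using step2[OF that h] by (simp add: A2_def)
      qed
      moreover have "linear A2" by (rule linearI) (auto simp: A2_def zero_prod_def)
      moreover have "A2 (?P z) = A2 z" for z by (simp add: A2_def differential_part_def case_prod_beta)
      ultimately show ?thesis using inv that by blast
    qed
    show "\<forall>z\<in>\<Lambda>. grad ?V z = 0"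
    proof
      fix z assume z: "z \<in> \<Lambda>"
      obtain a b c d e h\<phi> hp hEg hEl where h: "grad ?V z = ((a, b, c, d, e), h\<phi>, hp, hEg, hEl)"
        by (metis prod_cases5)
      note s = step1[OF z h] step2[OF z h]
      have "gen_part (Dc pm) *v c = 0" "load_part (Dc pm) *v c = 0"
        using A2[OF z] s by (auto simp: A2_def interconnection_def Let_def zero_prod_def)
      then have "Dc pm *v c = 0" by (rule stacked_mult_eq_0)
      then have "c = 0"
        using tree_incidence_injective[of "comm_edges pm" "Dc pm" c] sa assms(3)
        by (simp add: standing_assumptions_def)
      then show "grad ?V z = 0" using h s by (simp add: zero_prod_def)
    qed
  qed (use in_\<Omega> C2 crit assms(5) in auto)
qed

end
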